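(* Let $\Omega\subset\mathbb{R}^n$ ($n\geq 2$) be a bounded domain and let $\alpha:\Omega\to(0,1]$ and $\beta:\Omega\to[0,1)$ satisfy $\alpha(x)+\beta(x)=1$ and $0<\alpha_{\min}\leq\alpha(x)\leq 1$ for all $x\in\Omega$, where $\alpha_{\min}$ is a constant. Assume that $\alpha$ is H\"older continuous with exponent $s\in(0,1)$ and constant $C_\alpha>0$, i.e. $|\alpha(x)-\alpha(z)|\leq C_\alpha|x-z|^s$ for all $x,z\in\Omega$. Let $x_0\in\Omega$ and $r>0$ be such that $B_{2r}(x_0)\subset\Omega$, let $\varepsilon>0$, and let $u_\varepsilon$ be a solution of the dynamic programming principle \begin{align*} u_\varepsilon(x)&=\frac12\sup_{|\nu|=\varepsilon}\left(\alpha(x)u_\varepsilon(x+\nu)+\beta(x)\frac{1}{\mathcal{L}^{n-1}(B_\varepsilon^\nu(x))}\int_{B_\varepsilon^\nu(x)}u_\varepsilon\,d\mathcal{L}^{n-1}\right)\\ &\quad+\frac12\inf_{|\nu|=\varepsilon}\left(\alpha(x)u_\varepsilon(x+\nu)+\beta(x)\frac{1}{\mathcal{L}^{n-1}(B_\varepsilon^\nu(x))}\int_{B_\varepsilon^\nu(x)}u_\varepsilon\,d\mathcal{L}^{n-1}\right)\qquad\text{for all }x\in\Omega. \end{align*} Then $$|u_\varepsilon(x)-u_\varepsilon(z)|\leq C\,(|x-z|+\varepsilon)\qquad\text{for all }x,z\in B_r(x_0),$$ for some constant $C>0$ depending only on $\alpha_{\min}$, $C_\alpha$, $s$, $n$,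 $r$ and $\sup_{B_{2r}(x_0)}|u_\varepsilon|$ (in particular, not otherwise on $\varepsilon$ or on $u_\varepsilon$).
   Context: $B_\rho(x)$ is the open ball of radius $\rho$ centered at $x$ in $\mathbb{R}^n$. For $\nu\in\mathbb{R}^n\setminus\{0\}$, $B_\varepsilon^\nu(x)=\{\xi\in\mathbb{R}^n:|\xi-x|<\varepsilon,\ \langle\nu,\xi-x\rangle=0\}$ is the $(n-1)$-dimensional ball of radius $\varepsilon$ centered at $x$ and orthogonal to $\nu$, and $\mathcal{L}^{n-1}$ is the $(n-1)$-dimensional Lebesgue measure on the hyperplane containing it. A solution $u_\varepsilon$ is a bounded Borel measurable real-valued function defined on the $\varepsilon$-neighbourhood $\{x\in\mathbb{R}^n:\operatorname{dist}(x,\Omega)\leq\varepsilon\}$ of $\Omega$ (values outside $\Omega$ playing the role of boundary data) that satisfies the stated identity at every $x\in\Omega$. *)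

theory Defs
  imports "HOL-Analysis.Analysis"
begin

definition eps_nbhd :: "('a::euclidean_space) set \<Rightarrow> real \<Rightarrow> 'a set" where
  "eps_nbhd \<Omega> \<epsilon> = {x. infdist x \<Omega> \<le> \<epsilon>}"

definition orthonormal_basis_of :: "('a::euclidean_space) set \<Rightarrow> 'a set \<Rightarrow> bool" where
  "orthonormal_basis_of V B \<longleftrightarrow>
     pairwise orthogonal B \<and> (\<forall>b\<in>B. norm b = 1) \<and> span B = V"

lemma orthonormal_basis_of_finite:
  assumes "orthonormal_basis_of V B"
  shows "finite B"
proof -
  have "0 \<notin> B" using assms by (auto simp: orthonormal_basis_of_def)
  then have "independent B"
    using assms pairwise_orthogonal_independent by (auto simp: orthonormal_basis_of_def)
  then show ?thesis by (rule independent_imp_finite)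
qed

lemma orthonormal_basis_of_exists:
  fixes V :: "('a::euclidean_space) set"
  assumes "subspace V"
  shows "\<exists>B. orthonormal_basis_of V B"
proof -
  obtain B where "pairwise orthogonal B" "\<And>x. x \<in> B \<Longrightarrow> norm x = 1" "span B = V"
    using orthonormal_basis_subspace[OF assms] by metis
  then show ?thesis by (auto simp: orthonormal_basis_of_def)
qed

text \<open>
  Lebesgue measure on the affine subspace \<open>x + V\<close>, as a measure on the ambient space: the image of
  the product Lebesgue measure under the isometric parametrisation
  \<open>t \<mapsto> x + (\<Sum>b\<in>B. t b *\<^sub>R b)\<close> given by an orthonormal basis \<open>B\<close> of \<open>V\<close>.  Since Lebesgue
  measure is invariant under orthogonal maps, the result does not depend on which basis is chosen.
\<close>
definition lborel_affine :: "'a::euclidean_space \<Rightarrow> 'a set \<Rightarrow> 'a measure" where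
  "lborel_affine x V =
     (let B = (SOME B. orthonormal_basis_of V B)
      in distr (\<Pi>\<^sub>M b\<in>B. lborel) borel (\<lambda>t. x + (\<Sum>b\<in>B. t b *\<^sub>R b)))"

definition hyperplane_lborel :: "'a::euclidean_space \<Rightarrow> 'a \<Rightarrow> 'a measure" where
  "hyperplane_lborel \<nu> x = lborel_affine x {v. \<nu> \<bullet> v = 0}"

definition orth_disc :: "real \<Rightarrow> 'a::euclidean_space \<Rightarrow> 'a \<Rightarrow> 'a set" where
  "orth_disc \<epsilon> \<nu> x = {\<xi>. norm (\<xi> - x) < \<epsilon> \<and> \<nu> \<bullet> (\<xi> - x) = 0}"

definition orth_disc_average :: "('a::euclidean_space \<Rightarrow> real) \<Rightarrow> real \<Rightarrow> 'a \<Rightarrow> 'a \<Rightarrow> real" where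
  "orth_disc_average u \<epsilon> \<nu> x =
     1 / measure (hyperplane_lborel \<nu> x) (orth_disc \<epsilon> \<nu> x) *
     (LINT \<xi>:orth_disc \<epsilon> \<nu> x|hyperplane_lborel \<nu> x. u \<xi>)"

text \<open>
  The values of \<open>u\<close> outside \<open>eps_nbhd \<Omega> \<epsilon>\<close> and those of \<open>\<alpha>\<close>, \<open>\<beta>\<close> outside \<open>\<Omega>\<close> are irrelevant.
\<close>
definition dpp_solution ::
  "('a::euclidean_space) set \<Rightarrow> real \<Rightarrow> ('a \<Rightarrow> real) \<Rightarrow> ('a \<Rightarrow> real) \<Rightarrow> ('a \<Rightarrow> real) \<Rightarrow> bool" where
  "dpp_solution \<Omega> \<epsilon> \<alpha> \<beta> u \<longleftrightarrow>
     bounded (u ` eps_nbhd \<Omega> \<epsilon>) \<and>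
     u \<in> borel_measurable (restrict_space borel (eps_nbhd \<Omega> \<epsilon>)) \<and>
     (\<forall>x\<in>\<Omega>. u x =
        1/2 * (SUP \<nu>\<in>sphere 0 \<epsilon>. \<alpha> x * u (x + \<nu>) + \<beta> x * orth_disc_average u \<epsilon> \<nu> x) +
        1/2 * (INF \<nu>\<in>sphere 0 \<epsilon>. \<alpha> x * u (x + \<nu>) + \<beta> x * orth_disc_average u \<epsilon> \<nu> x))"

end

theory Submission
  imports Defs
begin

text \<open>
  Write the dynamic programming principle as the mean of the supremum and the infimum over \<open>\<nu>\<close> of
  the turn value \<open>T x \<nu> = \<alpha> x * u (x + \<nu>) + (1 - \<alpha> x) * A x \<nu>\<close>, where \<open>A x \<nu>\<close> is the average of
  \<open>u\<close> over the disc at \<open>x\<close> orthogonal to \<open>\<nu>\<close>.  The estimate comes from playing the game at two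
  points \<open>x\<close> and \<open>z\<close> at once, with coupled noise, and comparing \<open>u x - u z\<close> with an explicit
  barrier \<open>C * f x z\<close> by a maximum principle.

  Coupling.  If \<open>\<alpha> z \<le> \<alpha> x\<close>, both copies make the chosen moves \<open>(\<nu>, \<nu>')\<close> with weight \<open>\<alpha> z\<close>, both
  move at random with weight \<open>1 - \<alpha> x\<close>, and with the remaining weight \<open>\<alpha> x - \<alpha> z\<close> only the copy at
  \<open>z\<close> moves at random.  The two discs are matched by the reflection that exchanges \<open>\<nu>\<close> and \<open>\<nu>'\<close>; it
  displaces the points of the disc by at most \<open>2 * norm (\<nu> + \<nu>')\<close>, which is small when the moves
  are almost opposite (\<open>reflect_near_identity\<close>).  Disc averages are invariant under such isometries and
  under \<open>h \<mapsto> - h\<close>; this is an instance of the uniqueness, up to a factor, of translation invariant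
  measures (\<open>proportional_of_translation_invariant\<close>).

  Barrier.  With \<open>t = norm (x - z)\<close>, \<open>y = (x + z) / 2 - y0\<close> and \<open>p = s / 2\<close>, put
  \<open>f x z = (t - t powr (1 + p) + \<epsilon> * stair) / (\<rho>\<^sup>2 - (norm y)\<^sup>2)\<^sup>2\<close>.  The concave part \<open>t - t powr (1 + p)\<close>
  has second derivative of order \<open>- t powr (p - 1)\<close>, which beats the error of order \<open>t powr (s - 1)\<close>
  caused by the Hoelder continuity of \<open>\<alpha>\<close>.  The \<open>stair\<close> is a function of \<open>t / (2 * \<epsilon>)\<close> whose steps shrink
  geometrically; it handles the pairs at distance comparable to \<open>\<epsilon>\<close>, where no Taylor expansion is
  useful.  The weight blows up at \<open>norm y = \<rho>\<close>.  If \<open>C\<close> is large and \<open>u x - u z > C * f x z\<close>, then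
  boundedness of \<open>u\<close> forces \<open>t\<close> and \<open>\<epsilon>\<close> below tiny multiples of \<open>(\<rho>\<^sup>2 - (norm y)\<^sup>2)\<^sup>2\<close>.  That makes
  the derivatives of the weight negligible, which is why one barrier yields the Lipschitz bound
  directly, without a preliminary Hoelder estimate.

  Supersolution property.  Every pair of moves \<open>(\<nu>, \<nu>')\<close> has an answer \<open>(\<mu>, \<mu>')\<close> such that the coupled values
  of \<open>f\<close> for the two pairs add up to less than \<open>2 * f x z\<close>
  (\<open>barrier_strict_supersolution\<close>).  When \<open>t\<close> is at most \<open>2 * N * \<epsilon>\<close>, the answer moves the two points
  towards each other, and the drop of the stair dominates (\<open>near_answered\<close>).  For larger \<open>t\<close> there are two
  cases (\<open>distant_answered\<close>).  If \<open>\<nu> - \<nu>'\<close> is almost as long as possible in the direction of \<open>x - z\<close>, the answer is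
  \<open>(- \<nu>, - \<nu>')\<close>: all first-order terms cancel and concavity wins (\<open>antipodal_balance\<close>).  Otherwise the answer moves
  the points straight towards each other, and the first-order gain wins (\<open>pulling_balance\<close>).

  Maximum principle.  Let \<open>K\<close> be the supremum of \<open>u x - u z - C * f x z\<close>.  Wherever this difference is
  positive, the dynamic programming principle and the supersolution property bound it by \<open>K\<close> minus a
  fixed positive amount; hence \<open>K \<le> 0\<close> (\<open>local_comparison\<close>).  Centring the barrier at the midpoint of
  two given points gives the theorem.
\<close>

section \<open>Lebesgue measure in orthonormal coordinates of a subspace\<close>

text \<open>
  Uniqueness of invariant measures by Fubini, for two measures pushed into the same space by \<open>\<Phi>\<close>
  and \<open>\<Psi>\<close>, each invariant under translation by the values of the other: insert a translation
  by \<open>\<Phi> t\<close> into the inner integral over \<open>s\<close>, exchange the integrals, translate by \<open>- \<Psi> s\<close>, exchange back and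
  translate again.  The factors of \<open>f\<close> and \<open>g\<close> have then changed measures.  With \<open>g\<close> the
  indicator of a ball this says that the normalised averages agree up to \<open>y \<mapsto> - y\<close>; with equal measures it
  says that averages are even.
\<close>
lemma proportional_of_translation_invariant:
  fixes \<Phi> :: "'b \<Rightarrow> 'a::euclidean_space" and \<Psi> :: "'c \<Rightarrow> 'a" and f g :: "'a \<Rightarrow> ennreal"
  assumes "sigma_finite_measure M" "sigma_finite_measure N"
    and \<Phi>[measurable]: "\<Phi> \<in> borel_measurable M" and \<Psi>[measurable]: "\<Psi> \<in> borel_measurable N"
    and invM: "\<And>F s. F \<in> borel_measurable borel \<Longrightarrow> s \<in> space N \<Longrightarrow>
                 (\<integral>\<^sup>+t. F (\<Phi> t + \<Psi> s) \<partial>M) = (\<integral>\<^sup>+t. F (\<Phi> t) \<partial>M)"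
    and invN: "\<And>F t. F \<in> borel_measurable borel \<Longrightarrow> t \<in> space M \<Longrightarrow>
                 (\<integral>\<^sup>+s. F (\<Psi> s + \<Phi> t) \<partial>N) = (\<integral>\<^sup>+s. F (\<Psi> s) \<partial>N)"
    and f[measurable]: "f \<in> borel_measurable borel" and g[measurable]: "g \<in> borel_measurable borel"
  shows "(\<integral>\<^sup>+t. f (\<Phi> t) \<partial>M) * (\<integral>\<^sup>+s. g (\<Psi> s) \<partial>N) = (\<integral>\<^sup>+t. g (\<Phi> t) \<partial>M) * (\<integral>\<^sup>+s. f (- \<Psi> s) \<partial>N)"
proof -
  interpret M: sigma_finite_measure M by fact
  interpret N: sigma_finite_measure N by fact
  interpret pair_sigma_finite M N ..
  have "(\<integral>\<^sup>+t. f (\<Phi> t) \<partial>M) * (\<integral>\<^sup>+s. g (\<Psi> s) \<partial>N) = (\<integral>\<^sup>+t. f (\<Phi> t) * (\<integral>\<^sup>+s. g (\<Psi> s) \<partial>N) \<partial>M)"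
    by (simp add: nn_integral_multc)
  also have "\<dots> = (\<integral>\<^sup>+t. (\<integral>\<^sup>+s. f (\<Phi> t) * g (\<Psi> s + \<Phi> t) \<partial>N) \<partial>M)"
    by (rule nn_integral_cong) (simp add: nn_integral_cmult invN)
  also have "\<dots> = (\<integral>\<^sup>+s. (\<integral>\<^sup>+t. f (\<Phi> t) * g (\<Psi> s + \<Phi> t) \<partial>M) \<partial>N)"
    by (rule Fubini'[symmetric]) measurable
  also have "\<dots> = (\<integral>\<^sup>+s. (\<integral>\<^sup>+t. f (\<Phi> t - \<Psi> s) * g (\<Phi> t) \<partial>M) \<partial>N)"
  proof (rule nn_integral_cong)
    fix s assume "s \<in> space N"
    then show "(\<integral>\<^sup>+t. f (\<Phi> t) * g (\<Psi> s + \<Phi> t) \<partial>M) = (\<integral>\<^sup>+t. f (\<Phi> t - \<Psi> s) * g (\<Phi> t) \<partial>M)"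
      using invM[of "\<lambda>y. f (y - \<Psi> s) * g y" s] by (simp add: add.commute)
  qed
  also have "\<dots> = (\<integral>\<^sup>+t. (\<integral>\<^sup>+s. f (\<Phi> t - \<Psi> s) * g (\<Phi> t) \<partial>N) \<partial>M)"
    by (rule Fubini') measurable
  also have "\<dots> = (\<integral>\<^sup>+t. g (\<Phi> t) * (\<integral>\<^sup>+s. f (- \<Psi> s) \<partial>N) \<partial>M)"
  proof (rule nn_integral_cong)
    fix t assume "t \<in> space M"
    then have "(\<integral>\<^sup>+s. f (\<Phi> t - \<Psi> s) \<partial>N) = (\<integral>\<^sup>+s. f (- \<Psi> s) \<partial>N)"
      using invN[of "\<lambda>y. f (\<Phi> t - y)" t] by simp
    then show "(\<integral>\<^sup>+s. f (\<Phi> t - \<Psi> s) * g (\<Phi> t) \<partial>N) = g (\<Phi> t) * (\<integral>\<^sup>+s. f (- \<Psi> s) \<partial>N)"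
      by (simp add: nn_integral_multc) (simp add: mult.commute)
  qed
  also have "\<dots> = (\<integral>\<^sup>+t. g (\<Phi> t) \<partial>M) * (\<integral>\<^sup>+s. f (- \<Psi> s) \<partial>N)"
    by (simp add: nn_integral_multc)
  finally show ?thesis .
qed

abbreviation coord_lborel :: "'a set \<Rightarrow> ('a \<Rightarrow> real) measure" where
  "coord_lborel B \<equiv> (\<Pi>\<^sub>M b\<in>B. lborel)"

definition lin_comb :: "'a::euclidean_space set \<Rightarrow> ('a \<Rightarrow> real) \<Rightarrow> 'a" where
  "lin_comb B t = (\<Sum>b\<in>B. t b *\<^sub>R b)"

lemma lin_comb_measurable[measurable]:
  fixes B :: "'a::euclidean_space set"
  shows "lin_comb B \<in> borel_measurable (coord_lborel B)"
  unfolding lin_comb_def by measurable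

lemma sigma_finite_coord_lborel: "finite B \<Longrightarrow> sigma_finite_measure (coord_lborel B)"
proof -
  interpret product_sigma_finite "\<lambda>_::'a. lborel :: real measure"
    by standard (rule lborel.sigma_finite_countable)
  show "finite B \<Longrightarrow> sigma_finite_measure (coord_lborel B)" by (rule sigma_finite)
qed

lemma emeasure_coord_lborel:
  assumes "finite B" "\<And>b. b \<in> B \<Longrightarrow> A b \<in> sets borel"
  shows "emeasure (coord_lborel B) (Pi\<^sub>E B A) = (\<Prod>b\<in>B. emeasure lborel (A b))"
proof -
  interpret product_sigma_finite "\<lambda>_::'a. lborel :: real measure"
    by standard (rule lborel.sigma_finite_countable)
  show ?thesis using assms by (intro emeasure_PiM) auto
qed

lemma distr_coord_lborel_translate:
  assumes [simp]: "finite B"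
  shows "distr (coord_lborel B) (coord_lborel B) (\<lambda>t. \<lambda>b\<in>B. t b + c b) = coord_lborel B"
proof -
  interpret product_sigma_finite "\<lambda>_::'a. lborel :: real measure"
    by standard (rule lborel.sigma_finite_countable)
  have meas[measurable]: "(\<lambda>t. \<lambda>b\<in>B. t b + c b) \<in> coord_lborel B \<rightarrow>\<^sub>M coord_lborel B"
    by (rule measurable_restrict) measurable
  show ?thesis
  proof (rule PiM_eqI)
    fix A :: "'a \<Rightarrow> real set" assume A: "\<And>b. b \<in> B \<Longrightarrow> A b \<in> sets lborel"
    have A': "(\<lambda>x. x + c b) -` A b \<in> sets borel" if "b \<in> B" for b
      using A[OF that] by (intro measurable_sets_borel[of _ borel]) auto
    have "emeasure (distr (coord_lborel B) (coord_lborel B) (\<lambda>t. \<lambda>b\<in>B. t b + c b)) (Pi\<^sub>E B A)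
        = emeasure (coord_lborel B) ((\<lambda>t. \<lambda>b\<in>B. t b + c b) -` Pi\<^sub>E B A \<inter> space (coord_lborel B))"
      using A by (intro emeasure_distr) (auto intro!: sets_PiM_I_finite)
    also have "(\<lambda>t. \<lambda>b\<in>B. t b + c b) -` Pi\<^sub>E B A \<inter> space (coord_lborel B)
        = Pi\<^sub>E B (\<lambda>b. (\<lambda>x. x + c b) -` A b)"
      by (auto simp: space_PiM PiE_iff extensional_def restrict_def fun_eq_iff)
    also have "emeasure (coord_lborel B) \<dots> = (\<Prod>b\<in>B. emeasure lborel ((\<lambda>x. x + c b) -` A b))"
      using A' by (intro emeasure_coord_lborel) auto
    also have "\<dots> = (\<Prod>b\<in>B. emeasure lborel (A b))"
    proof (rule prod.cong[OF refl])
      fix b assume b: "b \<in> B"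
      have "emeasure lborel (A b) = emeasure (distr lborel borel ((+) (c b))) (A b)"
        by (simp only: lborel_distr_plus)
      also have "\<dots> = emeasure lborel ((\<lambda>x. x + c b) -` A b)"
        using A[OF b] by (subst emeasure_distr) (auto simp: add.commute[of _ "c b"])
      finally show "emeasure lborel ((\<lambda>x. x + c b) -` A b) = emeasure lborel (A b)" by simp
    qed
    finally show "emeasure (distr (coord_lborel B) (coord_lborel B) (\<lambda>t. \<lambda>b\<in>B. t b + c b)) (Pi\<^sub>E B A)
        = (\<Prod>b\<in>B. emeasure lborel (A b))" .
  qed auto
qed

lemma orthonormal_basis_expand:
  assumes "orthonormal_basis_of V B" "v \<in> V"
  shows "v = lin_comb B (\<lambda>b. v \<bullet> b)"
proof -
  have p: "pairwise orthogonal B" and n: "\<And>b. b \<in> B \<Longrightarrow> norm b = 1" and v: "v \<in> span B"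
    using assms by (auto simp: orthonormal_basis_of_def)
  let ?w = "v - (\<Sum>b\<in>B. (b \<bullet> v / (b \<bullet> b)) *\<^sub>R b)"
  have "?w \<in> span B" by (intro span_diff span_sum span_scale v) (auto intro: span_base)
  from Gram_Schmidt_step[OF p this, of v] have "?w = 0"
    by (simp add: orthogonal_def)
  then have "v = (\<Sum>b\<in>B. (b \<bullet> v / (b \<bullet> b)) *\<^sub>R b)" by simp
  also have "\<dots> = lin_comb B (\<lambda>b. v \<bullet> b)"
    unfolding lin_comb_def by (rule sum.cong) (auto simp: n dot_square_norm inner_commute)
  finally show ?thesis .
qed

lemma lin_comb_in: "orthonormal_basis_of V B \<Longrightarrow> lin_comb B t \<in> V"
  unfolding lin_comb_def orthonormal_basis_of_def
  by (auto intro: span_sum span_scale span_base)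

lemma norm_lin_comb:
  assumes "orthonormal_basis_of V B"
  shows "(norm (lin_comb B t))\<^sup>2 = (\<Sum>b\<in>B. (t b)\<^sup>2)"
proof -
  have p: "pairwise orthogonal B" and n: "\<And>b. b \<in> B \<Longrightarrow> norm b = 1"
    using assms by (auto simp: orthonormal_basis_of_def)
  have "(norm (lin_comb B t))\<^sup>2 = (\<Sum>b\<in>B. (norm (t b *\<^sub>R b))\<^sup>2)"
    unfolding lin_comb_def using orthonormal_basis_of_finite[OF assms] p
    by (intro norm_sum_Pythagorean) (auto simp: pairwise_def orthogonal_def)
  also have "\<dots> = (\<Sum>b\<in>B. (t b)\<^sup>2)"
    by (rule sum.cong) (auto simp: n)
  finally show ?thesis .
qed

text \<open>
  A translation within the subspace is a translation of the coordinates.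
\<close>
lemma nn_integral_lin_comb_translate:
  fixes F :: "'a::euclidean_space \<Rightarrow> ennreal"
  assumes B: "orthonormal_basis_of V B" and v: "v \<in> V" and [measurable]: "F \<in> borel_measurable borel"
  shows "(\<integral>\<^sup>+t. F (lin_comb B t + v) \<partial>coord_lborel B) = (\<integral>\<^sup>+t. F (lin_comb B t) \<partial>coord_lborel B)"
proof -
  let ?T = "\<lambda>t. \<lambda>b\<in>B. t b + v \<bullet> b"
  have fin: "finite B" by (rule orthonormal_basis_of_finite[OF B])
  have meas[measurable]: "?T \<in> coord_lborel B \<rightarrow>\<^sub>M coord_lborel B"
    by (rule measurable_restrict) measurable
  have "lin_comb B (?T t) = lin_comb B t + v" for t
    using orthonormal_basis_expand[OF B v]
    by (simp add: lin_comb_def scaleR_add_left sum.distrib)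
  then have "(\<integral>\<^sup>+t. F (lin_comb B t + v) \<partial>coord_lborel B) = (\<integral>\<^sup>+t. F (lin_comb B (?T t)) \<partial>coord_lborel B)"
    by simp
  also have "\<dots> = (\<integral>\<^sup>+t. F (lin_comb B t) \<partial>distr (coord_lborel B) (coord_lborel B) ?T)"
    by (subst nn_integral_distr) measurable
  also have "\<dots> = (\<integral>\<^sup>+t. F (lin_comb B t) \<partial>coord_lborel B)"
    by (simp only: distr_coord_lborel_translate[OF fin])
  finally show ?thesis .
qed

definition disc_params :: "'a::euclidean_space set \<Rightarrow> real \<Rightarrow> ('a \<Rightarrow> real) set" where
  "disc_params B \<epsilon> = {t \<in> space (coord_lborel B). norm (lin_comb B t) < \<epsilon>}"

lemma disc_params_measurable[measurable]: "disc_params B \<epsilon> \<in> sets (coord_lborel B)"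
  unfolding disc_params_def by measurable

lemma disc_params_finite:
  assumes B: "orthonormal_basis_of V B"
  shows "emeasure (coord_lborel B) (disc_params B \<epsilon>) < \<infinity>"
proof -
  have fin: "finite B" by (rule orthonormal_basis_of_finite[OF B])
  have "disc_params B \<epsilon> \<subseteq> (\<Pi>\<^sub>E b\<in>B. {-\<epsilon>..\<epsilon>})"
  proof
    fix t assume "t \<in> disc_params B \<epsilon>"
    then have t: "norm (lin_comb B t) < \<epsilon>" and "t \<in> extensional B"
      by (auto simp: disc_params_def space_PiM PiE_iff)
    moreover have "\<bar>t b\<bar> \<le> \<epsilon>" if "b \<in> B" for b
    proof -
      have "(t b)\<^sup>2 \<le> (\<Sum>b\<in>B. (t b)\<^sup>2)" using that fin by (intro member_le_sum) auto
      then have "(t b)\<^sup>2 \<le> (norm (lin_comb B t))\<^sup>2" by (simp add: norm_lin_comb[OF B])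
      then have "\<bar>t b\<bar> \<le> norm (lin_comb B t)" by (simp add: abs_le_square_iff[symmetric])
      then show ?thesis using t by simp
    qed
    ultimately show "t \<in> (\<Pi>\<^sub>E b\<in>B. {-\<epsilon>..\<epsilon>})" by (auto simp: PiE_iff abs_le_iff minus_le_iff)
  qed
  then have "emeasure (coord_lborel B) (disc_params B \<epsilon>) \<le> emeasure (coord_lborel B) (\<Pi>\<^sub>E b\<in>B. {-\<epsilon>..\<epsilon>})"
    using fin by (intro emeasure_mono) (auto intro!: sets_PiM_I_finite)
  also have "\<dots> < \<infinity>"
    using fin by (subst emeasure_coord_lborel)
      (auto simp: less_top[symmetric] emeasure_lborel_Icc_eq power_eq_top_ennreal)
  finally show ?thesis .
qed

lemma disc_params_pos:
  assumes B: "orthonormal_basis_of V B" and "\<epsilon> > 0"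
  shows "emeasure (coord_lborel B) (disc_params B \<epsilon>) > 0"
proof -
  have fin: "finite B" by (rule orthonormal_basis_of_finite[OF B])
  define k where "k = \<epsilon> / (2 * (real (card B) + 1))"
  have k: "k > 0" "(real (card B) + 1) * k < \<epsilon>" using assms by (auto simp: k_def field_simps add_pos_nonneg)
  have "(\<Pi>\<^sub>E b\<in>B. {-k..k}) \<subseteq> disc_params B \<epsilon>"
  proof
    fix t assume t: "t \<in> (\<Pi>\<^sub>E b\<in>B. {-k..k})"
    have "norm (lin_comb B t) \<le> (\<Sum>b\<in>B. k)"
      unfolding lin_comb_def using t B
      by (intro sum_norm_le) (force simp: orthonormal_basis_of_def PiE_iff abs_le_iff)
    also have "\<dots> < \<epsilon>" using k by (simp add: algebra_simps)
    finally show "t \<in> disc_params B \<epsilon>" using t by (auto simp: disc_params_def space_PiM PiE_iff)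
  qed
  then have "emeasure (coord_lborel B) (\<Pi>\<^sub>E b\<in>B. {-k..k}) \<le> emeasure (coord_lborel B) (disc_params B \<epsilon>)"
    by (intro emeasure_mono) auto
  moreover have "emeasure (coord_lborel B) (\<Pi>\<^sub>E b\<in>B. {-k..k}) = (\<Prod>b\<in>B. ennreal (2 * k))"
    using fin k by (subst emeasure_coord_lborel) auto
  moreover have "(\<Prod>b\<in>B. ennreal (2 * k)) > 0" using k by (simp add: ennreal_power)
  ultimately show ?thesis by simp
qed

section \<open>Averages over discs\<close>

text \<open>
  The average over the disc of radius \<open>\<epsilon>\<close> centred at the origin of the span of \<open>B\<close>.  It is phrased with
  coordinates so that the centre and the isometries act on the integrand alone.
\<close>
definition disc_mean :: "'a::euclidean_space set \<Rightarrow> real \<Rightarrow> ('a \<Rightarrow> real) \<Rightarrow> real" where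
  "disc_mean B \<epsilon> f =
     (\<integral>t. indicator (ball 0 \<epsilon>) (lin_comb B t) * f (lin_comb B t) \<partial>coord_lborel B) /
     measure (coord_lborel B) (disc_params B \<epsilon>)"

definition hyperplane_basis :: "'a::euclidean_space \<Rightarrow> 'a set" where
  "hyperplane_basis \<nu> = (SOME B. orthonormal_basis_of {v. \<nu> \<bullet> v = 0} B)"

lemma orthonormal_hyperplane_basis: "orthonormal_basis_of {v. \<nu> \<bullet> v = 0} (hyperplane_basis \<nu>)"
  unfolding hyperplane_basis_def
  by (rule someI_ex, rule orthonormal_basis_of_exists, rule subspace_hyperplane)

lemma orth_disc_average_eq_disc_mean:
  fixes u :: "'a::euclidean_space \<Rightarrow> real"
  assumes u[measurable]: "u \<in> borel_measurable borel"
  shows "orth_disc_average u \<epsilon> \<nu> x = disc_mean (hyperplane_basis \<nu>) \<epsilon> (\<lambda>h. u (x + h))"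
proof -
  let ?B = "hyperplane_basis \<nu>"
  let ?M = "coord_lborel ?B"
  have h: "hyperplane_lborel \<nu> x = distr ?M borel (\<lambda>t. x + lin_comb ?B t)"
    by (simp add: hyperplane_lborel_def lborel_affine_def hyperplane_basis_def lin_comb_def Let_def)
  have D[measurable]: "orth_disc \<epsilon> \<nu> x \<in> sets borel"
    unfolding orth_disc_def by measurable
  have perp: "\<nu> \<bullet> lin_comb ?B t = 0" for t
    using lin_comb_in[OF orthonormal_hyperplane_basis] by blast
  have iff: "x + lin_comb ?B t \<in> orth_disc \<epsilon> \<nu> x \<longleftrightarrow> norm (lin_comb ?B t) < \<epsilon>" for t
    by (simp add: orth_disc_def perp)
  have "measure (hyperplane_lborel \<nu> x) (orth_disc \<epsilon> \<nu> x) = measure ?M (disc_params ?B \<epsilon>)"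
    unfolding h by (subst measure_distr) (auto intro!: arg_cong[where f="measure ?M"] simp: iff disc_params_def)
  moreover have "(LINT \<xi>:orth_disc \<epsilon> \<nu> x|hyperplane_lborel \<nu> x. u \<xi>)
      = (\<integral>t. indicator (ball 0 \<epsilon>) (lin_comb ?B t) * u (x + lin_comb ?B t) \<partial>?M)"
    unfolding h set_lebesgue_integral_def
    by (subst integral_distr) (auto intro!: Bochner_Integration.integral_cong simp: iff indicator_def)
  ultimately show ?thesis
    by (simp add: orth_disc_average_def disc_mean_def)
qed

lemma orth_disc_average_cong:
  assumes "\<And>\<xi>. \<xi> \<in> orth_disc \<epsilon> \<nu> x \<Longrightarrow> u \<xi> = v \<xi>"
  shows "orth_disc_average u \<epsilon> \<nu> x = orth_disc_average v \<epsilon> \<nu> x"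
proof -
  have "(\<lambda>\<xi>. indicator (orth_disc \<epsilon> \<nu> x) \<xi> *\<^sub>R u \<xi>) = (\<lambda>\<xi>. indicator (orth_disc \<epsilon> \<nu> x) \<xi> *\<^sub>R v \<xi>)"
    using assms by (auto simp: indicator_def fun_eq_iff)
  then show ?thesis by (simp add: orth_disc_average_def set_lebesgue_integral_def)
qed

lemma disc_measure_pos:
  assumes "orthonormal_basis_of V B" "\<epsilon> > 0"
  shows "measure (coord_lborel B) (disc_params B \<epsilon>) > 0"
  using disc_params_finite[OF assms(1)] disc_params_pos[OF assms]
  by (simp add: measure_def enn2real_positive_iff)

lemma disc_integrable:
  fixes f :: "'a::euclidean_space \<Rightarrow> real"
  assumes B: "orthonormal_basis_of V B" and [measurable]: "f \<in> borel_measurable borel"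
    and bdd: "\<And>h. \<bar>f h\<bar> \<le> c"
  shows "integrable (coord_lborel B) (\<lambda>t. indicator (ball 0 \<epsilon>) (lin_comb B t) * f (lin_comb B t))"
proof (rule Bochner_Integration.integrable_bound)
  show "integrable (coord_lborel B) (\<lambda>t. indicator (disc_params B \<epsilon>) t * c)"
    using disc_params_finite[OF B] by (intro integrable_mult_left) (simp add: integrable_indicator_iff)
  show "AE t in coord_lborel B. norm (indicator (ball 0 \<epsilon>) (lin_comb B t) * f (lin_comb B t))
          \<le> norm (indicator (disc_params B \<epsilon>) t * c)"
  proof (rule AE_I2)
    fix t assume "t \<in> space (coord_lborel B)"
    moreover have "\<bar>f (lin_comb B t)\<bar> \<le> \<bar>c\<bar>" using bdd[of "lin_comb B t"] by linarith
    ultimately show "norm (indicator (ball 0 \<epsilon>) (lin_comb B t) * f (lin_comb B t))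
          \<le> norm (indicator (disc_params B \<epsilon>) t * c)"
      by (simp add: indicator_def disc_params_def)
  qed
  have "(\<lambda>y. indicator (ball 0 \<epsilon>) y * f y) \<in> borel_measurable borel"
    by (intro borel_measurable_times borel_measurable_indicator) auto
  then show "(\<lambda>t. indicator (ball 0 \<epsilon>) (lin_comb B t) * f (lin_comb B t)) \<in> borel_measurable (coord_lborel B)"
    by (rule measurable_compose[OF lin_comb_measurable])
qed

lemma disc_mean_mono:
  fixes f g :: "'a::euclidean_space \<Rightarrow> real"
  assumes B: "orthonormal_basis_of V B" and "\<epsilon> > 0"
    and f: "f \<in> borel_measurable borel" "\<And>h. \<bar>f h\<bar> \<le> c"
    and g: "g \<in> borel_measurable borel" "\<And>h. \<bar>g h\<bar> \<le> c'"
    and le: "\<And>h. h \<in> V \<Longrightarrow> norm h < \<epsilon> \<Longrightarrow> f h \<le> g h"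
  shows "disc_mean B \<epsilon> f \<le> disc_mean B \<epsilon> g"
  unfolding disc_mean_def
proof (rule divide_right_mono, rule integral_mono)
  fix t
  show "indicator (ball 0 \<epsilon>) (lin_comb B t) * f (lin_comb B t)
      \<le> indicator (ball 0 \<epsilon>) (lin_comb B t) * g (lin_comb B t)"
    using le[OF lin_comb_in[OF B]] by (auto simp: indicator_def)
qed (auto intro!: disc_integrable[OF B] f g)

lemma disc_mean_add:
  fixes f g :: "'a::euclidean_space \<Rightarrow> real"
  assumes B: "orthonormal_basis_of V B"
    and f: "f \<in> borel_measurable borel" "\<And>h. \<bar>f h\<bar> \<le> c"
    and g: "g \<in> borel_measurable borel" "\<And>h. \<bar>g h\<bar> \<le> c'"
  shows "disc_mean B \<epsilon> (\<lambda>h. f h + g h) = disc_mean B \<epsilon> f + disc_mean B \<epsilon> g"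
  unfolding disc_mean_def
  by (simp add: distrib_left add_divide_distrib[symmetric]
      Bochner_Integration.integral_add[OF disc_integrable[OF B f] disc_integrable[OF B g]])

lemma disc_mean_uminus: "disc_mean B \<epsilon> (\<lambda>h. - f h) = - disc_mean B \<epsilon> f"
  by (simp add: disc_mean_def)

lemma disc_mean_const:
  assumes B: "orthonormal_basis_of V B" and "\<epsilon> > 0"
  shows "disc_mean B \<epsilon> (\<lambda>_. c) = c"
proof -
  have "(\<integral>t. indicator (ball 0 \<epsilon>) (lin_comb B t) * c \<partial>coord_lborel B)
      = (\<integral>t. indicator (disc_params B \<epsilon>) t * c \<partial>coord_lborel B)"
    by (rule Bochner_Integration.integral_cong) (auto simp: indicator_def disc_params_def)
  also have "\<dots> = (\<integral>t. indicator (disc_params B \<epsilon>) t \<partial>coord_lborel B) * c"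
    by (rule integral_mult_left_zero)
  also have "(\<integral>t. indicator (disc_params B \<epsilon>) t \<partial>coord_lborel B) = measure (coord_lborel B) (disc_params B \<epsilon>)"
    by (simp add: disc_params_def Int_absorb2)
  finally have eq: "(\<integral>t. indicator (ball 0 \<epsilon>) (lin_comb B t) * c \<partial>coord_lborel B)
      = measure (coord_lborel B) (disc_params B \<epsilon>) * c" .
  show ?thesis unfolding disc_mean_def eq using disc_measure_pos[OF assms] by simp
qed

text \<open>
  The sign on the right comes from \<open>proportional_of_translation_invariant\<close>, applied to the
  coordinates of \<open>V\<close> followed by \<open>Q\<close> and to the coordinates of \<open>W\<close>.  Nonnegativity allows the
  integrals to be computed as extended nonnegative reals.
\<close>
lemma disc_mean_transfer_nonneg:
  fixes f :: "'a::euclidean_space \<Rightarrow> real"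
  assumes A: "orthonormal_basis_of V A" and B: "orthonormal_basis_of W B" and \<epsilon>: "\<epsilon> > 0"
    and Q: "linear Q" "\<And>h. norm (Q h) = norm h" "Q ` V = W"
    and f[measurable]: "f \<in> borel_measurable borel" and bdd: "\<And>h. \<bar>f h\<bar> \<le> c" and nn: "\<And>h. f h \<ge> 0"
  shows "disc_mean A \<epsilon> (\<lambda>h. f (Q h)) = disc_mean B \<epsilon> (\<lambda>h. f (- h))"
proof -
  have Qm[measurable]: "Q \<in> borel_measurable borel"
    using Q(1) by (intro borel_measurable_continuous_onI linear_continuous_on linear_conv_bounded_linear[THEN iffD1])
  let ?M = "coord_lborel A" and ?N = "coord_lborel B"
  let ?g = "\<lambda>y. ennreal (indicator (ball 0 \<epsilon>) y)"
  let ?F = "\<lambda>y. ennreal (indicator (ball 0 \<epsilon>) y * f y)"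
  have "(\<integral>\<^sup>+t. ?F (Q (lin_comb A t)) \<partial>?M) * (\<integral>\<^sup>+s. ?g (lin_comb B s) \<partial>?N)
      = (\<integral>\<^sup>+t. ?g (Q (lin_comb A t)) \<partial>?M) * (\<integral>\<^sup>+s. ?F (- lin_comb B s) \<partial>?N)"
  proof (rule proportional_of_translation_invariant[where \<Phi>="\<lambda>t. Q (lin_comb A t)" and \<Psi>="lin_comb B"])
    show "sigma_finite_measure ?M" "sigma_finite_measure ?N"
      using A B by (auto intro: sigma_finite_coord_lborel orthonormal_basis_of_finite)
  next
    fix F :: "'a \<Rightarrow> ennreal" and s assume [measurable]: "F \<in> borel_measurable borel"
    have "lin_comb B s \<in> Q ` V" using lin_comb_in[OF B] Q(3) by simp
    then obtain v where v: "v \<in> V" "lin_comb B s = Q v" by blast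
    show "(\<integral>\<^sup>+t. F (Q (lin_comb A t) + lin_comb B s) \<partial>?M) = (\<integral>\<^sup>+t. F (Q (lin_comb A t)) \<partial>?M)"
      using nn_integral_lin_comb_translate[OF A v(1), of "\<lambda>y. F (Q y)"] v(2) linear_add[OF Q(1)] by simp
  next
    fix F :: "'a \<Rightarrow> ennreal" and t assume [measurable]: "F \<in> borel_measurable borel"
    have "Q (lin_comb A t) \<in> W" using lin_comb_in[OF A] Q(3) by blast
    then show "(\<integral>\<^sup>+s. F (lin_comb B s + Q (lin_comb A t)) \<partial>?N) = (\<integral>\<^sup>+s. F (lin_comb B s) \<partial>?N)"
      by (intro nn_integral_lin_comb_translate[OF B]) measurable
  next
    show "?g \<in> borel_measurable borel"
      by (intro measurable_compose[OF _ measurable_ennreal] borel_measurable_indicator) auto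
    show "?F \<in> borel_measurable borel"
      by (intro measurable_compose[OF _ measurable_ennreal] borel_measurable_times borel_measurable_indicator) auto
  qed measurable
  moreover have "(\<integral>\<^sup>+t. ?F (Q (lin_comb A t)) \<partial>?M)
      = ennreal (\<integral>t. indicator (ball 0 \<epsilon>) (lin_comb A t) * f (Q (lin_comb A t)) \<partial>?M)"
    using disc_integrable[OF A, of "\<lambda>h. f (Q h)" c \<epsilon>] bdd nn
    by (subst nn_integral_eq_integral[symmetric]) (auto intro!: nn_integral_cong simp: Q(2) indicator_def)
  moreover have "(\<integral>\<^sup>+s. ?F (- lin_comb B s) \<partial>?N)
      = ennreal (\<integral>t. indicator (ball 0 \<epsilon>) (lin_comb B t) * f (- lin_comb B t) \<partial>?N)"
    using disc_integrable[OF B, of "\<lambda>h. f (- h)" c \<epsilon>] bdd nn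
    by (subst nn_integral_eq_integral[symmetric]) (auto intro!: nn_integral_cong simp: indicator_def)
  moreover have "(\<integral>\<^sup>+s. ?g (lin_comb B s) \<partial>?N) = ennreal (measure ?N (disc_params B \<epsilon>))"
  proof -
    have "(\<integral>\<^sup>+s. ?g (lin_comb B s) \<partial>?N) = (\<integral>\<^sup>+s. indicator (disc_params B \<epsilon>) s \<partial>?N)"
      by (rule nn_integral_cong) (auto simp: indicator_def disc_params_def)
    then show ?thesis using disc_params_finite[OF B]
      by (simp add: emeasure_eq_ennreal_measure less_top[symmetric])
  qed
  moreover have "(\<integral>\<^sup>+t. ?g (Q (lin_comb A t)) \<partial>?M) = ennreal (measure ?M (disc_params A \<epsilon>))"
  proof -
    have "(\<integral>\<^sup>+t. ?g (Q (lin_comb A t)) \<partial>?M) = (\<integral>\<^sup>+t. indicator (disc_params A \<epsilon>) t \<partial>?M)"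
      by (rule nn_integral_cong) (auto simp: indicator_def disc_params_def Q(2))
    then show ?thesis using disc_params_finite[OF A]
      by (simp add: emeasure_eq_ennreal_measure less_top[symmetric])
  qed
  ultimately have "ennreal ((\<integral>t. indicator (ball 0 \<epsilon>) (lin_comb A t) * f (Q (lin_comb A t)) \<partial>?M) * measure ?N (disc_params B \<epsilon>))
     = ennreal (measure ?M (disc_params A \<epsilon>) * (\<integral>t. indicator (ball 0 \<epsilon>) (lin_comb B t) * f (- lin_comb B t) \<partial>?N))"
    using nn by (simp add: ennreal_mult)
  moreover have "0 \<le> (\<integral>t. indicator (ball 0 \<epsilon>) (lin_comb A t) * f (Q (lin_comb A t)) \<partial>?M)"
    "0 \<le> (\<integral>t. indicator (ball 0 \<epsilon>) (lin_comb B t) * f (- lin_comb B t) \<partial>?N)"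
    using nn by simp_all
  ultimately have "(\<integral>t. indicator (ball 0 \<epsilon>) (lin_comb A t) * f (Q (lin_comb A t)) \<partial>?M) * measure ?N (disc_params B \<epsilon>)
     = measure ?M (disc_params A \<epsilon>) * (\<integral>t. indicator (ball 0 \<epsilon>) (lin_comb B t) * f (- lin_comb B t) \<partial>?N)"
    by (subst (asm) ennreal_inj) auto
  then show ?thesis
    using disc_measure_pos[OF A \<epsilon>] disc_measure_pos[OF B \<epsilon>]
    by (simp add: disc_mean_def field_simps)
qed

lemma disc_mean_transfer:
  fixes f :: "'a::euclidean_space \<Rightarrow> real"
  assumes A: "orthonormal_basis_of V A" and B: "orthonormal_basis_of W B" and \<epsilon>: "\<epsilon> > 0"
    and Q: "linear Q" "\<And>h. norm (Q h) = norm h" "Q ` V = W"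
    and f[measurable]: "f \<in> borel_measurable borel" and bdd: "\<And>h. \<bar>f h\<bar> \<le> c"
  shows "disc_mean A \<epsilon> (\<lambda>h. f (Q h)) = disc_mean B \<epsilon> (\<lambda>h. f (- h))"
proof -
  have Qm[measurable]: "Q \<in> borel_measurable borel"
    using Q(1) by (intro borel_measurable_continuous_onI linear_continuous_on linear_conv_bounded_linear[THEN iffD1])
  have b: "\<bar>f h + c\<bar> \<le> 2 * c" "f h + c \<ge> 0" for h using bdd[of h] by auto
  have "disc_mean A \<epsilon> (\<lambda>h. f (Q h) + c) = disc_mean B \<epsilon> (\<lambda>h. f (- h) + c)"
    by (rule disc_mean_transfer_nonneg[OF A B \<epsilon> Q, where f="\<lambda>h. f h + c" and c="2 * c"])
       (use b in \<open>auto simp: abs_le_iff\<close>)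
  moreover have "disc_mean A \<epsilon> (\<lambda>h. f (Q h) + c) = disc_mean A \<epsilon> (\<lambda>h. f (Q h)) + disc_mean A \<epsilon> (\<lambda>_. c)"
    using bdd by (intro disc_mean_add[OF A, of _ c _ "\<bar>c\<bar>"]) auto
  moreover have "disc_mean B \<epsilon> (\<lambda>h. f (- h) + c) = disc_mean B \<epsilon> (\<lambda>h. f (- h)) + disc_mean B \<epsilon> (\<lambda>_. c)"
    using bdd by (intro disc_mean_add[OF B, of _ c _ "\<bar>c\<bar>"]) auto
  ultimately show ?thesis
    by (simp add: disc_mean_const[OF A \<epsilon>] disc_mean_const[OF B \<epsilon>])
qed

text \<open>
  Transfer along the identity of \<open>V\<close>.
\<close>
lemma disc_mean_even:
  fixes f :: "'a::euclidean_space \<Rightarrow> real"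
  assumes B: "orthonormal_basis_of V B" and "\<epsilon> > 0"
    and "f \<in> borel_measurable borel" and "\<And>h. \<bar>f h\<bar> \<le> c"
  shows "disc_mean B \<epsilon> (\<lambda>h. f (- h)) = disc_mean B \<epsilon> f"
  using disc_mean_transfer[OF B B \<open>\<epsilon> > 0\<close>, of id f c] assms by (simp add: linear_id)

text \<open>
  Since discs are symmetric, it suffices to bound the average of the values at opposite points.
  This removes first-order terms before any integration.
\<close>
lemma orth_disc_average_bound:
  fixes u :: "'a::euclidean_space \<Rightarrow> real"
  assumes u[measurable]: "u \<in> borel_measurable borel" and bdd: "\<And>h. \<bar>u h\<bar> \<le> c" and "\<epsilon> > 0"
    and le: "\<And>h. \<nu> \<bullet> h = 0 \<Longrightarrow> norm h < \<epsilon> \<Longrightarrow> u (x + h) + u (x - h) \<le> 2 * e"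
  shows "orth_disc_average u \<epsilon> \<nu> x \<le> e"
proof -
  note B = orthonormal_hyperplane_basis[of \<nu>]
  let ?m = "disc_mean (hyperplane_basis \<nu>) \<epsilon>"
  have m: "orth_disc_average u \<epsilon> \<nu> x = ?m (\<lambda>h. u (x + h))"
    by (simp add: orth_disc_average_eq_disc_mean)
  have "?m (\<lambda>h. u (x + h)) + ?m (\<lambda>h. u (x + - h)) = ?m (\<lambda>h. u (x + h) + u (x + - h))"
    by (rule disc_mean_add[OF B, of _ c _ c, symmetric]) (auto intro: bdd)
  also have "\<dots> \<le> ?m (\<lambda>_. 2 * e)"
  proof (rule disc_mean_mono[OF B \<open>\<epsilon> > 0\<close>, of _ "2 * c" _ "\<bar>2 * e\<bar>"])
    show "\<bar>u (x + h) + u (x + - h)\<bar> \<le> 2 * c" for h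
      using bdd[of "x + h"] bdd[of "x + - h"] by linarith
    show "u (x + h) + u (x + - h) \<le> 2 * e" if "h \<in> {v. \<nu> \<bullet> v = 0}" "norm h < \<epsilon>" for h
      using le[of h] that by simp
  qed measurable
  also have "\<dots> = 2 * e" by (rule disc_mean_const[OF B \<open>\<epsilon> > 0\<close>])
  also have "?m (\<lambda>h. u (x + - h)) = ?m (\<lambda>h. u (x + h))"
    using bdd by (intro disc_mean_even[OF B \<open>\<epsilon> > 0\<close>, of "\<lambda>h. u (x + h)" c]) auto
  finally show ?thesis using m by simp
qed

lemma orth_disc_average_uminus: "orth_disc_average (\<lambda>y. - u y) \<epsilon> \<nu> x = - orth_disc_average u \<epsilon> \<nu> x"
  by (simp add: orth_disc_average_def set_lebesgue_integral_def)

lemma orth_disc_average_diff_bound: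
  fixes u :: "'a::euclidean_space \<Rightarrow> real"
  assumes u[measurable]: "u \<in> borel_measurable borel" and bdd: "\<And>h. \<bar>u h\<bar> \<le> c" and "\<epsilon> > 0"
    and Q: "linear Q" "\<And>h. norm (Q h) = norm h" "Q ` {h. \<nu> \<bullet> h = 0} = {h. \<nu>' \<bullet> h = 0}"
    and le: "\<And>h. \<nu> \<bullet> h = 0 \<Longrightarrow> norm h < \<epsilon> \<Longrightarrow>
               (u (x + h) - u (z + Q h)) + (u (x - h) - u (z - Q h)) \<le> 2 * e"
  shows "orth_disc_average u \<epsilon> \<nu> x - orth_disc_average u \<epsilon> \<nu>' z \<le> e"
proof -
  note B = orthonormal_hyperplane_basis[of \<nu>]
  note B' = orthonormal_hyperplane_basis[of \<nu>']
  have Qm[measurable]: "Q \<in> borel_measurable borel"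
    using Q(1) by (intro borel_measurable_continuous_onI linear_continuous_on linear_conv_bounded_linear[THEN iffD1])
  let ?m = "disc_mean (hyperplane_basis \<nu>) \<epsilon>" and ?m' = "disc_mean (hyperplane_basis \<nu>') \<epsilon>"
  let ?G = "\<lambda>h. u (x + h) + - u (z + Q h)"
  have G: "?G \<in> borel_measurable borel" "\<And>h. \<bar>?G h\<bar> \<le> 2 * c"
    subgoal by measurable
    subgoal for h using bdd[of "x + h"] bdd[of "z + Q h"] by linarith
    done
  have m: "orth_disc_average u \<epsilon> \<nu> x = ?m (\<lambda>h. u (x + h))"
    by (simp add: orth_disc_average_eq_disc_mean)
  have "orth_disc_average u \<epsilon> \<nu>' z = ?m' (\<lambda>h. u (z + h))"
    by (simp add: orth_disc_average_eq_disc_mean)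
  also have "\<dots> = ?m' (\<lambda>h. u (z + - h))"
    using bdd by (intro disc_mean_even[OF B' \<open>\<epsilon> > 0\<close>, of "\<lambda>h. u (z + h)" c, symmetric]) auto
  also have "\<dots> = ?m (\<lambda>h. u (z + Q h))"
    using bdd by (intro disc_mean_transfer[OF B B' \<open>\<epsilon> > 0\<close> Q, of "\<lambda>h. u (z + h)" c, symmetric]) auto
  finally have "orth_disc_average u \<epsilon> \<nu> x - orth_disc_average u \<epsilon> \<nu>' z = ?m (\<lambda>h. u (x + h)) + ?m (\<lambda>h. - u (z + Q h))"
    using m by (simp add: disc_mean_uminus)
  also have "\<dots> = ?m ?G"
    using bdd by (intro disc_mean_add[OF B, of _ c _ c, symmetric]) auto
  finally have 1: "orth_disc_average u \<epsilon> \<nu> x - orth_disc_average u \<epsilon> \<nu>' z = ?m ?G" .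
  have "?m ?G + ?m (\<lambda>h. ?G (- h)) = ?m (\<lambda>h. ?G h + ?G (- h))"
    using G(1) by (intro disc_mean_add[OF B, of _ "2*c" _ "2*c", symmetric] G) measurable
  also have "\<dots> \<le> ?m (\<lambda>_. 2 * e)"
  proof (rule disc_mean_mono[OF B \<open>\<epsilon> > 0\<close>, of _ "4 * c" _ "\<bar>2 * e\<bar>"])
    show "\<bar>?G h + ?G (- h)\<bar> \<le> 4 * c" for h
      using G(2)[of h] G(2)[of "- h"] by linarith
    show "?G h + ?G (- h) \<le> 2 * e" if "h \<in> {v. \<nu> \<bullet> v = 0}" "norm h < \<epsilon>" for h
      using le[of h] that by (simp add: linear_neg[OF Q(1)])
  qed measurable
  also have "\<dots> = 2 * e" by (rule disc_mean_const[OF B \<open>\<epsilon> > 0\<close>])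
  also have "?m (\<lambda>h. ?G (- h)) = ?m ?G"
    by (intro disc_mean_even[OF B \<open>\<epsilon> > 0\<close>, of ?G "2 * c"] G)
  finally show ?thesis using 1 by simp
qed

section \<open>The barrier and its second-order expansion\<close>

text \<open>
  The second derivative of \<open>(1 + x) powr (1 + p)\<close> is at least \<open>(4/7) * p\<close> for \<open>-1 < x < 3/4\<close>, so subtracting
  \<open>(p/4) * x\<^sup>2\<close> keeps the function convex and hence above its tangent at \<open>0\<close>.
\<close>
lemma powr_quadratic_lower_bound:
  fixes p x :: real
  assumes "0 < p" "p \<le> 1/2" "\<bar>x\<bar> \<le> 1/2"
  shows "(1 + x) powr (1 + p) \<ge> 1 + (1 + p) * x + p / 4 * x\<^sup>2"
proof -
  let ?f = "\<lambda>x. (1 + x) powr (1 + p) - p / 4 * x\<^sup>2"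
  let ?f' = "\<lambda>x. (1 + p) * (1 + x) powr p - p / 2 * x"
  let ?f'' = "\<lambda>x. (1 + p) * p * (1 + x) powr (p - 1) - p / 2"
  let ?I = "{-1<..<3/4::real}"
  have d1: "(?f has_real_derivative ?f' x) (at x)" if "x \<in> ?I" for x
    using that by (auto intro!: derivative_eq_intros simp: field_simps)
  have d2: "(?f' has_real_derivative ?f'' x) (at x)" if "x \<in> ?I" for x
    using that by (auto intro!: derivative_eq_intros simp: field_simps)
  have nonneg: "?f'' x \<ge> 0" if "x \<in> ?I" for x
  proof -
    have "(1 + x) powr (p - 1) \<ge> (7/4) powr (p - 1)"
      using that assms by (intro powr_mono2') auto
    moreover have "(7/4::real) powr (p - 1) \<ge> (7/4) powr (-1)"
      using assms by (intro powr_mono) auto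
    moreover have "(7/4::real) powr (-1) = 4/7" by (simp add: powr_minus)
    ultimately have "(1 + x) powr (p - 1) \<ge> 4/7" by linarith
    then have "p * (1 + x) powr (p - 1) \<ge> p * (4/7)" using assms by (intro mult_left_mono) auto
    moreover have "(1 + p) * (p * (1 + x) powr (p - 1)) \<ge> 1 * (p * (1 + x) powr (p - 1))"
      using assms by (intro mult_right_mono) auto
    ultimately show ?thesis using assms by (simp add: mult.assoc)
  qed
  have "convex_on ?I ?f"
    by (rule f''_ge0_imp_convex[OF _ d1 d2 nonneg]) auto
  then have "?f x - ?f 0 \<ge> ?f' 0 * (x - 0)"
  proof (rule convex_on_imp_above_tangent)
    show "(?f has_real_derivative ?f' 0) (at 0 within ?I)"
      by (rule has_field_derivative_at_within, rule d1) auto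
    show "0 \<in> interior ?I" by (simp add: interior_open)
    show "x \<in> ?I" using assms by (auto simp: abs_le_iff)
  qed auto
  then show ?thesis by simp
qed

definition concave_mod :: "real \<Rightarrow> real \<Rightarrow> real" where
  "concave_mod p t = t - t * t powr p"

lemma concave_mod_upper: "0 \<le> t \<Longrightarrow> concave_mod p t \<le> t"
  by (simp add: concave_mod_def)

lemma concave_mod_lower:
  assumes "0 \<le> t" "t powr p \<le> 1/4"
  shows "t / 2 \<le> concave_mod p t"
proof -
  have "t * t powr p \<le> t * (1/4)" using assms by (intro mult_left_mono) auto
  then show ?thesis using assms by (simp add: concave_mod_def)
qed

text \<open>
  The bound on \<open>b powr p\<close> keeps the derivative \<open>1 - (1 + p) * t powr p\<close> between \<open>0\<close> and \<open>1\<close>.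
\<close>
lemma concave_mod_increment:
  assumes "0 < p" "p \<le> 1/2" "0 \<le> a" "a \<le> b" "b powr p \<le> 1/4"
  shows "concave_mod p a \<le> concave_mod p b" "concave_mod p b \<le> concave_mod p a + (b - a)"
proof -
  have eq: "t * t powr p = t powr (1 + p)" if "t \<ge> 0" for t
    using that by (cases "t = 0") (auto simp: powr_add)
  have "a powr (1 + p) \<le> b powr (1 + p)"
    using assms by (intro powr_mono2) auto
  then show "concave_mod p b \<le> concave_mod p a + (b - a)"
    using assms by (simp add: concave_mod_def eq)
  show "concave_mod p a \<le> concave_mod p b"
  proof (cases "a = b \<or> a = 0")
    case True
    then show ?thesis using concave_mod_lower[of b p] assms by (auto simp: concave_mod_def[of p 0])
  next
    case False
    then have ab: "0 < a" "a < b" using assms by auto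
    have "\<exists>z>a. z < b \<and> b powr (1 + p) - a powr (1 + p) = (b - a) * ((1 + p) * z powr p)"
      using ab by (intro MVT2) (auto intro!: derivative_eq_intros simp: field_simps)
    then obtain z where z: "a < z" "z < b" "b powr (1 + p) - a powr (1 + p) = (b - a) * ((1 + p) * z powr p)"
      by blast
    have "z powr p \<le> b powr p" using z ab assms by (intro powr_mono2) auto
    then have "(1 + p) * z powr p \<le> 2 * (1/4)" using assms by (intro mult_mono) auto
    then have "(b - a) * ((1 + p) * z powr p) \<le> (b - a) * 1" using ab by (intro mult_left_mono) auto
    then show ?thesis using z(3) eq[of a] eq[of b] assms(3,4) unfolding concave_mod_def by auto
  qed
qed

text \<open>
  The quadratic term is the gain that the whole argument lives on: it has the size
  \<open>t powr (p - 1) * e\<^sup>2\<close>.  It follows from the case \<open>t = 1\<close> by scaling.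
\<close>
lemma concave_mod_expansion:
  assumes p: "0 < p" "p \<le> 1/2" and t: "0 < t" "\<bar>e\<bar> \<le> t / 2"
  shows "concave_mod p (t + e)
     \<le> concave_mod p t + (1 - (1 + p) * t powr p) * e - p / 4 * (t powr p / t) * e\<^sup>2"
proof -
  define x where "x = e / t"
  have x: "\<bar>x\<bar> \<le> 1/2" "e = t * x" using t by (simp_all add: x_def abs_divide divide_le_eq)
  have te: "t + e = t * (1 + x)" "1 + x > 0" using x by (simp_all add: distrib_left abs_le_iff)
  have "(t + e) * (t + e) powr p = t * t powr p * ((1 + x) * (1 + x) powr p)"
    unfolding te(1) using t te(2) by (simp add: powr_mult)
  also have "(1 + x) * (1 + x) powr p = (1 + x) powr (1 + p)"
    using te(2) by (simp add: powr_add)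
  also have "t * t powr p * (1 + x) powr (1 + p) \<ge> t * t powr p * (1 + (1 + p) * x + p / 4 * x\<^sup>2)"
    using t by (intro mult_left_mono powr_quadratic_lower_bound p x) auto
  finally have "t * t powr p * (1 + (1 + p) * x + p / 4 * x\<^sup>2) \<le> (t + e) * (t + e) powr p" .
  moreover have "t * t powr p * (1 + (1 + p) * x + p / 4 * x\<^sup>2)
      = t * t powr p + (1 + p) * t powr p * e + p / 4 * (t powr p / t) * e\<^sup>2"
  proof -
    have "t * P * (1 + (1 + p) * x + p / 4 * x\<^sup>2) = t * P + (1 + p) * P * (t * x) + p / 4 * (P / t) * (t * x)\<^sup>2" for P
      using t(1) by (simp add: power2_eq_square field_simps)
    then show ?thesis unfolding x(2) by blast
  qed
  ultimately show ?thesis unfolding concave_mod_def by (simp add: left_diff_distrib)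
qed

text \<open>
  The step from \<open>k\<close> to \<open>k + 1\<close> has height \<open>L ^ (N - k)\<close>, so each step is \<open>L\<close> times as high as the
  next one, and the stair is flat from \<open>N\<close> on.
\<close>
definition stair :: "real \<Rightarrow> nat \<Rightarrow> nat \<Rightarrow> real" where
  "stair L N k = (\<Sum>j<k. if j < N then L ^ (N - j) else 0)"

lemma stair_0 [simp]: "stair L N 0 = 0"
  by (simp add: stair_def)

lemma stair_Suc: "stair L N (Suc k) = stair L N k + (if k < N then L ^ (N - k) else 0)"
  by (simp add: stair_def)

lemma stair_mono: "L \<ge> 0 \<Longrightarrow> k \<le> l \<Longrightarrow> stair L N k \<le> stair L N l"
  unfolding stair_def by (rule sum_mono2) auto

lemma stair_const: "k \<ge> N \<Longrightarrow> stair L N k = stair L N N"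
  by (induction rule: dec_induct) (auto simp: stair_Suc)

lemma stair_le: "L \<ge> 0 \<Longrightarrow> stair L N k \<le> stair L N N"
  using stair_mono[of L k N N] stair_const[of N k L] by (cases "k \<le> N") auto

lemma stair_nonneg: "L \<ge> 0 \<Longrightarrow> 0 \<le> stair L N k"
  using stair_mono[of L 0 k N] by simp

text \<open>
  A move of both points towards each other shortens their distance by \<open>2 * \<epsilon>\<close>, which is exactly one step of
  the stair.
\<close>
definition pair_mod :: "real \<Rightarrow> real \<Rightarrow> nat \<Rightarrow> real \<Rightarrow> real \<Rightarrow> real" where
  "pair_mod p L N \<epsilon> t = concave_mod p t + \<epsilon> * stair L N (nat \<lceil>t / (2 * \<epsilon>)\<rceil>)"

lemma pair_mod_upper:
  assumes "L \<ge> 0" "\<epsilon> > 0" "t \<ge> 0"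
  shows "pair_mod p L N \<epsilon> t \<le> t + \<epsilon> * stair L N N"
  unfolding pair_mod_def using assms
  by (intro add_mono concave_mod_upper mult_left_mono stair_le) auto

lemma pair_mod_nonneg:
  assumes "L \<ge> 0" "\<epsilon> > 0" "t \<ge> 0" "t powr p \<le> 1/4"
  shows "pair_mod p L N \<epsilon> t \<ge> 0"
  unfolding pair_mod_def using assms concave_mod_lower[of t p]
  by (intro add_nonneg_nonneg mult_nonneg_nonneg stair_nonneg) auto

definition weight :: "real \<Rightarrow> 'a::euclidean_space \<Rightarrow> real" where
  "weight \<rho> y = 1 / (\<rho>\<^sup>2 - (norm y)\<^sup>2)\<^sup>2"

lemma weight_nonneg: "weight \<rho> y \<ge> 0"
  by (simp add: weight_def)

lemma inverse_square_quadratic: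
  fixes x :: real
  assumes "\<bar>x\<bar> \<le> 1/2"
  shows "1 / (1 - x)\<^sup>2 \<le> 1 + 2 * x + 8 * x\<^sup>2"
proof -
  have "0 \<le> x\<^sup>2 * ((1 - 2 * x) * (5 - 4 * x))"
    using assms by (intro mult_nonneg_nonneg) (auto simp: abs_le_iff)
  also have "\<dots> = (1 + 2 * x + 8 * x\<^sup>2) * (1 - x)\<^sup>2 - 1" 
    by (simp add: power2_eq_square algebra_simps)
  finally show ?thesis using assms by (simp add: divide_le_eq)
qed

lemma weight_region:
  fixes y \<sigma> :: "'a::euclidean_space"
  assumes "q = \<rho>\<^sup>2 - (norm y)\<^sup>2" "q > 0" "0 < \<rho>" "\<rho> \<le> 1"
  shows "q \<le> 1" "\<bar>y \<bullet> \<sigma>\<bar> \<le> norm \<sigma>"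
proof -
  have \<rho>2: "\<rho>\<^sup>2 \<le> 1" using assms by (simp add: power_le_one)
  then show "q \<le> 1" using assms(1) zero_le_power2[of "norm y"] by linarith
  have "(norm y)\<^sup>2 \<le> 1\<^sup>2" using \<rho>2 assms by simp
  then have y: "norm y \<le> 1" by (rule power2_le_imp_le) simp
  have "\<bar>y \<bullet> \<sigma>\<bar> \<le> norm y * norm \<sigma>" by (rule Cauchy_Schwarz_ineq2)
  also have "\<dots> \<le> 1 * norm \<sigma>" using y by (rule mult_right_mono) simp
  finally show "\<bar>y \<bullet> \<sigma>\<bar> \<le> norm \<sigma>" by simp
qed

text \<open>
  With \<open>e = 2 * (y \<bullet> \<sigma>) + (norm \<sigma>)\<^sup>2\<close> the left-hand side is the weight at \<open>y\<close> divided by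
  \<open>(1 - e / q)\<^sup>2\<close>.  The constant is \<open>74 = 2 + 8 * 9\<close>, from \<open>\<bar>e\<bar> \<le> 3 * norm \<sigma>\<close> and \<open>q \<le> 1\<close>.
\<close>
lemma weight_expansion:
  fixes y \<sigma> :: "'a::euclidean_space"
  assumes q: "q = \<rho>\<^sup>2 - (norm y)\<^sup>2" "q > 0" and \<rho>: "0 < \<rho>" "\<rho> \<le> 1" and \<sigma>: "6 * norm \<sigma> \<le> q"
  shows "weight \<rho> (y + \<sigma>) \<le> weight \<rho> y * (1 + 4 / q * (y \<bullet> \<sigma>) + 74 * (norm \<sigma>)\<^sup>2 / q\<^sup>2)"
proof -
  define e where "e = 2 * (y \<bullet> \<sigma>) + (norm \<sigma>)\<^sup>2"
  note q1 = weight_region(1)[OF q \<rho>]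
  then have \<sigma>1: "norm \<sigma> \<le> 1" using \<sigma> by linarith
  have "\<bar>y \<bullet> \<sigma>\<bar> \<le> norm \<sigma>" by (rule weight_region(2)[OF q \<rho>])
  moreover have "(norm \<sigma>)\<^sup>2 \<le> norm \<sigma>" using \<sigma>1 by (simp add: power2_eq_square mult_left_le_one_le)
  ultimately have e: "\<bar>e\<bar> \<le> 3 * norm \<sigma>" using zero_le_power2[of "norm \<sigma>"] unfolding e_def by linarith
  define x where "x = e / q"
  have x: "\<bar>x\<bar> \<le> 1/2" using e \<sigma> q by (simp add: x_def abs_divide divide_le_eq)
  have "(norm (y + \<sigma>))\<^sup>2 = (norm y)\<^sup>2 + e"
    by (simp add: e_def power2_norm_eq_inner inner_commute algebra_simps)
  then have "\<rho>\<^sup>2 - (norm (y + \<sigma>))\<^sup>2 = q * (1 - x)" 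
  proof -
    have "q * x = e" using q(2) by (simp add: x_def)
    then show ?thesis using \<open>(norm (y + \<sigma>))\<^sup>2 = (norm y)\<^sup>2 + e\<close> q(1) by (simp add: right_diff_distrib)
  qed
  then have "weight \<rho> (y + \<sigma>) = weight \<rho> y * (1 / (1 - x)\<^sup>2)"
    by (simp add: weight_def q(1)[symmetric] power_mult_distrib)
  also have "\<dots> \<le> weight \<rho> y * (1 + 2 * x + 8 * x\<^sup>2)"
    using inverse_square_quadratic[OF x] by (intro mult_left_mono) (auto simp: weight_def)
  also have "\<dots> \<le> weight \<rho> y * (1 + 4 / q * (y \<bullet> \<sigma>) + 74 * (norm \<sigma>)\<^sup>2 / q\<^sup>2)"
  proof (intro mult_left_mono)
    have "x\<^sup>2 \<le> 9 * (norm \<sigma>)\<^sup>2 / q\<^sup>2"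
    proof -
      have "\<bar>e\<bar>\<^sup>2 \<le> (3 * norm \<sigma>)\<^sup>2" using e by (intro power_mono) auto
      then show ?thesis by (simp add: x_def power_divide divide_right_mono power_mult_distrib)
    qed
    moreover have "2 * x = 4 / q * (y \<bullet> \<sigma>) + 2 * (norm \<sigma>)\<^sup>2 / q"
      by (simp add: x_def e_def field_simps add_divide_distrib)
    moreover have "(norm \<sigma>)\<^sup>2 / q \<le> (norm \<sigma>)\<^sup>2 / q\<^sup>2"
      using q q1 by (intro divide_left_mono) (auto simp: power2_eq_square mult_left_le_one_le)
    ultimately show "1 + 2 * x + 8 * x\<^sup>2 \<le> 1 + 4 / q * (y \<bullet> \<sigma>) + 74 * (norm \<sigma>)\<^sup>2 / q\<^sup>2"
      by simp
  qed (simp add: weight_def)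
  finally show ?thesis .
qed

text \<open>
  Complete the square: \<open>sqrt (A\<^sup>2 + B) \<le> A + B / (2 * A)\<close> with \<open>A = t + w \<bullet> V\<close>, and \<open>2 * A \<ge> t\<close>.
\<close>
lemma norm_add_le_parallel:
  fixes v w :: "'a::euclidean_space"
  assumes t: "t = norm v" "t > 0" and w: "norm w \<le> t / 2" and V: "V = v /\<^sub>R t"
  shows "norm (v + w) \<le> t + w \<bullet> V + ((norm w)\<^sup>2 - (w \<bullet> V)\<^sup>2) / t"
proof -
  have nV: "norm V = 1" using t V by simp
  have wV: "\<bar>w \<bullet> V\<bar> \<le> norm w" using Cauchy_Schwarz_ineq2[of w V] nV by simp
  define A where "A = t + w \<bullet> V"
  define B where "B = (norm w)\<^sup>2 - (w \<bullet> V)\<^sup>2"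
  have A: "A \<ge> t / 2" using wV w by (simp add: A_def)
  have B: "B \<ge> 0" using wV by (simp add: B_def abs_le_square_iff[symmetric])
  have "v \<bullet> w = t * (w \<bullet> V)" using t by (simp add: V inner_commute)
  then have "(norm (v + w))\<^sup>2 = t\<^sup>2 + 2 * (t * (w \<bullet> V)) + (norm w)\<^sup>2"
    by (simp add: t(1) power2_norm_eq_inner inner_commute algebra_simps)
  also have "\<dots> = A\<^sup>2 + B"
    by (simp add: A_def B_def power2_eq_square algebra_simps)
  also have "\<dots> \<le> A\<^sup>2 + 2 * A * (B / t) + (B / t)\<^sup>2"
  proof -
    have "t * (B / t) \<le> 2 * A * (B / t)" using A B t by (intro mult_right_mono) auto
    moreover have "t * (B / t) = B" using t(2) by simp
    ultimately show ?thesis using zero_le_power2[of "B / t"] by linarith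
  qed
  also have "\<dots> = (A + B / t)\<^sup>2" by (simp add: power2_eq_square algebra_simps)
  finally have "norm (v + w) \<le> A + B / t"
    
  proof (rule power2_le_imp_le)
    have "B / t \<ge> 0" using B t(2) by simp
    then show "0 \<le> A + B / t" using A t(2) by linarith
  qed
  then show ?thesis by (simp add: A_def B_def)
qed

definition mid :: "'a::euclidean_space \<Rightarrow> 'a \<Rightarrow> 'a" where
  "mid x z = (1/2) *\<^sub>R (x + z)"

definition barrier :: "real \<Rightarrow> real \<Rightarrow> nat \<Rightarrow> real \<Rightarrow> real \<Rightarrow> 'a::euclidean_space \<Rightarrow> 'a \<Rightarrow> 'a \<Rightarrow> real" where
  "barrier p L N \<epsilon> \<rho> y0 x z = pair_mod p L N \<epsilon> (norm (x - z)) * weight \<rho> (mid x z - y0)"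

text \<open>
  For \<open>t > 2 * N * \<epsilon>\<close> the stair is at its top at distance \<open>t\<close>, so it cannot grow and only the concave part
  changes.  The terms are, in order: the value, the two first-order terms (change of distance and
  change of midpoint), the concavity gain, the loss from the component of \<open>a - b\<close> orthogonal to \<open>x - z\<close>,
  and the mixed and pure second-order errors of the weight.
\<close>
lemma barrier_expansion:
  fixes x z a b :: "'a::euclidean_space"
  assumes p: "0 < p" "p \<le> 1/2" and L: "L \<ge> 0" and \<epsilon>: "\<epsilon> > 0"
    and t: "t = norm (x - z)" "2 * real N * \<epsilon> < t" "4 * \<epsilon> \<le> t" "(t + 2 * \<epsilon>) powr p \<le> 1/4"
    and y: "y = mid x z - y0" and q: "q = \<rho>\<^sup>2 - (norm y)\<^sup>2" "6 * \<epsilon> \<le> q" and \<rho>: "0 < \<rho>" "\<rho> \<le> 1"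
    and V: "V = (x - z) /\<^sub>R t" and ab: "norm a \<le> \<epsilon>" "norm b \<le> \<epsilon>"
    and \<Psi>: "\<Psi> = pair_mod p L N \<epsilon> t" and \<sigma>: "\<sigma> = mid a b"
  shows "barrier p L N \<epsilon> \<rho> y0 (x + a) (z + b) \<le> weight \<rho> y *
    (\<Psi> + (1 - (1 + p) * t powr p) * ((a - b) \<bullet> V) + 4 * \<Psi> / q * (y \<bullet> \<sigma>)
     - p / 4 * (t powr p / t) * ((a - b) \<bullet> V)\<^sup>2 + ((norm (a - b))\<^sup>2 - ((a - b) \<bullet> V)\<^sup>2) / t
     + 4 / q * norm (a - b) * norm \<sigma> + 74 * (\<Psi> + 2 * \<epsilon>) * (norm \<sigma>)\<^sup>2 / q\<^sup>2)"
proof -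
  define d where "d = a - b"
  define t' where "t' = norm (x + a - (z + b))"
  define \<Delta> where "\<Delta> = concave_mod p t' - concave_mod p t"
  have t0: "t > 0" and q0: "q > 0" using \<epsilon> t(3) q(2) by linarith+
  have d: "norm d \<le> 2 * \<epsilon>" unfolding d_def using norm_triangle_ineq4[of a b] ab by linarith
  have \<sigma>n: "norm \<sigma> \<le> \<epsilon>" unfolding \<sigma> mid_def using norm_triangle_ineq[of a b] ab by simp
  have t'eq: "t' = norm ((x - z) + d)" by (simp add: t'_def d_def algebra_simps)
  have diff: "\<bar>t' - t\<bar> \<le> norm d" unfolding t'eq t(1)
    using norm_triangle_ineq3[of "x - z + d" "x - z"] by simp
  have dV: "\<bar>d \<bullet> V\<bar> \<le> norm d" using Cauchy_Schwarz_ineq2[of d V] t0 t(1) by (simp add: V)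
  have pw: "b powr p \<le> 1/4" if "0 \<le> b" "b \<le> t + 2 * \<epsilon>" for b
    using powr_mono2[of p b "t + 2 * \<epsilon>"] that p t(4) by linarith
  have t'0: "t' \<ge> 0" by (simp add: t'_def)
  have t'2: "t' \<le> t + 2 * \<epsilon>" using diff d by linarith
  have \<Delta>abs: "\<bar>\<Delta>\<bar> \<le> norm d"
    using concave_mod_increment[OF p t'0 _ pw[of t]] concave_mod_increment[OF p _ _ pw[of t'], of t]
      t0 t'0 t'2 diff \<epsilon> unfolding \<Delta>_def by (cases "t' \<le> t") auto
  have \<Delta>: "\<Delta> \<le> (1 - (1 + p) * t powr p) * (d \<bullet> V) - p / 4 * (t powr p / t) * (d \<bullet> V)\<^sup>2
       + ((norm d)\<^sup>2 - (d \<bullet> V)\<^sup>2) / t"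
  proof -
    define B where "B = ((norm d)\<^sup>2 - (d \<bullet> V)\<^sup>2) / t"
    have B: "B \<ge> 0" using dV t0 by (simp add: B_def abs_le_square_iff[symmetric])
    have le: "t' \<le> t + d \<bullet> V + B"
      unfolding t'eq B_def using d t(3) t0 by (intro norm_add_le_parallel t(1) V) auto
    define T where "T = max t' (t + d \<bullet> V)"
    have T0: "0 \<le> t + d \<bullet> V" using dV d t(3) by linarith
    have Tt: "T \<le> t + 2 * \<epsilon>" "T \<ge> 0" unfolding T_def using dV d t'2 t'0 by auto
    have "concave_mod p t' \<le> concave_mod p T"
      using t'0 Tt by (intro concave_mod_increment[OF p] pw) (auto simp: T_def)
    also have "\<dots> \<le> concave_mod p (t + d \<bullet> V) + (T - (t + d \<bullet> V))"
      using T0 Tt by (intro concave_mod_increment[OF p] pw) (auto simp: T_def)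
    also have "\<dots> \<le> concave_mod p (t + d \<bullet> V) + B"
      using le B by (auto simp: T_def)
    also have "concave_mod p (t + d \<bullet> V) \<le> concave_mod p t + (1 - (1 + p) * t powr p) * (d \<bullet> V) - p / 4 * (t powr p / t) * (d \<bullet> V)\<^sup>2"
      using dV d t(3) by (intro concave_mod_expansion[OF p t0]) linarith
    finally show ?thesis by (simp add: \<Delta>_def B_def)
  qed
  have "t / (2 * \<epsilon>) > real N" using t(2) \<epsilon> by (simp add: less_divide_eq mult_ac)
  then have "nat \<lceil>t / (2 * \<epsilon>)\<rceil> \<ge> N" by linarith
  then have \<Psi>eq: "\<Psi> = concave_mod p t + \<epsilon> * stair L N N"
    unfolding \<Psi> pair_mod_def by (subst stair_const) auto
  have \<Psi>0: "\<Psi> \<ge> 0" unfolding \<Psi> using t0 by (intro pair_mod_nonneg L \<epsilon> pw) (use \<epsilon> in auto)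
  have "pair_mod p L N \<epsilon> t' \<le> concave_mod p t' + \<epsilon> * stair L N N"
    unfolding pair_mod_def using \<epsilon> L by (intro add_left_mono mult_left_mono stair_le) auto
  then have pm: "pair_mod p L N \<epsilon> t' \<le> \<Psi> + \<Delta>" by (simp add: \<Psi>eq \<Delta>_def)
  moreover have pm0: "pair_mod p L N \<epsilon> t' \<ge> 0"
    using t'0 t'2 by (intro pair_mod_nonneg L \<epsilon> pw) auto
  ultimately have \<Psi>\<Delta>: "\<Psi> + \<Delta> \<ge> 0" by linarith
  have m: "mid (x + a) (z + b) - y0 = y + \<sigma>" by (simp add: y \<sigma> mid_def algebra_simps)
  have W0: "weight \<rho> w \<ge> 0" for w :: 'a by (simp add: weight_def)
  have "barrier p L N \<epsilon> \<rho> y0 (x + a) (z + b) = pair_mod p L N \<epsilon> t' * weight \<rho> (y + \<sigma>)"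
    by (simp add: barrier_def m t'_def)
  also have "\<dots> \<le> (\<Psi> + \<Delta>) * weight \<rho> (y + \<sigma>)"
    by (rule mult_right_mono[OF pm W0])
  also have "\<dots> \<le> (\<Psi> + \<Delta>) * (weight \<rho> y * (1 + 4 / q * (y \<bullet> \<sigma>) + 74 * (norm \<sigma>)\<^sup>2 / q\<^sup>2))"
    using \<sigma>n q by (intro mult_left_mono[OF _ \<Psi>\<Delta>] weight_expansion q(1) q0 \<rho>) linarith
  also have "\<dots> = weight \<rho> y * (\<Psi> + \<Delta> + 4 * \<Psi> / q * (y \<bullet> \<sigma>) + 4 / q * (\<Delta> * (y \<bullet> \<sigma>)) + 74 * (\<Psi> + \<Delta>) * (norm \<sigma>)\<^sup>2 / q\<^sup>2)"
    by (simp add: algebra_simps add_divide_distrib)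
  also have "\<dots> \<le> weight \<rho> y * (\<Psi> + \<Delta> + 4 * \<Psi> / q * (y \<bullet> \<sigma>) + 4 / q * (norm d * norm \<sigma>) + 74 * (\<Psi> + 2 * \<epsilon>) * (norm \<sigma>)\<^sup>2 / q\<^sup>2)"
  proof (rule mult_left_mono[OF _ W0])
    note ys = weight_region(2)[OF q(1) q0 \<rho>, of \<sigma>]
    have "\<Delta> * (y \<bullet> \<sigma>) \<le> \<bar>\<Delta>\<bar> * \<bar>y \<bullet> \<sigma>\<bar>" by (simp add: abs_mult[symmetric])
    also have "\<dots> \<le> norm d * norm \<sigma>" using \<Delta>abs ys by (intro mult_mono) auto
    finally have "4 / q * (\<Delta> * (y \<bullet> \<sigma>)) \<le> 4 / q * (norm d * norm \<sigma>)"
      using q0 by (intro mult_left_mono) auto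
    moreover have "74 * (\<Psi> + \<Delta>) * (norm \<sigma>)\<^sup>2 / q\<^sup>2 \<le> 74 * (\<Psi> + 2 * \<epsilon>) * (norm \<sigma>)\<^sup>2 / q\<^sup>2"
      using \<Delta>abs d by (intro divide_right_mono mult_right_mono) auto
    ultimately show "\<Psi> + \<Delta> + 4 * \<Psi> / q * (y \<bullet> \<sigma>) + 4 / q * (\<Delta> * (y \<bullet> \<sigma>)) + 74 * (\<Psi> + \<Delta>) * (norm \<sigma>)\<^sup>2 / q\<^sup>2
      \<le> \<Psi> + \<Delta> + 4 * \<Psi> / q * (y \<bullet> \<sigma>) + 4 / q * (norm d * norm \<sigma>) + 74 * (\<Psi> + 2 * \<epsilon>) * (norm \<sigma>)\<^sup>2 / q\<^sup>2"
      by linarith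
  qed
  also have "\<dots> \<le> weight \<rho> y *
    (\<Psi> + (1 - (1 + p) * t powr p) * (d \<bullet> V) + 4 * \<Psi> / q * (y \<bullet> \<sigma>)
     - p / 4 * (t powr p / t) * (d \<bullet> V)\<^sup>2 + ((norm d)\<^sup>2 - (d \<bullet> V)\<^sup>2) / t
     + 4 / q * norm d * norm \<sigma> + 74 * (\<Psi> + 2 * \<epsilon>) * (norm \<sigma>)\<^sup>2 / q\<^sup>2)"
    using \<Delta> by (intro mult_left_mono W0) (simp add: algebra_simps)
  finally show ?thesis unfolding d_def .
qed

section \<open>The reflection coupling and two balance inequalities\<close>

text \<open>
  For \<open>e = 0\<close> the coefficient is \<open>0\<close> and the map is the identity, which is the correct coupling
  of equal moves.
\<close>
definition reflect :: "'a::euclidean_space \<Rightarrow> 'a \<Rightarrow> 'a" where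
  "reflect e h = h - (2 * (e \<bullet> h) / (e \<bullet> e)) *\<^sub>R e"

lemma linear_reflect: "linear (reflect e)"
  by (rule linearI) (simp_all add: reflect_def algebra_simps add_divide_distrib scaleR_add_left)

lemma reflect_inner: "reflect e g \<bullet> reflect e h = g \<bullet> h"
proof (cases "e = 0")
  case False
  then have "e \<bullet> e \<noteq> 0" by simp
  then show ?thesis
    by (simp add: reflect_def inner_diff_left inner_diff_right inner_commute field_simps)
qed (simp add: reflect_def)

lemma norm_reflect: "norm (reflect e h) = norm h"
  by (simp add: norm_eq_sqrt_inner reflect_inner)

lemma reflect_reflect: "reflect e (reflect e h) = h"
  by (cases "e = 0") (simp_all add: reflect_def inner_diff_right algebra_simps)

lemma reflect_swap:
  assumes "norm \<nu> = norm \<nu>'"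
  shows "reflect (\<nu> - \<nu>') \<nu> = \<nu>'"
proof (cases "\<nu> = \<nu>'")
  case False
  have "\<nu> \<bullet> \<nu> = \<nu>' \<bullet> \<nu>'" using assms by (simp add: norm_eq_sqrt_inner)
  then have "2 * ((\<nu> - \<nu>') \<bullet> \<nu>) = (\<nu> - \<nu>') \<bullet> (\<nu> - \<nu>')"
    by (simp add: inner_diff_left inner_diff_right inner_commute)
  moreover have "(\<nu> - \<nu>') \<bullet> (\<nu> - \<nu>') \<noteq> 0" using False by simp
  ultimately show ?thesis by (simp add: reflect_def)
qed (simp add: reflect_def)

lemma reflect_hyperplane:
  assumes "norm \<nu> = norm \<nu>'"
  shows "reflect (\<nu> - \<nu>') ` {h. \<nu> \<bullet> h = 0} = {h. \<nu>' \<bullet> h = 0}"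
proof -
  let ?Q = "reflect (\<nu> - \<nu>')"
  have Q: "?Q \<nu> = \<nu>'" "?Q \<nu>' = \<nu>"
    using reflect_swap[OF assms] reflect_reflect by metis+
  have 1: "\<nu>' \<bullet> ?Q h = \<nu> \<bullet> h" "\<nu> \<bullet> ?Q h = \<nu>' \<bullet> h" for h
    using reflect_inner[of "\<nu> - \<nu>'" \<nu> h] reflect_inner[of "\<nu> - \<nu>'" \<nu>' h] Q by simp_all
  show ?thesis
  proof safe
    fix h assume "\<nu>' \<bullet> h = 0"
    then show "h \<in> ?Q ` {h. \<nu> \<bullet> h = 0}"
      by (intro image_eqI[of _ _ "?Q h"]) (simp_all add: reflect_reflect 1)
  qed (simp add: 1)
qed

lemma norm_diff_mid:
  assumes "norm \<nu> = \<epsilon>" "norm \<nu>' = \<epsilon>"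
  shows "(norm (\<nu> - \<nu>'))\<^sup>2 + 4 * (norm (mid \<nu> \<nu>'))\<^sup>2 = 4 * \<epsilon>\<^sup>2"
proof -
  have "\<nu> \<bullet> \<nu> = \<epsilon>\<^sup>2" "\<nu>' \<bullet> \<nu>' = \<epsilon>\<^sup>2" using assms by (simp_all add: power2_norm_eq_inner[symmetric])
  moreover have "4 * (norm (mid \<nu> \<nu>'))\<^sup>2 = (norm (\<nu> + \<nu>'))\<^sup>2"
    by (simp add: mid_def power_divide)
  ultimately show ?thesis
    by (simp add: power2_norm_eq_inner inner_add_left inner_add_right inner_diff_left inner_diff_right inner_commute)
qed

lemma mid_minus: "mid (- a) (- b) = - mid a b"
  by (simp add: mid_def algebra_simps)

text \<open>
  If \<open>\<sigma>\<close> is the midpoint of the moves, then \<open>(\<nu> - \<nu>') \<bullet> h = - 2 * (\<sigma> \<bullet> h)\<close> because \<open>h\<close> is orthogonal to \<open>\<nu>\<close>.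
  For long \<open>\<nu> - \<nu>'\<close> this gives the bound; for short \<open>\<nu> - \<nu>'\<close> the vector \<open>\<sigma>\<close> is itself of length comparable to
  \<open>\<epsilon>\<close>, and the triangle inequality suffices.
\<close>
lemma reflect_near_identity:
  assumes n: "norm \<nu> = \<epsilon>" "norm \<nu>' = \<epsilon>" and h: "\<nu> \<bullet> h = 0" "norm h \<le> \<epsilon>"
  shows "norm (h - reflect (\<nu> - \<nu>') h) \<le> 4 * norm (mid \<nu> \<nu>')"
proof -
  define e where "e = \<nu> - \<nu>'"
  define \<sigma> where "\<sigma> = mid \<nu> \<nu>'"
  have par: "(norm e)\<^sup>2 + 4 * (norm \<sigma>)\<^sup>2 = 4 * \<epsilon>\<^sup>2"
    by (rule norm_diff_mid[OF n, folded e_def \<sigma>_def])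
  have \<epsilon>0: "\<epsilon> \<ge> 0" using n by auto
  show ?thesis
  proof (cases "norm e \<ge> \<epsilon> \<and> e \<noteq> 0")
    case True
    have "e \<bullet> h = - 2 * (\<sigma> \<bullet> h)" using h by (simp add: e_def \<sigma>_def mid_def inner_diff_left inner_add_left)
    then have "\<bar>e \<bullet> h\<bar> = 2 * \<bar>\<sigma> \<bullet> h\<bar>" by simp
    also have "\<dots> \<le> 2 * (norm \<sigma> * norm h)" using Cauchy_Schwarz_ineq2[of \<sigma> h] by simp
    also have "\<dots> \<le> 2 * (norm \<sigma> * norm e)" using h True by (intro mult_left_mono) auto
    finally have eh: "\<bar>e \<bullet> h\<bar> \<le> 2 * norm \<sigma> * norm e" by simp
    have "norm (h - reflect e h) = 2 * \<bar>e \<bullet> h\<bar> / norm e"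
      using True by (simp add: reflect_def abs_mult dot_square_norm power2_eq_square)
    also have "\<dots> \<le> 4 * norm \<sigma>" using eh True by (simp add: divide_le_eq)
    finally show ?thesis by (simp add: e_def \<sigma>_def)
  next
    case False
    then have "(norm e)\<^sup>2 \<le> \<epsilon>\<^sup>2" using \<epsilon>0 by (intro power_mono) auto
    then have "\<epsilon>\<^sup>2 \<le> (2 * norm \<sigma>)\<^sup>2" using par by (simp add: power_mult_distrib) (use zero_le_power2[of \<epsilon>] in linarith)
    then have "\<epsilon> \<le> 2 * norm \<sigma>" by (rule power2_le_imp_le) simp
    moreover have "norm (h - reflect e h) \<le> norm h + norm h"
      using norm_triangle_ineq4[of h "reflect e h"] by (simp add: norm_reflect)
    ultimately show ?thesis using h by (simp add: e_def \<sigma>_def)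
  qed
qed

text \<open>
  The sum over the moves \<open>(\<nu>, \<nu>')\<close> and \<open>(- \<nu>, - \<nu>')\<close> with weights \<open>a\<close>, \<open>b\<close>, \<open>\<theta>\<close>; here \<open>w\<^sup>2 = t powr p\<close>,
  \<open>s = norm (mid \<nu> \<nu>')\<close>, \<open>D = norm (\<nu> - \<nu>')\<close> and \<open>dV\<close> is the component of \<open>\<nu> - \<nu>'\<close> along \<open>x - z\<close>.
  Measured in the unit \<open>X = \<epsilon>\<^sup>2 * w\<^sup>2 / t\<close>, the concavity gain is at least \<open>(3/4) * p\<close> because \<open>dV\<^sup>2 \<ge> 3 * \<epsilon>\<^sup>2\<close>, the losses
  from transversal parts and from the reflection are multiples of \<open>c1\<close>, and everything else carries a factor \<open>\<delta>\<close>.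
\<close>
lemma antipodal_balance:
  fixes a b \<theta> m p :: real
  assumes wt: "a \<ge> m" "m > 0" "b \<ge> 0" "\<theta> \<ge> 0" "a + b + \<theta> = 1"
    and par: "0 < p" "0 < \<delta>" "\<delta> \<le> 1" "0 \<le> w" "w \<le> \<delta>" "t > 0" "\<epsilon> > 0" "K \<ge> 0" "c \<ge> 0"
    and \<theta>: "\<theta> \<le> c * w ^ 4"
    and geo: "0 \<le> s" "0 \<le> D" "D\<^sup>2 + 4 * s\<^sup>2 = 4 * \<epsilon>\<^sup>2" "dV\<^sup>2 \<le> D\<^sup>2" "dV\<^sup>2 \<ge> (4 - c1 * w\<^sup>2) * \<epsilon>\<^sup>2"
    and c1: "0 \<le> c1" "c1 \<le> 1" "20 * c1 \<le> m * p"
    and \<delta>: "\<delta> * (6 * K + c * (4 + 3 * K)) \<le> m * p / 4"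
  shows "a * (2 * (- (p / 4 * (w\<^sup>2 / t) * dV\<^sup>2) + (D\<^sup>2 - dV\<^sup>2) / t + K * (\<delta>\<^sup>2 * w\<^sup>2 * \<epsilon>\<^sup>2 / t + \<delta> * w * D * s / t)))
    + b * (2 * ((4 * s)\<^sup>2 / t + K * (\<delta>\<^sup>2 * w\<^sup>2 * \<epsilon>\<^sup>2 / t + \<delta> * w * (4 * s) * \<epsilon> / t)))
    + \<theta> * (2 * (4 * \<epsilon>\<^sup>2 / t + K * (\<delta>\<^sup>2 * w\<^sup>2 * \<epsilon>\<^sup>2 / t + 2 * \<delta> * w * \<epsilon>\<^sup>2 / t)))
    \<le> - (m * p / 2) * (\<epsilon>\<^sup>2 * w\<^sup>2 / t)"
proof -
  define X where "X = \<epsilon>\<^sup>2 * w\<^sup>2 / t"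
  have X0: "X \<ge> 0" using par by (simp add: X_def)
  have w1: "w\<^sup>2 \<le> 1" using par by (simp add: power_le_one)
  have c1w: "c1 * w\<^sup>2 \<le> 1" using mult_mono[OF c1(2) w1] by simp
  have \<delta>2: "\<delta>\<^sup>2 \<le> \<delta>" using par by (simp add: power2_eq_square mult_left_le_one_le)
  have s2: "4 * s\<^sup>2 \<le> c1 * w\<^sup>2 * \<epsilon>\<^sup>2" using geo by (simp add: algebra_simps)
  also have "\<dots> \<le> 1 * w\<^sup>2 * \<epsilon>\<^sup>2" using c1 by (intro mult_right_mono) auto
  finally have "(2 * s)\<^sup>2 \<le> (w * \<epsilon>)\<^sup>2" by (simp add: power_mult_distrib)
  then have s: "2 * s \<le> w * \<epsilon>" by (rule power2_le_imp_le) (use par in auto)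
  have "D\<^sup>2 \<le> 4 * \<epsilon>\<^sup>2" using geo(3) zero_le_power2[of s] by linarith
  then have "D\<^sup>2 \<le> (2 * \<epsilon>)\<^sup>2" by (simp add: power_mult_distrib)
  then have D: "D \<le> 2 * \<epsilon>" by (rule power2_le_imp_le) (use par in auto)
  have i1: "p / 4 * (w\<^sup>2 / t) * dV\<^sup>2 \<ge> 3 * p / 4 * X"
  proof -
    have "dV\<^sup>2 \<ge> 3 * \<epsilon>\<^sup>2" 
    proof -
      have "3 * \<epsilon>\<^sup>2 \<le> (4 - c1 * w\<^sup>2) * \<epsilon>\<^sup>2" using c1w by (intro mult_right_mono) auto
      then show ?thesis using geo(5) by linarith
    qed
    then have "p / 4 * (w\<^sup>2 / t) * dV\<^sup>2 \<ge> p / 4 * (w\<^sup>2 / t) * (3 * \<epsilon>\<^sup>2)"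
      using par by (intro mult_left_mono) auto
    then show ?thesis by (simp add: X_def mult_ac)
  qed
  have i2: "(D\<^sup>2 - dV\<^sup>2) / t \<le> c1 * X"
  proof -
    have "D\<^sup>2 - dV\<^sup>2 \<le> c1 * w\<^sup>2 * \<epsilon>\<^sup>2"
      using geo(3,5) zero_le_power2[of s] unfolding left_diff_distrib by linarith
    then have "(D\<^sup>2 - dV\<^sup>2) / t \<le> c1 * w\<^sup>2 * \<epsilon>\<^sup>2 / t" using par by (intro divide_right_mono) auto
    then show ?thesis by (simp add: X_def mult_ac)
  qed
  have i3: "\<delta>\<^sup>2 * w\<^sup>2 * \<epsilon>\<^sup>2 / t \<le> \<delta> * X"
    using mult_right_mono[OF \<delta>2 X0] by (simp add: X_def mult_ac)
  have i4: "\<delta> * w * D * s / t \<le> \<delta> * X"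
  proof -
    have "D * (2 * s) \<le> (2 * \<epsilon>) * (w * \<epsilon>)" using geo par by (intro mult_mono[OF D s]) auto
    then have "(\<delta> * w) * (D * (2 * s)) \<le> (\<delta> * w) * ((2 * \<epsilon>) * (w * \<epsilon>))" using par by (intro mult_left_mono) auto
    then have "\<delta> * w * D * s \<le> \<delta> * (\<epsilon>\<^sup>2 * w\<^sup>2)" by (simp add: power2_eq_square mult_ac)
    then have "\<delta> * w * D * s / t \<le> \<delta> * (\<epsilon>\<^sup>2 * w\<^sup>2) / t" using par by (intro divide_right_mono) auto
    then show ?thesis by (simp add: X_def)
  qed
  have i5: "(4 * s)\<^sup>2 / t \<le> 4 * c1 * X"
  proof -
    have "(4 * s)\<^sup>2 / t \<le> 4 * (c1 * w\<^sup>2 * \<epsilon>\<^sup>2) / t"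
      using s2 par by (intro divide_right_mono) (auto simp: power_mult_distrib mult_ac)
    then show ?thesis by (simp add: X_def mult_ac)
  qed
  have i6: "\<delta> * w * (4 * s) * \<epsilon> / t \<le> 2 * \<delta> * X"
  proof -
    have "(2 * \<delta> * w * \<epsilon>) * (2 * s) \<le> (2 * \<delta> * w * \<epsilon>) * (w * \<epsilon>)" using s par by (intro mult_left_mono) auto
    then have "\<delta> * w * (4 * s) * \<epsilon> / t \<le> 2 * \<delta> * (\<epsilon>\<^sup>2 * w\<^sup>2) / t"
      using par by (intro divide_right_mono) (auto simp: power2_eq_square mult_ac)
    then show ?thesis by (simp add: X_def)
  qed
  have B1: "- (p / 4 * (w\<^sup>2 / t) * dV\<^sup>2) + (D\<^sup>2 - dV\<^sup>2) / t + K * (\<delta>\<^sup>2 * w\<^sup>2 * \<epsilon>\<^sup>2 / t + \<delta> * w * D * s / t)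
      \<le> (- 3 * p / 4 + c1 + 2 * K * \<delta>) * X"
  proof -
    have "K * (\<delta>\<^sup>2 * w\<^sup>2 * \<epsilon>\<^sup>2 / t + \<delta> * w * D * s / t) \<le> K * (\<delta> * X + \<delta> * X)"
      by (rule mult_left_mono[OF add_mono[OF i3 i4] par(8)])
    moreover have "(- 3 * p / 4 + c1 + 2 * K * \<delta>) * X = - (3 * p / 4 * X) + c1 * X + K * (\<delta> * X + \<delta> * X)"
      by (simp add: algebra_simps)
    ultimately show ?thesis using i1 i2 by linarith
  qed
  have B2: "(4 * s)\<^sup>2 / t + K * (\<delta>\<^sup>2 * w\<^sup>2 * \<epsilon>\<^sup>2 / t + \<delta> * w * (4 * s) * \<epsilon> / t) \<le> (4 * c1 + 3 * K * \<delta>) * X"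
  proof -
    have "K * (\<delta>\<^sup>2 * w\<^sup>2 * \<epsilon>\<^sup>2 / t + \<delta> * w * (4 * s) * \<epsilon> / t) \<le> K * (\<delta> * X + 2 * \<delta> * X)"
      by (rule mult_left_mono[OF add_mono[OF i3 i6] par(8)])
    moreover have "(4 * c1 + 3 * K * \<delta>) * X = 4 * c1 * X + K * (\<delta> * X + 2 * \<delta> * X)"
      by (simp add: algebra_simps)
    ultimately show ?thesis using i5 by linarith
  qed
  have B3: "\<theta> * (4 * \<epsilon>\<^sup>2 / t + K * (\<delta>\<^sup>2 * w\<^sup>2 * \<epsilon>\<^sup>2 / t + 2 * \<delta> * w * \<epsilon>\<^sup>2 / t)) \<le> c * (4 + 3 * K) * \<delta> * X"
  proof -
    have "\<delta>\<^sup>2 * w\<^sup>2 \<le> 1" "\<delta> * w \<le> 1" using par w1 by (auto simp: power_le_one mult_le_one)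
    then have "\<delta>\<^sup>2 * w\<^sup>2 + 2 * (\<delta> * w) \<le> 3" by linarith
    then have "K * (\<delta>\<^sup>2 * w\<^sup>2 + 2 * (\<delta> * w)) \<le> K * 3" using par by (intro mult_left_mono) auto
    then have "(4 + K * (\<delta>\<^sup>2 * w\<^sup>2 + 2 * (\<delta> * w))) * (\<epsilon>\<^sup>2 / t) \<le> (4 + 3 * K) * (\<epsilon>\<^sup>2 / t)"
      using par by (intro mult_right_mono) auto
    then have "4 * \<epsilon>\<^sup>2 / t + K * (\<delta>\<^sup>2 * w\<^sup>2 * \<epsilon>\<^sup>2 / t + 2 * \<delta> * w * \<epsilon>\<^sup>2 / t) \<le> (4 + 3 * K) * (\<epsilon>\<^sup>2 / t)"
      by (simp add: algebra_simps)
    then have "\<theta> * (4 * \<epsilon>\<^sup>2 / t + K * (\<delta>\<^sup>2 * w\<^sup>2 * \<epsilon>\<^sup>2 / t + 2 * \<delta> * w * \<epsilon>\<^sup>2 / t)) \<le> (c * w ^ 4) * ((4 + 3 * K) * (\<epsilon>\<^sup>2 / t))"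
      using \<theta> wt par by (intro mult_mono) auto
    also have "\<dots> = (c * (4 + 3 * K) * X) * w\<^sup>2" by (simp add: X_def power4_eq_xxxx power2_eq_square)
    also have "\<dots> \<le> (c * (4 + 3 * K) * X) * \<delta>"
    proof (rule mult_left_mono)
      have "w\<^sup>2 \<le> \<delta>\<^sup>2" using par by (intro power_mono) auto
      then show "w\<^sup>2 \<le> \<delta>" using \<delta>2 by linarith
      show "0 \<le> c * (4 + 3 * K) * X" using par X0 by simp
    qed
    finally show ?thesis by (simp add: mult_ac)
  qed
  have a1: "a \<le> 1" "b \<le> 1" using wt by linarith+
  have "a * (- 3 * p / 4 + c1 + 2 * K * \<delta>) + b * (4 * c1 + 3 * K * \<delta>) + c * (4 + 3 * K) * \<delta> \<le> - (m * p / 4)"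
  proof -
    have "m * p \<le> a * p" using wt par by (intro mult_right_mono) auto
    moreover have "a * (c1 + 2 * K * \<delta>) \<le> 1 * (c1 + 2 * K * \<delta>)" using a1 c1 par by (intro mult_right_mono) auto
    moreover have "b * (4 * c1 + 3 * K * \<delta>) \<le> 1 * (4 * c1 + 3 * K * \<delta>)" using a1 c1 par by (intro mult_right_mono) auto
    moreover have "K * \<delta> \<ge> 0" using par by simp
    ultimately show ?thesis using \<delta> c1(3) by (simp add: algebra_simps)
  qed
  then have fin: "(a * (- 3 * p / 4 + c1 + 2 * K * \<delta>) + b * (4 * c1 + 3 * K * \<delta>) + c * (4 + 3 * K) * \<delta>) * X \<le> - (m * p / 4) * X"
    using X0 by (rule mult_right_mono)
  have a0: "a \<ge> 0" using wt by linarith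
  have comb: "a * (2 * T1) + b * (2 * T2) + \<theta> * (2 * T3) \<le> 2 * ((a * r1 + b * r2 + r3) * X)"
    if "T1 \<le> r1 * X" "T2 \<le> r2 * X" "\<theta> * T3 \<le> r3 * X" for T1 T2 T3 r1 r2 r3
    using mult_left_mono[OF that(1) a0] mult_left_mono[OF that(2) wt(3)] that(3) by (simp add: algebra_simps)
  have "2 * (- (m * p / 4) * X) = - (m * p / 2) * X" by simp
  with comb[OF B1 B2 B3] fin show ?thesis unfolding X_def[symmetric] by linarith
qed

text \<open>
  The sum over the moves \<open>(\<nu>, \<nu>')\<close> and the straight pull.  The number \<open>j\<^sup>2\<close> measures how far \<open>dV\<^sup>2\<close> stays below
  its maximum \<open>4 * \<epsilon>\<^sup>2\<close>.  The first-order gain is at least \<open>j\<^sup>2 * \<epsilon> / 8\<close>; the transversal losses are of order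
  \<open>j\<^sup>2 * \<epsilon>\<^sup>2 / t\<close>, which is smaller since \<open>\<epsilon> / t\<close> is small, and the remaining terms are controlled
  by \<open>\<delta> * w \<le> \<delta> * c2 * j\<close>.
\<close>
lemma pulling_balance:
  fixes a b \<theta> m :: real
  assumes wt: "a \<ge> m" "m > 0" "b \<ge> 0" "\<theta> \<ge> 0" "a + b + \<theta> = 1"
    and par: "0 < \<delta>" "\<delta> \<le> 1" "0 \<le> w" "w \<le> \<delta>" "t > 0" "\<epsilon> > 0" "K \<ge> 0" "c \<ge> 0" "S \<ge> 0" "80 * \<epsilon> \<le> m * t"
    and \<theta>: "\<theta> \<le> c * w ^ 4"
    and geo: "0 \<le> s" "0 \<le> D" "D\<^sup>2 + 4 * s\<^sup>2 = 4 * \<epsilon>\<^sup>2" "dV\<^sup>2 = (4 - j\<^sup>2) * \<epsilon>\<^sup>2" "dV\<^sup>2 \<le> D\<^sup>2"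
    and j: "0 \<le> j" "w \<le> c2 * j" "c2 \<ge> 1"
    and l1: "l1 \<le> g * (dV - 2 * \<epsilon>) + 4 * S * \<delta> * w * s" "g \<ge> 1/2" and l3: "l3 \<le> 4 * S * \<delta> * w * \<epsilon>"
    and \<delta>: "\<delta> * c2\<^sup>2 * (2 * S + 7 * K + c * (4 * S + 8 + 6 * K)) \<le> m / 32"
  shows "a * (l1 + (D\<^sup>2 - dV\<^sup>2) / t + K * (\<delta>\<^sup>2 * w\<^sup>2 * \<epsilon>\<^sup>2 / t + \<delta> * w * D * s / t) + K * (\<delta>\<^sup>2 * w\<^sup>2 * \<epsilon>\<^sup>2 / t))
    + b * ((4 * s)\<^sup>2 / t + K * (\<delta>\<^sup>2 * w\<^sup>2 * \<epsilon>\<^sup>2 / t + \<delta> * w * (4 * s) * \<epsilon> / t) + K * (\<delta>\<^sup>2 * w\<^sup>2 * \<epsilon>\<^sup>2 / t))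
    + \<theta> * (l3 + 2 * (4 * \<epsilon>\<^sup>2 / t + K * (\<delta>\<^sup>2 * w\<^sup>2 * \<epsilon>\<^sup>2 / t + 2 * \<delta> * w * \<epsilon>\<^sup>2 / t)))
    \<le> - (m / 32) * (j\<^sup>2 * \<epsilon>)"
proof -
  define Y where "Y = j\<^sup>2 * \<epsilon>"
  define Z where "Z = \<delta> * c2\<^sup>2 * Y"
  have Y0: "Y \<ge> 0" using par by (simp add: Y_def)
  have Z0: "Z \<ge> 0" using par Y0 by (simp add: Z_def)
  have a1: "0 \<le> a" "a \<le> 1" "b \<le> 1" using wt by linarith+
  have m1: "m \<le> 1" using wt a1 by linarith
  have \<epsilon>t: "\<epsilon> / t \<le> m / 80" "\<epsilon> / t \<le> 1" "0 \<le> \<epsilon> / t"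
  proof -
    show "\<epsilon> / t \<le> m / 80" using par by (simp add: divide_le_eq field_simps)
    then show "\<epsilon> / t \<le> 1" using m1 by linarith
    show "0 \<le> \<epsilon> / t" using par by simp
  qed
  have \<delta>2: "\<delta>\<^sup>2 \<le> \<delta>" using par by (simp add: power2_eq_square mult_left_le_one_le)
  have c2: "c2 \<le> c2\<^sup>2" using j by (simp add: power2_eq_square)
  have w2: "w\<^sup>2 \<le> c2\<^sup>2 * j\<^sup>2" using power_mono[OF j(2), of 2] par by (simp add: power_mult_distrib)
  have wj: "w * j \<le> c2\<^sup>2 * j\<^sup>2"
  proof -
    have "w * j \<le> c2 * j * j" using j by (intro mult_right_mono) auto
    also have "\<dots> \<le> c2\<^sup>2 * j * j" using c2 j by (intro mult_right_mono) auto
    finally show ?thesis by (simp add: power2_eq_square mult_ac)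
  qed
  have j2: "j\<^sup>2 \<le> 4"
  proof (rule ccontr)
    assume "\<not> j\<^sup>2 \<le> 4"
    then have "(4 - j\<^sup>2) * \<epsilon>\<^sup>2 < 0" using par by (intro mult_neg_pos) auto
    then show False using geo(4) zero_le_power2[of dV] by linarith
  qed
  have dV: "dV - 2 * \<epsilon> \<le> - (j\<^sup>2 / 4) * \<epsilon>"
  proof -
    have "dV\<^sup>2 \<le> ((2 - j\<^sup>2 / 4) * \<epsilon>)\<^sup>2"
    proof -
      have "(2 - j\<^sup>2 / 4)\<^sup>2 = 4 - j\<^sup>2 + (j\<^sup>2)\<^sup>2 / 16" by (simp add: power2_eq_square algebra_simps)
      then have "4 - j\<^sup>2 \<le> (2 - j\<^sup>2 / 4)\<^sup>2" using zero_le_power2[of "j\<^sup>2"] by linarith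
      then show ?thesis unfolding geo(4) power_mult_distrib by (rule mult_right_mono) simp
    qed
    then have "dV \<le> (2 - j\<^sup>2 / 4) * \<epsilon>" by (rule power2_le_imp_le) (use j2 par in auto)
    then show ?thesis by (simp add: algebra_simps)
  qed
  have "(2 * s)\<^sup>2 \<le> (j * \<epsilon>)\<^sup>2" using geo by (simp add: power_mult_distrib algebra_simps)
  then have s: "2 * s \<le> j * \<epsilon>" by (rule power2_le_imp_le) (use j par in auto)
  have "D\<^sup>2 \<le> 4 * \<epsilon>\<^sup>2" using geo(3) zero_le_power2[of s] by linarith
  then have "D\<^sup>2 \<le> (2 * \<epsilon>)\<^sup>2" by (simp add: power_mult_distrib)
  then have D: "D \<le> 2 * \<epsilon>" by (rule power2_le_imp_le) (use par in auto)
  have i0: "l1 \<le> - Y / 8 + 2 * S * Z"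
  proof -
    have "g * (dV - 2 * \<epsilon>) \<le> g * (- (Y / 4))" using dV l1(2) unfolding Y_def by (intro mult_left_mono) auto
    moreover have "1/2 * (Y / 4) \<le> g * (Y / 4)" using l1(2) Y0 by (intro mult_right_mono) auto
    ultimately have "g * (dV - 2 * \<epsilon>) \<le> - Y / 8" by simp
    moreover have "4 * S * \<delta> * w * s \<le> 2 * S * Z"
    proof -
      have "4 * S * \<delta> * w * s = 2 * S * \<delta> * (w * (2 * s))" by simp
      also have "\<dots> \<le> 2 * S * \<delta> * (w * (j * \<epsilon>))" using s par by (intro mult_left_mono) auto
      also have "\<dots> = 2 * S * \<delta> * \<epsilon> * (w * j)" by simp
      also have "\<dots> \<le> 2 * S * \<delta> * \<epsilon> * (c2\<^sup>2 * j\<^sup>2)" using wj par by (intro mult_left_mono) auto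
      finally show ?thesis by (simp add: Z_def Y_def mult_ac)
    qed
    ultimately show ?thesis using l1(1) by linarith
  qed
  have small: "v / t \<le> Z" if "v \<le> \<epsilon> * Z" for v
  proof -
    have "v / t \<le> \<epsilon> * Z / t" using that par by (intro divide_right_mono) auto
    also have "\<dots> = (\<epsilon> / t) * Z" by simp
    also have "\<dots> \<le> 1 * Z" using \<epsilon>t Z0 by (intro mult_right_mono) auto
    finally show ?thesis by simp
  qed
  have i2: "(D\<^sup>2 - dV\<^sup>2) / t \<le> m / 80 * Y"
  proof -
    have "D\<^sup>2 - dV\<^sup>2 \<le> \<epsilon> * Y" 
    proof -
      have "D\<^sup>2 - dV\<^sup>2 \<le> j\<^sup>2 * \<epsilon>\<^sup>2" using geo(3,4) zero_le_power2[of s] unfolding left_diff_distrib by linarith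
      then show ?thesis by (simp add: Y_def power2_eq_square mult_ac)
    qed
    then have "(D\<^sup>2 - dV\<^sup>2) / t \<le> \<epsilon> * Y / t" using par by (intro divide_right_mono) auto
    also have "\<dots> = (\<epsilon> / t) * Y" by simp
    also have "\<dots> \<le> m / 80 * Y" using \<epsilon>t Y0 by (intro mult_right_mono) auto
    finally show ?thesis .
  qed
  have i5: "(4 * s)\<^sup>2 / t \<le> m / 20 * Y"
  proof -
    have "(4 * s)\<^sup>2 = 4 * (2 * s)\<^sup>2" by (simp add: power_mult_distrib)
    also have "\<dots> \<le> 4 * (j * \<epsilon>)\<^sup>2" using s geo by (intro mult_left_mono power_mono) auto
    also have "\<dots> = 4 * (\<epsilon> * Y)" by (simp add: Y_def power2_eq_square)
    finally have "(4 * s)\<^sup>2 / t \<le> 4 * (\<epsilon> * Y) / t" using par by (intro divide_right_mono) auto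
    also have "\<dots> = 4 * ((\<epsilon> / t) * Y)" by simp
    also have "\<dots> \<le> 4 * (m / 80 * Y)" using \<epsilon>t Y0 by (intro mult_left_mono mult_right_mono) auto
    finally show ?thesis by linarith
  qed
  have i3: "\<delta>\<^sup>2 * w\<^sup>2 * \<epsilon>\<^sup>2 / t \<le> Z"
  proof (rule small)
    have "\<delta>\<^sup>2 * w\<^sup>2 \<le> \<delta> * (c2\<^sup>2 * j\<^sup>2)" using \<delta>2 w2 par by (intro mult_mono) auto
    then have "\<delta>\<^sup>2 * w\<^sup>2 * \<epsilon>\<^sup>2 \<le> \<delta> * (c2\<^sup>2 * j\<^sup>2) * \<epsilon>\<^sup>2" by (rule mult_right_mono) simp
    then show "\<delta>\<^sup>2 * w\<^sup>2 * \<epsilon>\<^sup>2 \<le> \<epsilon> * Z" by (simp add: Z_def Y_def power2_eq_square mult_ac)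
  qed
  have sj: "\<delta> * w * j * \<epsilon> * \<epsilon> \<le> \<epsilon> * Z"
  proof -
    have "(\<delta> * \<epsilon> * \<epsilon>) * (w * j) \<le> (\<delta> * \<epsilon> * \<epsilon>) * (c2\<^sup>2 * j\<^sup>2)" using wj par by (intro mult_left_mono) auto
    then show ?thesis by (simp add: Z_def Y_def mult_ac)
  qed
  have i4: "\<delta> * w * D * s / t \<le> Z"
  proof (rule small)
    have "D * (2 * s) \<le> (2 * \<epsilon>) * (j * \<epsilon>)" using geo par by (intro mult_mono[OF D s]) auto
    then have "(\<delta> * w) * (D * (2 * s)) \<le> (\<delta> * w) * ((2 * \<epsilon>) * (j * \<epsilon>))" using par by (intro mult_left_mono) auto
    then show "\<delta> * w * D * s \<le> \<epsilon> * Z" using sj by (simp add: mult_ac)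
  qed
  have i6: "\<delta> * w * (4 * s) * \<epsilon> / t \<le> 2 * Z"
  proof -
    have "(\<delta> * w * \<epsilon>) * (2 * s) \<le> (\<delta> * w * \<epsilon>) * (j * \<epsilon>)" using s par by (intro mult_left_mono) auto
    then have "\<delta> * w * (2 * s) * \<epsilon> \<le> \<epsilon> * Z" using sj by (simp add: mult_ac)
    from small[OF this] have "2 * (\<delta> * w * (2 * s) * \<epsilon> / t) \<le> 2 * Z" by simp
    moreover have "\<delta> * w * (4 * s) * \<epsilon> / t = 2 * (\<delta> * w * (2 * s) * \<epsilon> / t)" by simp
    ultimately show ?thesis by (simp only:)
  qed
  have B1: "l1 + (D\<^sup>2 - dV\<^sup>2) / t + K * (\<delta>\<^sup>2 * w\<^sup>2 * \<epsilon>\<^sup>2 / t + \<delta> * w * D * s / t) + K * (\<delta>\<^sup>2 * w\<^sup>2 * \<epsilon>\<^sup>2 / t)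
      \<le> - Y / 8 + m / 80 * Y + (2 * S + 3 * K) * Z"
  proof -
    have "K * (\<delta>\<^sup>2 * w\<^sup>2 * \<epsilon>\<^sup>2 / t + \<delta> * w * D * s / t) \<le> K * (Z + Z)" "K * (\<delta>\<^sup>2 * w\<^sup>2 * \<epsilon>\<^sup>2 / t) \<le> K * Z"
      by (rule mult_left_mono[OF add_mono[OF i3 i4] par(7)], rule mult_left_mono[OF i3 par(7)])
    moreover have "(2 * S + 3 * K) * Z = 2 * S * Z + K * (Z + Z) + K * Z"
      by (simp add: algebra_simps)
    ultimately show ?thesis using i0 i2 by linarith
  qed
  have B2: "(4 * s)\<^sup>2 / t + K * (\<delta>\<^sup>2 * w\<^sup>2 * \<epsilon>\<^sup>2 / t + \<delta> * w * (4 * s) * \<epsilon> / t) + K * (\<delta>\<^sup>2 * w\<^sup>2 * \<epsilon>\<^sup>2 / t) \<le> m / 20 * Y + 4 * K * Z"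
  proof -
    have "K * (\<delta>\<^sup>2 * w\<^sup>2 * \<epsilon>\<^sup>2 / t + \<delta> * w * (4 * s) * \<epsilon> / t) \<le> K * (Z + 2 * Z)" "K * (\<delta>\<^sup>2 * w\<^sup>2 * \<epsilon>\<^sup>2 / t) \<le> K * Z"
      by (rule mult_left_mono[OF add_mono[OF i3 i6] par(7)], rule mult_left_mono[OF i3 par(7)])
    moreover have "4 * K * Z = K * (Z + 2 * Z) + K * Z"
      by (simp add: algebra_simps)
    ultimately show ?thesis using i5 by linarith
  qed
  have B3: "\<theta> * (l3 + 2 * (4 * \<epsilon>\<^sup>2 / t + K * (\<delta>\<^sup>2 * w\<^sup>2 * \<epsilon>\<^sup>2 / t + 2 * \<delta> * w * \<epsilon>\<^sup>2 / t))) \<le> c * (4 * S + 8 + 6 * K) * Z"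
  proof -
    have add2: "l3 + 2 * E \<le> r" if "E \<le> e" "l3 \<le> e'" "r = e' + 2 * e" for E e e' r
      using that by linarith
    have lw: "\<delta>\<^sup>2 * w\<^sup>2 \<le> 1" "\<delta> * w \<le> 1" "0 \<le> \<delta> * w" using par by (auto simp: power_le_one mult_le_one)
    then have "\<delta>\<^sup>2 * w\<^sup>2 + 2 * (\<delta> * w) \<le> 3" by linarith
    then have "K * (\<delta>\<^sup>2 * w\<^sup>2 + 2 * (\<delta> * w)) \<le> K * 3" using par by (intro mult_left_mono) auto
    then have "(4 + K * (\<delta>\<^sup>2 * w\<^sup>2 + 2 * (\<delta> * w))) * (\<epsilon> * (\<epsilon> / t)) \<le> (4 + 3 * K) * (\<epsilon> * 1)"
      using par \<epsilon>t by (intro mult_mono) auto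
    then have "4 * \<epsilon>\<^sup>2 / t + K * (\<delta>\<^sup>2 * w\<^sup>2 * \<epsilon>\<^sup>2 / t + 2 * \<delta> * w * \<epsilon>\<^sup>2 / t) \<le> (4 + 3 * K) * \<epsilon>"
      by (simp add: algebra_simps power2_eq_square)
    moreover have "l3 \<le> 4 * S * \<epsilon>"
    proof -
      have "(4 * S * \<epsilon>) * (\<delta> * w) \<le> (4 * S * \<epsilon>) * 1" using lw par by (intro mult_left_mono) auto
      then show ?thesis using l3 by (simp add: mult_ac)
    qed
    moreover have "(4 * S + 8 + 6 * K) * \<epsilon> = 4 * S * \<epsilon> + 2 * ((4 + 3 * K) * \<epsilon>)"
      by (simp add: algebra_simps)
    ultimately have "l3 + 2 * (4 * \<epsilon>\<^sup>2 / t + K * (\<delta>\<^sup>2 * w\<^sup>2 * \<epsilon>\<^sup>2 / t + 2 * \<delta> * w * \<epsilon>\<^sup>2 / t)) \<le> (4 * S + 8 + 6 * K) * \<epsilon>"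
      by (intro add2)
    then have "\<theta> * (l3 + 2 * (4 * \<epsilon>\<^sup>2 / t + K * (\<delta>\<^sup>2 * w\<^sup>2 * \<epsilon>\<^sup>2 / t + 2 * \<delta> * w * \<epsilon>\<^sup>2 / t))) \<le> \<theta> * ((4 * S + 8 + 6 * K) * \<epsilon>)"
      using wt by (intro mult_left_mono) auto
    also have "\<dots> \<le> (c * w ^ 4) * ((4 * S + 8 + 6 * K) * \<epsilon>)" using \<theta> par by (intro mult_right_mono) auto
    also have "\<dots> = c * (4 * S + 8 + 6 * K) * (w\<^sup>2 * w\<^sup>2 * \<epsilon>)" by (simp add: power4_eq_xxxx power2_eq_square)
    also have "\<dots> \<le> c * (4 * S + 8 + 6 * K) * (\<delta> * (c2\<^sup>2 * j\<^sup>2) * \<epsilon>)"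
    proof -
      have "w\<^sup>2 \<le> \<delta>\<^sup>2" using par by (intro power_mono) auto
      then have "w\<^sup>2 \<le> \<delta>" using \<delta>2 by linarith
      then have "w\<^sup>2 * w\<^sup>2 * \<epsilon> \<le> \<delta> * (c2\<^sup>2 * j\<^sup>2) * \<epsilon>" using w2 par by (intro mult_mono mult_right_mono) auto
      then show ?thesis using par by (intro mult_left_mono) auto
    qed
    finally show ?thesis by (simp add: Z_def Y_def mult_ac)
  qed
  have Z: "(2 * S + 7 * K + c * (4 * S + 8 + 6 * K)) * Z \<le> m / 32 * Y"
    using mult_right_mono[OF \<delta> Y0] by (simp add: Z_def mult_ac)
  have e1: "a * (- Y / 8 + m / 80 * Y + (2 * S + 3 * K) * Z) \<le> - m * Y / 8 + m / 80 * Y + (2 * S + 3 * K) * Z"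
  proof -
    have "m * Y \<le> a * Y" using wt Y0 by (intro mult_right_mono) auto
    moreover have "a * (m / 80 * Y + (2 * S + 3 * K) * Z) \<le> 1 * (m / 80 * Y + (2 * S + 3 * K) * Z)"
      using a1 wt Y0 Z0 par by (intro mult_right_mono) auto
    ultimately show ?thesis by (simp add: algebra_simps)
  qed
  have e2: "b * (m / 20 * Y + 4 * K * Z) \<le> 1 * (m / 20 * Y + 4 * K * Z)"
    using a1 wt Y0 Z0 par by (intro mult_right_mono) auto
  have "(2 * S + 7 * K + c * (4 * S + 8 + 6 * K)) * Z = (2 * S + 3 * K) * Z + 4 * K * Z + c * (4 * S + 8 + 6 * K) * Z"
    by (simp add: algebra_simps)
  then have "(2 * S + 3 * K) * Z + 4 * K * Z + c * (4 * S + 8 + 6 * K) * Z \<le> m * Y / 32"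
    using Z by simp
  moreover have "A + B + C \<le> - (m / 32) * Y"
    if "A \<le> a * a'" "B \<le> b * b'" "C \<le> z3" "a * a' \<le> - m * Y / 8 + m / 80 * Y + z1" "b * b' \<le> 1 * (m / 20 * Y + z2)" "z1 + z2 + z3 \<le> m * Y / 32"
    for A B C a' b' z1 z2 z3
  proof -
    define U where "U = m * Y"
    have U: "- m * Y / 8 = - (U / 8)" "m / 80 * Y = U / 80" "1 * (m / 20 * Y + z2) = U / 20 + z2" "m * Y / 32 = U / 32"
      "- (m / 32) * Y = - (U / 32)" by (simp_all add: U_def)
    from that show ?thesis unfolding U by linarith
  qed
  ultimately show ?thesis
    using mult_left_mono[OF B1 a1(1)] mult_left_mono[OF B2 wt(3)] B3 e1 e2
    unfolding Y_def[symmetric] by blast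
qed

section \<open>Distant pairs of points\<close>

text \<open>
  Bounds \<open>e1\<close>, \<open>e2\<close>, \<open>e3\<close> for the three branches of the coupled turn: both points make the chosen moves, both move at
  random with reflected noise, or only the second point moves at random.  Random moves are
  symmetrised, which is all that an average over a disc can see.
\<close>
definition coupled_le ::
  "('a::euclidean_space \<Rightarrow> 'a \<Rightarrow> real) \<Rightarrow> real \<Rightarrow> 'a \<Rightarrow> 'a \<Rightarrow> 'a \<Rightarrow> 'a \<Rightarrow> real \<Rightarrow> real \<Rightarrow> real \<Rightarrow> bool" where
  "coupled_le f \<epsilon> x z \<nu> \<nu>' e1 e2 e3 \<longleftrightarrow>
     f (x + \<nu>) (z + \<nu>') \<le> e1 \<and>
     (\<forall>h. \<nu> \<bullet> h = 0 \<and> norm h < \<epsilon> \<longrightarrow>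
        f (x + h) (z + reflect (\<nu> - \<nu>') h) + f (x - h) (z - reflect (\<nu> - \<nu>') h) \<le> 2 * e2) \<and>
     (\<forall>h. \<nu>' \<bullet> h = 0 \<and> norm h < \<epsilon> \<longrightarrow> f (x + \<nu>) (z + h) + f (x + \<nu>) (z - h) \<le> 2 * e3)"

text \<open>
  The weights \<open>a\<close>, \<open>b\<close>, \<open>\<theta>\<close> are those of the three branches of the coupled turn.  The bound concerns the sum over a pair
  of moves and its answer, because the dynamic programming principle averages a supremum and an infimum:
  one chooses the worst moves for the supremum and may choose the best answer for the infimum.
\<close>
definition answered ::
  "('a::euclidean_space \<Rightarrow> 'a \<Rightarrow> real) \<Rightarrow> real \<Rightarrow> 'a \<Rightarrow> 'a \<Rightarrow> real \<Rightarrow> real \<Rightarrow> real \<Rightarrow> 'a \<Rightarrow> 'a \<Rightarrow> real \<Rightarrow> bool" where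
  "answered f \<epsilon> x z a b \<theta> \<nu> \<nu>' R \<longleftrightarrow> (\<exists>\<mu> \<mu>' e1 e2 e3 e1' e2' e3'. norm \<mu> = \<epsilon> \<and> norm \<mu>' = \<epsilon> \<and>
     coupled_le f \<epsilon> x z \<nu> \<nu>' e1 e2 e3 \<and> coupled_le f \<epsilon> x z \<mu> \<mu>' e1' e2' e3' \<and>
     a * (e1 + e1') + b * (e2 + e2') + \<theta> * (e3 + e3') \<le> R)"

lemma answered_mono: "answered f \<epsilon> x z a b \<theta> \<nu> \<nu>' R \<Longrightarrow> R \<le> R' \<Longrightarrow> answered f \<epsilon> x z a b \<theta> \<nu> \<nu>' R'"
  unfolding answered_def by (elim ex_forward) auto

text \<open>
  Pairs farther apart than \<open>2 * N * \<epsilon>\<close>, close enough compared with the distance of their midpoint to the boundary.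
  The assumption \<open>t / q \<le> \<delta> * w\<close> expresses the latter; \<open>w\<close> is the square root of \<open>t powr p\<close>.
\<close>
locale distant_pair =
  fixes x z y0 :: "'a::euclidean_space" and p L \<epsilon> \<rho> \<delta> S K :: real and N :: nat
    and t q w \<Psi> :: real and y V :: 'a
  assumes p: "0 < p" "p \<le> 1/2" and L: "L \<ge> 0" and \<epsilon>: "\<epsilon> > 0"
    and t: "t = norm (x - z)" "2 * real N * \<epsilon> < t" "4 * \<epsilon> \<le> t" "(t + 2 * \<epsilon>) powr p \<le> 1/4"
    and y: "y = mid x z - y0" and q: "q = \<rho>\<^sup>2 - (norm y)\<^sup>2" "6 * \<epsilon> \<le> q" and \<rho>: "0 < \<rho>" "\<rho> \<le> 1"
    and V: "V = (x - z) /\<^sub>R t"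
    and \<Psi>: "\<Psi> = pair_mod p L N \<epsilon> t" "\<Psi> \<le> S * t"
    and w: "w = t powr (p / 2)" "w \<le> \<delta>" "t / q \<le> \<delta> * w" and \<delta>: "\<delta> \<le> 1"
    and K: "K = 74 * (S + 1)"
begin

definition slope :: real where "slope = 1 - (1 + p) * t powr p"

text \<open>
  The first-order part of the change of the barrier, in units of the weight.  It is odd in the pair of
  moves, hence cancels between a move and its opposite.
\<close>
definition drift :: "'a \<Rightarrow> 'a \<Rightarrow> real" where
  "drift a b = slope * ((a - b) \<bullet> V) + 4 * \<Psi> / q * (y \<bullet> mid a b)"

text \<open>
  A common bound for the second-order errors of the weight, for moves with \<open>norm (a - b) \<le> d\<close> and
  midpoint of norm at most \<open>s\<close>.
\<close>
definition error :: "real \<Rightarrow> real \<Rightarrow> real" where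
  "error d s = K * (\<delta>\<^sup>2 * w\<^sup>2 * \<epsilon>\<^sup>2 / t + \<delta> * w * d * s / t)"

lemma t_pos: "t > 0" using t(3) \<epsilon> by linarith
lemma q_pos: "q > 0" using q(2) \<epsilon> by linarith
lemma w_pos: "w > 0" using t_pos by (simp add: w(1))
lemma \<delta>_pos: "\<delta> > 0" using w_pos w(2) by linarith
lemma w_sq: "w\<^sup>2 = t powr p"
  using t_pos by (simp add: w(1) power2_eq_square powr_add[symmetric])
lemma t_powr: "t powr p \<le> 1/4"
  using powr_mono2[of p t "t + 2 * \<epsilon>"] t(4) p \<epsilon> t_pos by linarith
lemma \<Psi>_nonneg: "\<Psi> \<ge> 0"
  unfolding \<Psi>(1) by (rule pair_mod_nonneg[OF L \<epsilon>]) (use t_pos t_powr in auto)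
lemma S_nonneg: "S \<ge> 0"
proof -
  have "0 \<le> S * t" using \<Psi>_nonneg \<Psi>(2) by linarith
  then show ?thesis using t_pos by (simp add: zero_le_mult_iff)
qed
lemma K_nonneg: "K \<ge> 0" using S_nonneg by (simp add: K)
lemma slope_ge_half: "slope \<ge> 1/2"
proof -
  have "(1 + p) * t powr p \<le> 2 * (1/4)" using p t_powr by (intro mult_mono) auto
  then show ?thesis by (simp add: slope_def)
qed
lemma norm_V: "norm V = 1" using t_pos t(1) by (simp add: V)

lemma drift_minus: "drift (- a) (- b) = - drift a b"
proof -
  have "- a - - b = - (a - b)" "mid (- a) (- b) = - mid a b" by (simp_all add: mid_minus)
  then show ?thesis unfolding drift_def by (simp only: inner_minus_left inner_minus_right mult_minus_right minus_add_distrib)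
qed

lemma drift_split: "drift a b + drift a (- b) = 2 * drift a 0"
  by (simp add: drift_def mid_def inner_diff_left inner_add_left inner_add_right algebra_simps)

lemma inverse_q: "1 / q \<le> \<delta> * w / t"
  using w(3) t_pos by (simp add: field_simps)

text \<open>
  The errors of the weight in \<open>barrier_expansion\<close>, rewritten with \<open>1 / q \<le> \<delta> * w / t\<close>, so that all
  second-order terms are comparable with \<open>\<epsilon>\<^sup>2 / t\<close>.
\<close>
lemma barrier_le:
  assumes a: "norm a \<le> \<epsilon>" and b: "norm b \<le> \<epsilon>"
  shows "barrier p L N \<epsilon> \<rho> y0 (x + a) (z + b) \<le> weight \<rho> y *
    (\<Psi> + drift a b - p / 4 * (w\<^sup>2 / t) * ((a - b) \<bullet> V)\<^sup>2
     + ((norm (a - b))\<^sup>2 - ((a - b) \<bullet> V)\<^sup>2) / t + error (norm (a - b)) (norm (mid a b)))"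
proof -
  let ?d = "norm (a - b)" and ?s = "norm (mid a b)"
  have s: "?s \<le> \<epsilon>" unfolding mid_def using norm_triangle_ineq[of a b] a b by simp
  have "4 / q * ?d * ?s \<le> K * (\<delta> * w * ?d * ?s / t)"
  proof -
    have "4 / q * ?d * ?s = 4 * ((1 / q) * (?d * ?s))" by simp
    also have "\<dots> \<le> 4 * ((\<delta> * w / t) * (?d * ?s))"
      by (intro mult_left_mono mult_right_mono inverse_q) auto
    also have "\<dots> \<le> K * ((\<delta> * w / t) * (?d * ?s))"
      using S_nonneg \<delta>_pos w_pos t_pos by (intro mult_right_mono) (auto simp: K)
    finally show ?thesis by (simp add: mult_ac)
  qed
  moreover have "74 * (\<Psi> + 2 * \<epsilon>) * ?s\<^sup>2 / q\<^sup>2 \<le> K * (\<delta>\<^sup>2 * w\<^sup>2 * \<epsilon>\<^sup>2 / t)"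
  proof -
    have "\<Psi> + 2 * \<epsilon> \<le> (S + 1) * t" using \<Psi>(2) t(3) \<epsilon> by (simp add: algebra_simps)
    then have "74 * (\<Psi> + 2 * \<epsilon>) \<le> K * t" 
      unfolding K mult.assoc by (rule mult_left_mono) simp
    then have "74 * (\<Psi> + 2 * \<epsilon>) * (?s\<^sup>2 * (1 / q)\<^sup>2) \<le> K * t * (\<epsilon>\<^sup>2 * (\<delta> * w / t)\<^sup>2)"
    proof (rule mult_mono)
      show "?s\<^sup>2 * (1 / q)\<^sup>2 \<le> \<epsilon>\<^sup>2 * (\<delta> * w / t)\<^sup>2"
        using s inverse_q q_pos \<epsilon> by (intro mult_mono power_mono) auto
    qed (use K_nonneg t_pos in auto)
    also have "\<dots> = K * (\<delta>\<^sup>2 * w\<^sup>2 * \<epsilon>\<^sup>2 / t)"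
      using t_pos by (simp add: power2_eq_square field_simps)
    finally show ?thesis by (simp add: power_divide)
  qed
  ultimately have "4 / q * ?d * ?s + 74 * (\<Psi> + 2 * \<epsilon>) * ?s\<^sup>2 / q\<^sup>2 \<le> error ?d ?s"
    unfolding error_def distrib_left by linarith
  then have "(\<Psi> + (1 - (1 + p) * t powr p) * ((a - b) \<bullet> V) + 4 * \<Psi> / q * (y \<bullet> mid a b)
     - p / 4 * (t powr p / t) * ((a - b) \<bullet> V)\<^sup>2 + (?d\<^sup>2 - ((a - b) \<bullet> V)\<^sup>2) / t
     + 4 / q * ?d * ?s + 74 * (\<Psi> + 2 * \<epsilon>) * ?s\<^sup>2 / q\<^sup>2)
     \<le> (\<Psi> + drift a b - p / 4 * (w\<^sup>2 / t) * ((a - b) \<bullet> V)\<^sup>2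
     + (?d\<^sup>2 - ((a - b) \<bullet> V)\<^sup>2) / t + error ?d ?s)"
    unfolding drift_def slope_def w_sq by linarith
  from mult_left_mono[OF this, of "weight \<rho> y"] show ?thesis
    using barrier_expansion[OF p L \<epsilon> t y q \<rho> V a b \<Psi>(1) refl] weight_nonneg[of \<rho> y] by linarith
qed

lemma error_mono: "0 \<le> d \<Longrightarrow> d \<le> d' \<Longrightarrow> 0 \<le> s \<Longrightarrow> s \<le> s' \<Longrightarrow> error d s \<le> error d' s'"
  unfolding error_def using K_nonneg \<delta>_pos w_pos t_pos
  by (intro mult_left_mono add_left_mono divide_right_mono mult_mono) auto

lemma barrier_le_crude:
  assumes a: "norm a \<le> \<epsilon>" and b: "norm b \<le> \<epsilon>" and d: "norm (a - b) \<le> d"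
  shows "barrier p L N \<epsilon> \<rho> y0 (x + a) (z + b) \<le> weight \<rho> y * (\<Psi> + drift a b + d\<^sup>2 / t + error d \<epsilon>)"
proof -
  have s: "norm (mid a b) \<le> \<epsilon>" unfolding mid_def using norm_triangle_ineq[of a b] a b by simp
  have "p / 4 * (w\<^sup>2 / t) * ((a - b) \<bullet> V)\<^sup>2 \<ge> 0" using p t_pos by simp
  moreover have "((norm (a - b))\<^sup>2 - ((a - b) \<bullet> V)\<^sup>2) / t \<le> d\<^sup>2 / t"
  proof (rule divide_right_mono)
    have "(norm (a - b))\<^sup>2 \<le> d\<^sup>2" using d by (intro power_mono) auto
    then show "(norm (a - b))\<^sup>2 - ((a - b) \<bullet> V)\<^sup>2 \<le> d\<^sup>2" using zero_le_power2[of "(a - b) \<bullet> V"] by linarith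
  qed (use t_pos in simp)
  moreover have "error (norm (a - b)) (norm (mid a b)) \<le> error d \<epsilon>"
    by (rule error_mono) (use d s in auto)
  ultimately have "\<Psi> + drift a b - p / 4 * (w\<^sup>2 / t) * ((a - b) \<bullet> V)\<^sup>2
     + ((norm (a - b))\<^sup>2 - ((a - b) \<bullet> V)\<^sup>2) / t + error (norm (a - b)) (norm (mid a b))
     \<le> \<Psi> + drift a b + d\<^sup>2 / t + error d \<epsilon>" by linarith
  from mult_left_mono[OF this, of "weight \<rho> y"] show ?thesis
    using barrier_le[OF a b] weight_nonneg[of \<rho> y] by linarith
qed

lemma barrier_coupled:
  assumes \<nu>: "norm \<nu> = \<epsilon>" "norm \<nu>' = \<epsilon>"
    and s: "s = norm (mid \<nu> \<nu>')" and D: "D = norm (\<nu> - \<nu>')"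
  shows "coupled_le (barrier p L N \<epsilon> \<rho> y0) \<epsilon> x z \<nu> \<nu>'
     (weight \<rho> y * (\<Psi> + (drift \<nu> \<nu>' + (- (p / 4 * (w\<^sup>2 / t) * ((\<nu> - \<nu>') \<bullet> V)\<^sup>2) + (D\<^sup>2 - ((\<nu> - \<nu>') \<bullet> V)\<^sup>2) / t + error D s))))
     (weight \<rho> y * (\<Psi> + ((4 * s)\<^sup>2 / t + error (4 * s) \<epsilon>)))
     (weight \<rho> y * (\<Psi> + (drift \<nu> 0 + (4 * \<epsilon>\<^sup>2 / t + error (2 * \<epsilon>) \<epsilon>))))"
  unfolding coupled_le_def
proof (intro conjI allI impI)
  show "barrier p L N \<epsilon> \<rho> y0 (x + \<nu>) (z + \<nu>') \<le> weight \<rho> y * (\<Psi> + (drift \<nu> \<nu>' + (- (p / 4 * (w\<^sup>2 / t) * ((\<nu> - \<nu>') \<bullet> V)\<^sup>2) + (D\<^sup>2 - ((\<nu> - \<nu>') \<bullet> V)\<^sup>2) / t + error D s)))"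
    using barrier_le[of \<nu> \<nu>'] \<nu> by (simp add: s D algebra_simps)
next
  fix h assume h: "\<nu> \<bullet> h = 0 \<and> norm h < \<epsilon>"
  let ?k = "reflect (\<nu> - \<nu>') h"
  have k: "norm h \<le> \<epsilon>" "norm ?k \<le> \<epsilon>" "norm (h - ?k) \<le> 4 * s"
    using h reflect_near_identity[OF \<nu>, of h] by (auto simp: norm_reflect s)
  have "barrier p L N \<epsilon> \<rho> y0 (x + h) (z + ?k) \<le> weight \<rho> y * (\<Psi> + drift h ?k + (4 * s)\<^sup>2 / t + error (4 * s) \<epsilon>)"
    by (rule barrier_le_crude[OF k])
  moreover have "barrier p L N \<epsilon> \<rho> y0 (x + - h) (z + - ?k) \<le> weight \<rho> y * (\<Psi> + drift (- h) (- ?k) + (4 * s)\<^sup>2 / t + error (4 * s) \<epsilon>)"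
    by (rule barrier_le_crude) (use k in \<open>auto simp: norm_minus_commute\<close>)
  moreover have "weight \<rho> y * (\<Psi> + drift h ?k + r + r') + weight \<rho> y * (\<Psi> + - drift h ?k + r + r') = 2 * (weight \<rho> y * (\<Psi> + (r + r')))" for r r'
    by (simp add: algebra_simps)
  ultimately show "barrier p L N \<epsilon> \<rho> y0 (x + h) (z + ?k) + barrier p L N \<epsilon> \<rho> y0 (x - h) (z - ?k)
      \<le> 2 * (weight \<rho> y * (\<Psi> + ((4 * s)\<^sup>2 / t + error (4 * s) \<epsilon>)))"
    unfolding drift_minus by (smt (verit) diff_conv_add_uminus)
next
  fix h assume h: "\<nu>' \<bullet> h = 0 \<and> norm h < \<epsilon>"
  have k: "norm (\<nu> - h) \<le> 2 * \<epsilon>" "norm (\<nu> - - h) \<le> 2 * \<epsilon>"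
    using norm_triangle_ineq4[of \<nu> h] norm_triangle_ineq[of \<nu> h] \<nu> h by auto
  have "barrier p L N \<epsilon> \<rho> y0 (x + \<nu>) (z + h) \<le> weight \<rho> y * (\<Psi> + drift \<nu> h + (2 * \<epsilon>)\<^sup>2 / t + error (2 * \<epsilon>) \<epsilon>)"
    by (rule barrier_le_crude) (use k \<nu> h in auto)
  moreover have "barrier p L N \<epsilon> \<rho> y0 (x + \<nu>) (z + - h) \<le> weight \<rho> y * (\<Psi> + drift \<nu> (- h) + (2 * \<epsilon>)\<^sup>2 / t + error (2 * \<epsilon>) \<epsilon>)"
    by (rule barrier_le_crude) (use k \<nu> h in auto)
  moreover have "weight \<rho> y * (\<Psi> + drift \<nu> h + (2 * \<epsilon>)\<^sup>2 / t + r) + weight \<rho> y * (\<Psi> + drift \<nu> (- h) + (2 * \<epsilon>)\<^sup>2 / t + r)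
      = 2 * (weight \<rho> y * (\<Psi> + (drift \<nu> 0 + (4 * \<epsilon>\<^sup>2 / t + r))))" for r
  proof -
    have "drift \<nu> (- h) = 2 * drift \<nu> 0 - drift \<nu> h" using drift_split[of \<nu> h] by linarith
    then show ?thesis by (simp only:) (simp add: power_mult_distrib algebra_simps)
  qed
  ultimately show "barrier p L N \<epsilon> \<rho> y0 (x + \<nu>) (z + h) + barrier p L N \<epsilon> \<rho> y0 (x + \<nu>) (z - h)
      \<le> 2 * (weight \<rho> y * (\<Psi> + (drift \<nu> 0 + (4 * \<epsilon>\<^sup>2 / t + error (2 * \<epsilon>) \<epsilon>))))"
    by (smt (verit) diff_conv_add_uminus)
qed

lemma drift_le: "drift a b \<le> slope * ((a - b) \<bullet> V) + 4 * S * \<delta> * w * norm (mid a b)"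
proof -
  have "y \<bullet> mid a b \<le> norm (mid a b)" using weight_region(2)[OF q(1) q_pos \<rho>] by (rule abs_le_D1)
  then have "4 * \<Psi> / q * (y \<bullet> mid a b) \<le> 4 * \<Psi> / q * norm (mid a b)"
    using \<Psi>_nonneg q_pos by (intro mult_left_mono) auto
  also have "4 * \<Psi> / q * norm (mid a b) \<le> 4 * S * \<delta> * w * norm (mid a b)"
  proof (rule mult_right_mono)
    have "4 * \<Psi> / q \<le> 4 * (S * t) / q" using \<Psi>(2) q_pos by (intro divide_right_mono) auto
    also have "\<dots> = 4 * S * (t / q)" by simp
    also have "\<dots> \<le> 4 * S * (\<delta> * w)" using w(3) S_nonneg by (intro mult_left_mono) auto
    finally show "4 * \<Psi> / q \<le> 4 * S * \<delta> * w" by simp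
  qed simp
  finally show ?thesis by (simp add: drift_def)
qed

text \<open>
  Antipodal answer if the moves are nearly opposite and nearly parallel to \<open>x - z\<close>, straight pull otherwise.
  The threshold \<open>c1 * w\<^sup>2\<close> is proportional to the concavity gain, so that the loss of nearly
  parallel moves is affordable in the first case, while the second case still has a first-order gain of
  order \<open>w\<^sup>2 * \<epsilon>\<close>.
\<close>
lemma distant_answered:
  fixes a b \<theta> m c c1 c2 :: real
  assumes wt: "a \<ge> m" "m > 0" "b \<ge> 0" "\<theta> \<ge> 0" "a + b + \<theta> = 1"
    and c: "c \<ge> 0" "80 * \<epsilon> \<le> m * t" "\<theta> \<le> c * w ^ 4"
    and c1: "0 \<le> c1" "c1 \<le> 1" "20 * c1 \<le> m * p" and c2: "1 \<le> c2" "1 \<le> c2\<^sup>2 * c1"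
    and \<delta>1: "\<delta> * (6 * K + c * (4 + 3 * K)) \<le> m * p / 4"
    and \<delta>2: "\<delta> * c2\<^sup>2 * (2 * S + 7 * K + c * (4 * S + 8 + 6 * K)) \<le> m / 32"
    and \<nu>: "norm \<nu> = \<epsilon>" "norm \<nu>' = \<epsilon>" and t1: "t \<le> 1"
    and \<eta>: "\<eta> \<le> m * p / 2" "\<eta> \<le> m / (32 * c2\<^sup>2)"
  shows "answered (barrier p L N \<epsilon> \<rho> y0) \<epsilon> x z a b \<theta> \<nu> \<nu>' (weight \<rho> y * (2 * \<Psi> - \<eta> * \<epsilon>\<^sup>2))"
proof -
  define s where "s = norm (mid \<nu> \<nu>')"
  define D where "D = norm (\<nu> - \<nu>')"
  define dV where "dV = (\<nu> - \<nu>') \<bullet> V"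
  have s0: "0 \<le> s" and D0: "0 \<le> D" by (simp_all add: s_def D_def)
  have par: "D\<^sup>2 + 4 * s\<^sup>2 = 4 * \<epsilon>\<^sup>2" using norm_diff_mid[OF \<nu>] by (simp add: D_def s_def)
  have "\<bar>dV\<bar> \<le> D" using Cauchy_Schwarz_ineq2[of "\<nu> - \<nu>'" V] norm_V by (simp add: dV_def D_def)
  then have dVD: "dV\<^sup>2 \<le> D\<^sup>2" using D0 power_mono[of "\<bar>dV\<bar>" D 2] by simp
  define Q where "Q = weight \<rho> y"
  have Q0: "Q \<ge> 0" by (simp add: Q_def weight_def)
  define E1 where "E1 = - (p / 4 * (w\<^sup>2 / t) * dV\<^sup>2) + (D\<^sup>2 - dV\<^sup>2) / t + error D s"
  define E2 where "E2 = (4 * s)\<^sup>2 / t + error (4 * s) \<epsilon>"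
  define E3 where "E3 = 4 * \<epsilon>\<^sup>2 / t + error (2 * \<epsilon>) \<epsilon>"
  have cpl: "coupled_le (barrier p L N \<epsilon> \<rho> y0) \<epsilon> x z \<nu> \<nu>' (Q * (\<Psi> + (drift \<nu> \<nu>' + E1))) (Q * (\<Psi> + E2)) (Q * (\<Psi> + (drift \<nu> 0 + E3)))"
    using barrier_coupled[OF \<nu> s_def D_def] unfolding Q_def E1_def E2_def E3_def dV_def .
  have combine: "a * (Q * (\<Psi> + f1) + Q * (\<Psi> + f1')) + b * (Q * (\<Psi> + f2) + Q * (\<Psi> + f2')) + \<theta> * (Q * (\<Psi> + f3) + Q * (\<Psi> + f3'))
      \<le> Q * (2 * \<Psi> - \<eta> * \<epsilon>\<^sup>2)"
    if "a * (f1 + f1') + b * (f2 + f2') + \<theta> * (f3 + f3') \<le> - \<eta> * \<epsilon>\<^sup>2" for f1 f1' f2 f2' f3 f3'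
  proof -
    have "a * (Q * (\<Psi> + f1) + Q * (\<Psi> + f1')) + b * (Q * (\<Psi> + f2) + Q * (\<Psi> + f2')) + \<theta> * (Q * (\<Psi> + f3) + Q * (\<Psi> + f3'))
      = Q * (2 * ((a + b + \<theta>) * \<Psi>) + (a * (f1 + f1') + b * (f2 + f2') + \<theta> * (f3 + f3')))"
      by (simp add: algebra_simps)
    also have "\<dots> \<le> Q * (2 * \<Psi> - \<eta> * \<epsilon>\<^sup>2)"
      using that wt(5) by (intro mult_left_mono[OF _ Q0]) simp
    finally show ?thesis .
  qed
  have tw: "t \<le> w\<^sup>2" using powr_mono'[of p 1 t] p t_pos t1 by (simp add: w_sq)
  show ?thesis
  proof (cases "dV\<^sup>2 \<ge> (4 - c1 * w\<^sup>2) * \<epsilon>\<^sup>2")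
    case True
    have n: "norm (- \<nu>) = \<epsilon>" "norm (- \<nu>') = \<epsilon>" using \<nu> by simp_all
    have ms: "s = norm (mid (- \<nu>) (- \<nu>'))" "D = norm (- \<nu> - - \<nu>')"
    proof -
      have "mid (- \<nu>) (- \<nu>') = - mid \<nu> \<nu>'" "- \<nu> - - \<nu>' = - (\<nu> - \<nu>')" by (simp_all add: mid_minus)
      then show "s = norm (mid (- \<nu>) (- \<nu>'))" "D = norm (- \<nu> - - \<nu>')"
        unfolding s_def D_def by (simp_all only: norm_minus_cancel)
    qed
    have sq: "((- \<nu> - - \<nu>') \<bullet> V)\<^sup>2 = dV\<^sup>2"
      by (simp add: dV_def inner_diff_left power2_commute)
    have d0: "drift (- \<nu>) 0 = - drift \<nu> 0" using drift_minus[of \<nu> 0] by simp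
    have cpl': "coupled_le (barrier p L N \<epsilon> \<rho> y0) \<epsilon> x z (- \<nu>) (- \<nu>')
        (Q * (\<Psi> + (- drift \<nu> \<nu>' + E1))) (Q * (\<Psi> + E2)) (Q * (\<Psi> + (- drift \<nu> 0 + E3)))"
      using barrier_coupled[OF n ms] unfolding drift_minus d0 sq Q_def E1_def E2_def E3_def .
    have "a * (2 * E1) + b * (2 * E2) + \<theta> * (2 * E3) \<le> - (m * p / 2) * (\<epsilon>\<^sup>2 * w\<^sup>2 / t)"
    proof -
      have e3: "error (2 * \<epsilon>) \<epsilon> = K * (\<delta>\<^sup>2 * w\<^sup>2 * \<epsilon>\<^sup>2 / t + 2 * \<delta> * w * \<epsilon>\<^sup>2 / t)"
        by (simp add: error_def power2_eq_square mult_ac)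
      show ?thesis
        unfolding E1_def E2_def E3_def e3 unfolding error_def
        by (rule antipodal_balance[OF wt p(1) \<delta>_pos \<delta> less_imp_le[OF w_pos] w(2) t_pos \<epsilon> K_nonneg c(1) c(3) s0 D0 par dVD True c1 \<delta>1])
    qed
    also have "- (m * p / 2) * (\<epsilon>\<^sup>2 * w\<^sup>2 / t) \<le> - \<eta> * \<epsilon>\<^sup>2"
    proof -
      have "1 \<le> w\<^sup>2 / t" using tw t_pos by simp
      then have "\<epsilon>\<^sup>2 * 1 \<le> \<epsilon>\<^sup>2 * (w\<^sup>2 / t)" by (intro mult_left_mono) auto
      then have "\<eta> * \<epsilon>\<^sup>2 \<le> (m * p / 2) * (\<epsilon>\<^sup>2 * w\<^sup>2 / t)"
        using \<eta>(1) wt(2) p by (intro mult_mono) auto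
      then show ?thesis by simp
    qed
    finally have "a * ((drift \<nu> \<nu>' + E1) + (- drift \<nu> \<nu>' + E1)) + b * (E2 + E2) + \<theta> * ((drift \<nu> 0 + E3) + (- drift \<nu> 0 + E3)) \<le> - \<eta> * \<epsilon>\<^sup>2"
      by (simp add: algebra_simps)
    from combine[OF this] cpl cpl' n show ?thesis unfolding answered_def Q_def by blast
  next
    case False
    \<comment> \<open>the shortfall of the moves from a maximal separation along \<open>V\<close>\<close>
    define j where "j = sqrt (4 - dV\<^sup>2 / \<epsilon>\<^sup>2)"
    have "dV\<^sup>2 \<le> 4 * \<epsilon>\<^sup>2" using dVD par zero_le_power2[of s] by linarith
    then have "4 - dV\<^sup>2 / \<epsilon>\<^sup>2 \<ge> 0" using \<epsilon> by (simp add: divide_le_eq)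
    then have j: "j \<ge> 0" "j\<^sup>2 = 4 - dV\<^sup>2 / \<epsilon>\<^sup>2" by (simp_all add: j_def)
    have dVj: "dV\<^sup>2 = (4 - j\<^sup>2) * \<epsilon>\<^sup>2" using \<epsilon> by (simp add: j(2))
    then have "(4 - j\<^sup>2) * \<epsilon>\<^sup>2 < (4 - c1 * w\<^sup>2) * \<epsilon>\<^sup>2" using False by simp
    then have j2: "c1 * w\<^sup>2 \<le> j\<^sup>2" using \<epsilon> by simp
    have w2: "w\<^sup>2 \<le> c2\<^sup>2 * j\<^sup>2"
    proof -
      have "1 * w\<^sup>2 \<le> (c2\<^sup>2 * c1) * w\<^sup>2" using c2 by (intro mult_right_mono) auto
      also have "\<dots> \<le> c2\<^sup>2 * j\<^sup>2" using j2 by (simp add: mult.assoc mult_left_mono)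
      finally show ?thesis by simp
    qed
    then have "w\<^sup>2 \<le> (c2 * j)\<^sup>2" by (simp add: power_mult_distrib)
    then have wj: "w \<le> c2 * j" by (rule power2_le_imp_le) (use c2 j in auto)
    define \<mu> where "\<mu> = - \<epsilon> *\<^sub>R V"
    define \<mu>' where "\<mu>' = \<epsilon> *\<^sub>R V"
    have n: "norm \<mu> = \<epsilon>" "norm \<mu>' = \<epsilon>" using \<epsilon> norm_V by (simp_all add: \<mu>_def \<mu>'_def)
    have mm: "0 = norm (mid \<mu> \<mu>')" by (simp add: mid_def \<mu>_def \<mu>'_def)
    have md: "\<mu> - \<mu>' = (- 2 * \<epsilon>) *\<^sub>R V" by (simp add: \<mu>_def \<mu>'_def algebra_simps scaleR_2[symmetric])
    have VV: "V \<bullet> V = 1" using norm_V by (simp add: norm_eq_1)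
    have mV: "(\<mu> - \<mu>') \<bullet> V = - 2 * \<epsilon>" unfolding md by (simp add: VV)
    have mD: "2 * \<epsilon> = norm (\<mu> - \<mu>')" unfolding md using \<epsilon> norm_V by simp
    define F where "F = K * (\<delta>\<^sup>2 * w\<^sup>2 * \<epsilon>\<^sup>2 / t)"
    have F: "error r 0 = F" "error 0 r = F" "error (4 * 0) r = F" for r by (simp_all add: error_def F_def)
    have z: "((2 * \<epsilon>)\<^sup>2 - (2 * \<epsilon>)\<^sup>2) / t + F = F" "(- 2 * \<epsilon>)\<^sup>2 = (2 * \<epsilon>)\<^sup>2" "(4 * 0)\<^sup>2 / t + F = F"
      by simp_all
    have cpl': "coupled_le (barrier p L N \<epsilon> \<rho> y0) \<epsilon> x z \<mu> \<mu>'
        (Q * (\<Psi> + (drift \<mu> \<mu>' + (- (p / 4 * (w\<^sup>2 / t) * (2 * \<epsilon>)\<^sup>2) + F)))) (Q * (\<Psi> + F)) (Q * (\<Psi> + (drift \<mu> 0 + E3)))"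
      using barrier_coupled[OF n mm mD] unfolding mV F add.assoc[of "- _" _ F] z unfolding Q_def E3_def .
    have dr1: "drift \<nu> \<nu>' + drift \<mu> \<mu>' \<le> slope * (dV - 2 * \<epsilon>) + 4 * S * \<delta> * w * s"
    proof -
      have "drift \<mu> \<mu>' \<le> slope * (- 2 * \<epsilon>) + 4 * S * \<delta> * w * 0"
        using drift_le[of \<mu> \<mu>'] unfolding mV mm[symmetric] .
      moreover have "drift \<nu> \<nu>' \<le> slope * dV + 4 * S * \<delta> * w * s"
        using drift_le[of \<nu> \<nu>'] unfolding dV_def s_def .
      moreover have "slope * (dV - 2 * \<epsilon>) = slope * dV + slope * (- 2 * \<epsilon>)"
        by (simp add: algebra_simps)
      ultimately show ?thesis by linarith
    qed
    have dr3: "drift \<nu> 0 + drift \<mu> 0 \<le> 4 * S * \<delta> * w * \<epsilon>"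
    proof -
      have "\<nu> \<bullet> V \<le> \<epsilon>" using norm_cauchy_schwarz[of \<nu> V] norm_V \<nu> by simp
      moreover have "\<mu> \<bullet> V = - \<epsilon>" by (simp add: \<mu>_def VV)
      ultimately have "slope * (\<nu> \<bullet> V) + slope * (\<mu> \<bullet> V) \<le> 0"
        using slope_ge_half mult_left_mono[of "\<nu> \<bullet> V" \<epsilon> slope] by simp
      moreover have m0: "norm (mid \<nu> 0) = \<epsilon> / 2" "norm (mid \<mu> 0) = \<epsilon> / 2" using \<nu> n by (simp_all add: mid_def)
      moreover have "drift \<nu> 0 \<le> slope * (\<nu> \<bullet> V) + 4 * S * \<delta> * w * (\<epsilon> / 2)" "drift \<mu> 0 \<le> slope * (\<mu> \<bullet> V) + 4 * S * \<delta> * w * (\<epsilon> / 2)"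
        using drift_le[of \<nu> 0] drift_le[of \<mu> 0] unfolding m0 diff_zero .
      moreover have "4 * S * \<delta> * w * (\<epsilon> / 2) + 4 * S * \<delta> * w * (\<epsilon> / 2) = 4 * S * \<delta> * w * \<epsilon>" by simp
      ultimately show ?thesis by linarith
    qed
    have bal: "a * ((drift \<nu> \<nu>' + drift \<mu> \<mu>') + (D\<^sup>2 - dV\<^sup>2) / t + error D s + F) + b * ((4 * s)\<^sup>2 / t + error (4 * s) \<epsilon> + F)
        + \<theta> * ((drift \<nu> 0 + drift \<mu> 0) + 2 * E3) \<le> - (m / 32) * (j\<^sup>2 * \<epsilon>)"
    proof -
      have e3: "error (2 * \<epsilon>) \<epsilon> = K * (\<delta>\<^sup>2 * w\<^sup>2 * \<epsilon>\<^sup>2 / t + 2 * \<delta> * w * \<epsilon>\<^sup>2 / t)"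
        by (simp add: error_def power2_eq_square mult_ac)
      show ?thesis
        unfolding E3_def e3 F_def unfolding error_def
        by (rule pulling_balance[OF wt \<delta>_pos \<delta> less_imp_le[OF w_pos] w(2) t_pos \<epsilon> K_nonneg c(1) S_nonneg c(2) c(3) s0 D0 par dVj dVD j(1) wj c2(1) dr1 slope_ge_half dr3 \<delta>2])
    qed
    also have "- (m / 32) * (j\<^sup>2 * \<epsilon>) \<le> - \<eta> * \<epsilon>\<^sup>2"
    proof -
      have "\<epsilon> \<le> c2\<^sup>2 * j\<^sup>2" using tw w2 t(3) \<epsilon> by linarith
      then have "m / (32 * c2\<^sup>2) * (\<epsilon> * \<epsilon>) \<le> m / (32 * c2\<^sup>2) * (c2\<^sup>2 * j\<^sup>2 * \<epsilon>)"
        using wt \<epsilon> by (intro mult_left_mono mult_right_mono) auto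
      also have "\<dots> = (m / 32) * (j\<^sup>2 * \<epsilon>)" using c2 by simp
      finally have "m / (32 * c2\<^sup>2) * \<epsilon>\<^sup>2 \<le> (m / 32) * (j\<^sup>2 * \<epsilon>)" by (simp add: power2_eq_square)
      moreover have "\<eta> * \<epsilon>\<^sup>2 \<le> m / (32 * c2\<^sup>2) * \<epsilon>\<^sup>2" using \<eta>(2) by (rule mult_right_mono) simp
      ultimately show ?thesis unfolding mult_minus_left neg_le_iff_le by (rule order_trans[rotated])
    qed
    finally have bal': "a * ((drift \<nu> \<nu>' + drift \<mu> \<mu>') + (D\<^sup>2 - dV\<^sup>2) / t + error D s + F) + b * (E2 + F)
        + \<theta> * ((drift \<nu> 0 + drift \<mu> 0) + 2 * E3) \<le> - \<eta> * \<epsilon>\<^sup>2" by (simp add: E2_def)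
    have le: "a * ((drift \<nu> \<nu>' + E1) + (drift \<mu> \<mu>' + (- (p / 4 * (w\<^sup>2 / t) * (2 * \<epsilon>)\<^sup>2) + F))) \<le> a * ((drift \<nu> \<nu>' + drift \<mu> \<mu>') + (D\<^sup>2 - dV\<^sup>2) / t + error D s + F)"
    proof (rule mult_left_mono)
      have "p / 4 * (w\<^sup>2 / t) * dV\<^sup>2 \<ge> 0" "p / 4 * (w\<^sup>2 / t) * (2 * \<epsilon>)\<^sup>2 \<ge> 0"
        using p t_pos by simp_all
      then show "(drift \<nu> \<nu>' + E1) + (drift \<mu> \<mu>' + (- (p / 4 * (w\<^sup>2 / t) * (2 * \<epsilon>)\<^sup>2) + F)) \<le> (drift \<nu> \<nu>' + drift \<mu> \<mu>') + (D\<^sup>2 - dV\<^sup>2) / t + error D s + F"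
        unfolding E1_def by linarith
    qed (use wt in linarith)
    have e3: "(drift \<nu> 0 + E3) + (drift \<mu> 0 + E3) = (drift \<nu> 0 + drift \<mu> 0) + 2 * E3" by simp
    have "a * ((drift \<nu> \<nu>' + E1) + (drift \<mu> \<mu>' + (- (p / 4 * (w\<^sup>2 / t) * (2 * \<epsilon>)\<^sup>2) + F))) + b * (E2 + F)
        + \<theta> * ((drift \<nu> 0 + E3) + (drift \<mu> 0 + E3)) \<le> - \<eta> * \<epsilon>\<^sup>2" 
      unfolding e3 by (rule order_trans[OF add_right_mono[OF add_right_mono[OF le]] bal'])
    from combine[OF this] cpl cpl' n show ?thesis unfolding answered_def Q_def by blast
  qed
qed

end

section \<open>Pairs of points a few steps apart\<close>

text \<open>
  If \<open>t < 2 * \<epsilon>\<close>, the points can meet: both jump to a common point of the perpendicular bisector, at height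
  \<open>sqrt (\<epsilon>\<^sup>2 - (t / 2)\<^sup>2)\<close>.  This is where the dimension must be at least two.
\<close>
lemma approach_step:
  fixes x z :: "'a::euclidean_space"
  assumes dim: "DIM('a) \<ge> 2" and xz: "x \<noteq> z" and \<epsilon>: "\<epsilon> > 0"
  shows "\<exists>\<mu> \<mu>'. norm \<mu> = \<epsilon> \<and> norm \<mu>' = \<epsilon> \<and> norm (x + \<mu> - (z + \<mu>')) = max 0 (norm (x - z) - 2 * \<epsilon>)"
proof -
  define t where "t = norm (x - z)"
  define V where "V = (x - z) /\<^sub>R t"
  have t: "t > 0" using xz by (simp add: t_def)
  have V: "norm V = 1" "x - z = t *\<^sub>R V" using t by (simp_all add: V_def t_def)
  show ?thesis
  proof (cases "t \<ge> 2 * \<epsilon>")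
    case True
    have "x + (- \<epsilon>) *\<^sub>R V - (z + \<epsilon> *\<^sub>R V) = (x - z) - (2 * \<epsilon>) *\<^sub>R V" 
    proof -
      have eq: "(2 * \<epsilon>) *\<^sub>R V = \<epsilon> *\<^sub>R V + \<epsilon> *\<^sub>R V" by (simp flip: scaleR_add_left)
      show ?thesis unfolding eq by simp
    qed
    also have "\<dots> = (t - 2 * \<epsilon>) *\<^sub>R V" by (simp add: V(2) scaleR_diff_left)
    finally have "norm (x + (- \<epsilon>) *\<^sub>R V - (z + \<epsilon> *\<^sub>R V)) = max 0 (norm (x - z) - 2 * \<epsilon>)"
      using True V(1) unfolding t_def[symmetric] by simp
    then show ?thesis using \<epsilon> V(1) by (intro exI[of _ "(- \<epsilon>) *\<^sub>R V"] exI[of _ "\<epsilon> *\<^sub>R V"]) simp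
  next
    case False
    obtain e0 where e0: "e0 \<noteq> 0" "orthogonal V e0"
      using orthogonal_to_vector_exists[OF dim, of V] by blast
    define e where "e = e0 /\<^sub>R norm e0"
    have e: "norm e = 1" "V \<bullet> e = 0" using e0 by (simp_all add: e_def orthogonal_def)
    define c where "c = sqrt (\<epsilon>\<^sup>2 - (t / 2)\<^sup>2)"
    have "(t / 2)\<^sup>2 \<le> \<epsilon>\<^sup>2" using False t by (intro power_mono) auto
    then have c: "c\<^sup>2 = \<epsilon>\<^sup>2 - (t / 2)\<^sup>2" by (simp add: c_def)
    have n: "norm (k *\<^sub>R V + c *\<^sub>R e) = \<epsilon>" if "k\<^sup>2 = (t / 2)\<^sup>2" for k
    proof -
      have "(norm (k *\<^sub>R V + c *\<^sub>R e))\<^sup>2 = k\<^sup>2 * (norm V)\<^sup>2 + c\<^sup>2 * (norm e)\<^sup>2"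
        using norm_add_Pythagorean[of "k *\<^sub>R V" "c *\<^sub>R e"] e(2) by (simp add: orthogonal_def power_mult_distrib)
      also have "\<dots> = \<epsilon>\<^sup>2" using that c e(1) V(1) by simp
      finally show ?thesis using \<epsilon> by (simp add: power2_eq_iff_nonneg)
    qed
    have "x + ((- t / 2) *\<^sub>R V + c *\<^sub>R e) - (z + ((t / 2) *\<^sub>R V + c *\<^sub>R e)) = (x - z) - t *\<^sub>R V"
    proof -
      have eq: "t *\<^sub>R V = (t / 2) *\<^sub>R V + (t / 2) *\<^sub>R V" by (simp flip: scaleR_add_left)
      show ?thesis unfolding eq by simp
    qed
    then have "norm (x + ((- t / 2) *\<^sub>R V + c *\<^sub>R e) - (z + ((t / 2) *\<^sub>R V + c *\<^sub>R e))) = max 0 (norm (x - z) - 2 * \<epsilon>)"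
      using V(2) False unfolding t_def[symmetric] by simp
    then show ?thesis using n[of "- t / 2"] n[of "t / 2"]
      by (intro exI[of _ "(- t / 2) *\<^sub>R V + c *\<^sub>R e"] exI[of _ "(t / 2) *\<^sub>R V + c *\<^sub>R e"]) simp
  qed
qed

lemma weight_le_linear:
  fixes y \<sigma> :: "'a::euclidean_space"
  assumes q: "q = \<rho>\<^sup>2 - (norm y)\<^sup>2" "6 * \<epsilon> \<le> q" and \<rho>: "0 < \<rho>" "\<rho> \<le> 1" and \<sigma>: "norm \<sigma> \<le> \<epsilon>" "\<epsilon> > 0"
  shows "weight \<rho> (y + \<sigma>) \<le> weight \<rho> y * (1 + 78 * (\<epsilon> / q))"
proof -
  have q0: "q > 0" using q(2) \<sigma> by linarith
  have "y \<bullet> \<sigma> \<le> \<epsilon>" using weight_region(2)[OF q(1) q0 \<rho>, of \<sigma>] \<sigma> by linarith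
  then have "4 / q * (y \<bullet> \<sigma>) \<le> 4 / q * \<epsilon>" using q0 by (intro mult_left_mono) auto
  moreover have "74 * (norm \<sigma>)\<^sup>2 / q\<^sup>2 \<le> 74 * (\<epsilon> / q)"
  proof -
    have "(norm \<sigma> / q)\<^sup>2 \<le> (\<epsilon> / q)\<^sup>2" using \<sigma> q0 by (intro power_mono divide_right_mono) auto
    also have "\<dots> \<le> 1 * (\<epsilon> / q)"
      unfolding power2_eq_square using q(2) q0 \<sigma> by (intro mult_right_mono) auto
    finally show ?thesis by (simp add: power_divide)
  qed
  ultimately have "1 + 4 / q * (y \<bullet> \<sigma>) + 74 * (norm \<sigma>)\<^sup>2 / q\<^sup>2 \<le> 1 + 78 * (\<epsilon> / q)" by simp
  from mult_left_mono[OF this weight_nonneg[of \<rho> y]] show ?thesis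
    using weight_expansion[OF q(1) q0 \<rho>, of \<sigma>] q(2) \<sigma> by linarith
qed

text \<open>
  Any move climbs at most one step of the stair, of height \<open>X\<close>, and costs a bounded multiple of \<open>\<epsilon>\<close> otherwise; the answer
  descends one step of height \<open>L * X\<close>, with weight at least \<open>m\<close>.  Since \<open>m * L \<ge> 20\<close>, the descent wins.
\<close>
lemma near_answered:
  fixes x z y0 :: "'a::euclidean_space" and m :: real
  assumes dim: "DIM('a) \<ge> 2" and p: "0 < p" "p \<le> 1/2" and L: "1 \<le> L" "20 \<le> m * L" and \<epsilon>: "\<epsilon> > 0"
    and xz: "x \<noteq> z" and t: "t = norm (x - z)" "t \<le> 2 * real N * \<epsilon>" "(t + 2 * \<epsilon>) powr p \<le> 1/4"
    and y: "y = mid x z - y0" and q: "q = \<rho>\<^sup>2 - (norm y)\<^sup>2" "6 * \<epsilon> \<le> q" and \<rho>: "0 < \<rho>" "\<rho> \<le> 1"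
    and q': "78 * (2 * real N + 2 + stair L N N) * \<epsilon> \<le> q"
    and \<Psi>: "\<Psi> = pair_mod p L N \<epsilon> t"
    and wt: "a \<ge> m" "m > 0" "b \<ge> 0" "\<theta> \<ge> 0" "a + b + \<theta> = 1"
    and \<nu>: "norm \<nu> = \<epsilon>" "norm \<nu>' = \<epsilon>"
  shows "answered (barrier p L N \<epsilon> \<rho> y0) \<epsilon> x z a b \<theta> \<nu> \<nu>' (weight \<rho> y * (2 * \<Psi> - \<epsilon>))"
proof -
  define k where "k = nat \<lceil>t / (2 * \<epsilon>)\<rceil>"
  define X where "X = L ^ (N - k)"
  have t0: "t > 0" using xz t(1) by simp
  have q0: "q > 0" using q(2) \<epsilon> by linarith
  have X1: "X \<ge> 1" using L by (simp add: X_def one_le_power)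
  have "0 < t / (2 * \<epsilon>)" using t0 \<epsilon> by simp
  then have k1: "k \<ge> 1" unfolding k_def by linarith
  have "t / (2 * \<epsilon>) \<le> real N" using t(2) \<epsilon> by (simp add: divide_le_eq mult_ac)
  then have kN: "k \<le> N" unfolding k_def by linarith
  have pw: "r powr p \<le> 1/4" if "0 \<le> r" "r \<le> t + 2 * \<epsilon>" for r
    using powr_mono2[of p r "t + 2 * \<epsilon>"] that p t(3) by linarith
  have W: "weight \<rho> y \<ge> 0" by (rule weight_nonneg)
  have \<Psi>k: "\<Psi> = concave_mod p t + \<epsilon> * stair L N k" by (simp add: \<Psi> pair_mod_def k_def)
  have bound: "barrier p L N \<epsilon> \<rho> y0 (x + g) (z + h) \<le> weight \<rho> y * (P + \<epsilon>)"
    if gh: "norm g \<le> \<epsilon>" "norm h \<le> \<epsilon>" and P: "pair_mod p L N \<epsilon> (norm (x + g - (z + h))) \<le> P" for g h P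
  proof -
    define t' where "t' = norm (x + g - (z + h))"
    have "t' \<le> norm (x - z) + norm (g - h)"
      using norm_triangle_ineq[of "x - z" "g - h"] by (simp add: t'_def algebra_simps)
    then have t': "t' \<le> t + 2 * \<epsilon>" "t' \<ge> 0" using norm_triangle_ineq4[of g h] gh t(1) by (auto simp: t'_def)
    let ?P = "pair_mod p L N \<epsilon> t'"
    have P0: "?P \<ge> 0" by (rule pair_mod_nonneg) (use L \<epsilon> t' pw in auto)
    have "?P \<le> t' + \<epsilon> * stair L N N" by (rule pair_mod_upper) (use L \<epsilon> t' in auto)
    also have "\<dots> \<le> (2 * real N + 2 + stair L N N) * \<epsilon>" using t' t(2) by (simp add: algebra_simps)
    finally have "?P * (78 * (\<epsilon> / q)) \<le> (2 * real N + 2 + stair L N N) * \<epsilon> * (78 * (\<epsilon> / q))"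
      using \<epsilon> q0 by (intro mult_right_mono) auto
    also have "\<dots> = (78 * (2 * real N + 2 + stair L N N) * \<epsilon>) * (\<epsilon> / q)" by simp
    also have "\<dots> \<le> q * (\<epsilon> / q)" using q' \<epsilon> q0 by (intro mult_right_mono) auto
    finally have small: "?P * (78 * (\<epsilon> / q)) \<le> \<epsilon>" using q0 by simp
    have s: "norm (mid g h) \<le> \<epsilon>" unfolding mid_def using norm_triangle_ineq[of g h] gh by simp
    have "mid (x + g) (z + h) - y0 = y + mid g h" by (simp add: y mid_def algebra_simps)
    then have "barrier p L N \<epsilon> \<rho> y0 (x + g) (z + h) = ?P * weight \<rho> (y + mid g h)"
      by (simp add: barrier_def t'_def)
    also have "\<dots> \<le> ?P * (weight \<rho> y * (1 + 78 * (\<epsilon> / q)))"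
      by (intro mult_left_mono[OF _ P0] weight_le_linear q \<rho> s \<epsilon>)
    also have "\<dots> = weight \<rho> y * (?P + ?P * (78 * (\<epsilon> / q)))" by (simp add: algebra_simps)
    also have "\<dots> \<le> weight \<rho> y * (P + \<epsilon>)"
      using small P by (intro mult_left_mono[OF _ W]) (simp add: t'_def)
    finally show ?thesis .
  qed
  define E where "E = weight \<rho> y * ((\<Psi> + \<epsilon> * X + 2 * \<epsilon>) + \<epsilon>)"
  have any: "barrier p L N \<epsilon> \<rho> y0 (x + g) (z + h) \<le> E" if gh: "norm g \<le> \<epsilon>" "norm h \<le> \<epsilon>" for g h
  proof -
    define t' where "t' = norm (x + g - (z + h))"
    have "t' \<le> norm (x - z) + norm (g - h)"
      using norm_triangle_ineq[of "x - z" "g - h"] by (simp add: t'_def algebra_simps)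
    then have t': "t' \<le> t + 2 * \<epsilon>" "t' \<ge> 0" using norm_triangle_ineq4[of g h] gh t(1) by (auto simp: t'_def)
    have "t' / (2 * \<epsilon>) \<le> (t + 2 * \<epsilon>) / (2 * \<epsilon>)" using t' \<epsilon> by (intro divide_right_mono) auto
    also have "\<dots> = t / (2 * \<epsilon>) + 1" using \<epsilon> by (simp add: field_simps)
    finally have "nat \<lceil>t' / (2 * \<epsilon>)\<rceil> \<le> Suc k" unfolding k_def by linarith
    then have "stair L N (nat \<lceil>t' / (2 * \<epsilon>)\<rceil>) \<le> stair L N (Suc k)" using L by (intro stair_mono) auto
    also have "\<dots> \<le> stair L N k + X" using L by (simp add: stair_Suc X_def)
    finally have "\<epsilon> * stair L N (nat \<lceil>t' / (2 * \<epsilon>)\<rceil>) \<le> \<epsilon> * (stair L N k + X)"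
      using \<epsilon> by (intro mult_left_mono) auto
    moreover have "concave_mod p t' \<le> concave_mod p t + 2 * \<epsilon>"
    proof -
      have "concave_mod p t' \<le> concave_mod p (t + 2 * \<epsilon>)"
        using t' \<epsilon> t0 t(3) by (intro concave_mod_increment[OF p]) auto
      also have "\<dots> \<le> concave_mod p t + (t + 2 * \<epsilon> - t)"
        using \<epsilon> t0 t(3) by (intro concave_mod_increment[OF p]) auto
      finally show ?thesis by simp
    qed
    ultimately have "pair_mod p L N \<epsilon> t' \<le> \<Psi> + \<epsilon> * X + 2 * \<epsilon>"
      unfolding \<Psi>k pair_mod_def by (simp add: algebra_simps)
    then have "barrier p L N \<epsilon> \<rho> y0 (x + g) (z + h) \<le> weight \<rho> y * ((\<Psi> + \<epsilon> * X + 2 * \<epsilon>) + \<epsilon>)"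
      unfolding t'_def by (intro bound gh)
    then show ?thesis unfolding E_def .
  qed
  have cpl: "coupled_le (barrier p L N \<epsilon> \<rho> y0) \<epsilon> x z g g' e E E"
    if "norm g = \<epsilon>" "norm g' = \<epsilon>" "barrier p L N \<epsilon> \<rho> y0 (x + g) (z + g') \<le> e" for g g' e
    unfolding coupled_le_def
  proof (intro conjI allI impI that(3))
    fix h assume "g \<bullet> h = 0 \<and> norm h < \<epsilon>"
    then show "barrier p L N \<epsilon> \<rho> y0 (x + h) (z + reflect (g - g') h) + barrier p L N \<epsilon> \<rho> y0 (x - h) (z - reflect (g - g') h) \<le> 2 * E"
      using any[of h "reflect (g - g') h"] any[of "- h" "- reflect (g - g') h"] by (simp add: norm_reflect)
  next
    fix h assume "g' \<bullet> h = 0 \<and> norm h < \<epsilon>"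
    then show "barrier p L N \<epsilon> \<rho> y0 (x + g) (z + h) + barrier p L N \<epsilon> \<rho> y0 (x + g) (z - h) \<le> 2 * E"
      using any[of g h] any[of g "- h"] that by simp
  qed
  obtain \<mu> \<mu>' where \<mu>: "norm \<mu> = \<epsilon>" "norm \<mu>' = \<epsilon>" and near: "norm (x + \<mu> - (z + \<mu>')) = max 0 (t - 2 * \<epsilon>)"
    using approach_step[OF dim xz \<epsilon>] t(1) by blast
  define e' where "e' = weight \<rho> y * (\<Psi> - \<epsilon> * (L * X) + \<epsilon>)"
  have "barrier p L N \<epsilon> \<rho> y0 (x + \<mu>) (z + \<mu>') \<le> e'"
  proof -
    define t' where "t' = max 0 (t - 2 * \<epsilon>)"
    have t': "0 \<le> t'" "t' \<le> t" using t0 \<epsilon> by (auto simp: t'_def)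
    have "concave_mod p t' \<le> concave_mod p t"
      using t' \<epsilon> by (intro concave_mod_increment[OF p] pw) auto
    moreover have "stair L N (nat \<lceil>t' / (2 * \<epsilon>)\<rceil>) \<le> stair L N k - L * X"
    proof -
      have "nat \<lceil>t' / (2 * \<epsilon>)\<rceil> \<le> k - 1"
      proof (cases "t \<ge> 2 * \<epsilon>")
        case True
        then have "t' / (2 * \<epsilon>) = t / (2 * \<epsilon>) - 1" using \<epsilon> by (simp add: t'_def field_simps)
        then show ?thesis unfolding k_def by linarith
      qed (simp add: t'_def)
      then have "stair L N (nat \<lceil>t' / (2 * \<epsilon>)\<rceil>) \<le> stair L N (k - 1)" using L by (intro stair_mono) auto
      also have "stair L N k = stair L N (k - 1) + L ^ (N - (k - 1))"
        using k1 kN stair_Suc[of L N "k - 1"] by simp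
      then have "stair L N (k - 1) = stair L N k - L * X"
        using k1 kN by (simp add: X_def power_Suc[symmetric] Suc_diff_le del: power_Suc)
      finally show ?thesis .
    qed
    then have "\<epsilon> * stair L N (nat \<lceil>t' / (2 * \<epsilon>)\<rceil>) \<le> \<epsilon> * (stair L N k - L * X)"
      using \<epsilon> by (intro mult_left_mono) auto
    ultimately have "pair_mod p L N \<epsilon> t' \<le> \<Psi> - \<epsilon> * (L * X)"
      unfolding \<Psi>k pair_mod_def by (simp add: algebra_simps)
    then show ?thesis unfolding e'_def by (intro bound) (use \<mu> near in \<open>auto simp: t'_def\<close>)
  qed
  then have c': "coupled_le (barrier p L N \<epsilon> \<rho> y0) \<epsilon> x z \<mu> \<mu>' e' E E" using \<mu> by (intro cpl)
  have c: "coupled_le (barrier p L N \<epsilon> \<rho> y0) \<epsilon> x z \<nu> \<nu>' E E E" using \<nu> any by (intro cpl) auto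
  have "a * (E + e') + b * (E + E) + \<theta> * (E + E) = (a + b + \<theta>) * (2 * E) - a * (E - e')" by (simp add: algebra_simps)
  also have "\<dots> = 2 * E - a * (E - e')" using wt(5) by simp
  also have "\<dots> = weight \<rho> y * (2 * \<Psi> + 2 * \<epsilon> * X + 6 * \<epsilon> - a * \<epsilon> * (X + L * X + 2))"
    by (simp add: E_def e'_def algebra_simps)
  also have "\<dots> \<le> weight \<rho> y * (2 * \<Psi> - \<epsilon>)"
  proof (rule mult_left_mono[OF _ W])
    \<comment> \<open>the descent has size \<open>20 * \<epsilon> * X\<close>, against \<open>2 * \<epsilon> * X + 6 * \<epsilon>\<close> for everything else\<close>
    have "20 * X \<le> (m * L) * X" using L X1 by (intro mult_right_mono) auto
    also have "\<dots> \<le> a * (L * X)" using wt L X1 by (simp add: mult.assoc mult_right_mono)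
    also have "\<dots> \<le> a * (X + L * X + 2)" using wt X1 by (intro mult_left_mono) auto
    finally have "\<epsilon> * (20 * X) \<le> \<epsilon> * (a * (X + L * X + 2))" using \<epsilon> by (intro mult_left_mono) auto
    moreover have "\<epsilon> * 1 \<le> \<epsilon> * X" using \<epsilon> X1 by (intro mult_left_mono) auto
    moreover have "2 * \<Psi> + 2 * \<epsilon> * X + 6 * \<epsilon> - Y \<le> 2 * \<Psi> - \<epsilon>"
      if Y: "\<epsilon> * (20 * X) \<le> Y" "\<epsilon> * 1 \<le> \<epsilon> * X" for Y
    proof -
      define Z where "Z = \<epsilon> * X"
      have "20 * Z \<le> Y" "\<epsilon> \<le> Z" "2 * \<epsilon> * X = 2 * Z" using Y by (simp_all add: Z_def)
      then show ?thesis using \<epsilon> by linarith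
    qed
    ultimately have "2 * \<Psi> + 2 * \<epsilon> * X + 6 * \<epsilon> - \<epsilon> * (a * (X + L * X + 2)) \<le> 2 * \<Psi> - \<epsilon>" by blast
    moreover have "a * \<epsilon> * (X + L * X + 2) = \<epsilon> * (a * (X + L * X + 2))" by simp
    ultimately show "2 * \<Psi> + 2 * \<epsilon> * X + 6 * \<epsilon> - a * \<epsilon> * (X + L * X + 2) \<le> 2 * \<Psi> - \<epsilon>" by (simp only:)
  qed
  finally show ?thesis using c c' \<mu> unfolding answered_def by blast
qed

section \<open>The barrier is a strict supersolution\<close>

lemma barrier_sym: "barrier p L N \<epsilon> \<rho> y0 x z = barrier p L N \<epsilon> \<rho> y0 z x"
  by (simp add: barrier_def mid_def norm_minus_commute add.commute)

lemma barrier_diag: "barrier p L N \<epsilon> \<rho> y0 x x = 0"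
  by (simp add: barrier_def pair_mod_def concave_mod_def)

text \<open>
  The constants are chosen in this order: the step ratio \<open>L\<close> and the number of steps \<open>N\<close> from \<open>m\<close>; then the bound
  \<open>S\<close> for the barrier relative to the distance and the error constant \<open>K\<close>; then the threshold \<open>c1\<close>; then \<open>\<delta>\<close>, small
  compared with all of these; and finally \<open>\<kappa>\<close>, which turns the hypothesis on the size of
  the barrier into smallness of \<open>t\<close> and \<open>\<epsilon>\<close> compared with \<open>q\<^sup>2\<close>.  The first two conclusions keep the
  neighbouring pairs inside the region of comparison.
\<close>
lemma barrier_strict_supersolution:
  fixes m c p \<rho> \<tau> :: real
  assumes dim: "DIM('a::euclidean_space) \<ge> 2" and m: "0 < m" "m \<le> 1" and c: "c \<ge> 0"
    and p: "0 < p" "p \<le> 1/2" and \<rho>: "0 < \<rho>" "\<rho> \<le> 1" and \<tau>: "\<tau> > 0"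
  shows "\<exists>L N \<kappa> \<eta>. L \<ge> 1 \<and> \<kappa> > 0 \<and> \<eta> > 0 \<and>
    (\<forall>\<epsilon> x z y0::'a. \<epsilon> > 0 \<longrightarrow> x \<noteq> z \<longrightarrow> norm (mid x z - y0) < \<rho> \<longrightarrow> norm (x - z) powr p \<le> 1/4 \<longrightarrow>
       pair_mod p L N \<epsilon> (norm (x - z)) \<le> \<kappa> * (\<rho>\<^sup>2 - (norm (mid x z - y0))\<^sup>2)\<^sup>2 \<longrightarrow>
       norm (x - z) + 2 * \<epsilon> < \<tau> \<and> 6 * \<epsilon> \<le> \<rho>\<^sup>2 - (norm (mid x z - y0))\<^sup>2 \<and>
       (\<forall>a b \<theta> \<nu> \<nu>'. a \<ge> m \<longrightarrow> b \<ge> 0 \<longrightarrow> \<theta> \<ge> 0 \<longrightarrow> a + b + \<theta> = 1 \<longrightarrow> \<theta> \<le> c * norm (x - z) powr (2 * p) \<longrightarrow>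
          norm \<nu> = \<epsilon> \<longrightarrow> norm \<nu>' = \<epsilon> \<longrightarrow>
          answered (barrier p L N \<epsilon> \<rho> y0) \<epsilon> x z a b \<theta> \<nu> \<nu>' (2 * barrier p L N \<epsilon> \<rho> y0 x z - \<eta> * \<epsilon>\<^sup>2)))"
proof -
  define L where "L = 20 / m"
  have L: "L \<ge> 1" "20 \<le> m * L" using m by (simp_all add: L_def le_divide_eq)
  obtain N0 :: nat where N0: "40 / m \<le> real N0" using real_arch_simple by blast
  define N where "N = N0 + 2"
  have N: "80 \<le> m * (2 * real N)" "N \<ge> 2"
  proof -
    have "40 \<le> real N0 * m" using N0 m by (simp add: divide_le_eq)
    also have "\<dots> \<le> real N * m" using m by (intro mult_right_mono) (auto simp: N_def)
    finally show "80 \<le> m * (2 * real N)" by (simp add: mult.commute)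
  qed (simp add: N_def)
  define S0 where "S0 = stair L N N"
  have S0: "S0 \<ge> 0" unfolding S0_def using L by (intro stair_nonneg) auto
  define S where "S = 1 + S0"
  define K where "K = 74 * (S + 1)"
  have S: "S \<ge> 0" and K: "K \<ge> 0" using S0 by (simp_all add: S_def K_def)
  define c1 where "c1 = m * p / 20"
  have mp: "m * p > 0" "m * p \<le> 1" using m p by (auto intro: mult_le_one)
  have c1: "0 \<le> c1" "c1 \<le> 1" "20 * c1 \<le> m * p" "c1 > 0" using mp by (simp_all add: c1_def)
  define c2 where "c2 = 1 / sqrt c1"
  have c2sq: "c2\<^sup>2 * c1 = 1" using c1 by (simp add: c2_def power_divide)
  have c2: "1 \<le> c2" "1 \<le> c2\<^sup>2 * c1" using c1 c2sq by (simp_all add: c2_def)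
  define X1 where "X1 = 6 * K + c * (4 + 3 * K)"
  define X2 where "X2 = c2\<^sup>2 * (2 * S + 7 * K + c * (4 * S + 8 + 6 * K))"
  have X: "X1 \<ge> 0" "X2 \<ge> 0" using K S c by (simp_all add: X1_def X2_def)
  define \<delta> where "\<delta> = min (1/2) (min (m * p / 4 / (X1 + 1)) (m / 32 / (X2 + 1)))"
  have \<delta>0: "\<delta> > 0" using X m mp by (simp add: \<delta>_def)
  have \<delta>h: "\<delta> \<le> 1/2" unfolding \<delta>_def by (rule min.cobounded1)
  have \<delta>1: "\<delta> * X1 \<le> m * p / 4"
  proof -
    have "\<delta> \<le> m * p / 4 / (X1 + 1)" unfolding \<delta>_def by (rule min.coboundedI2, rule min.cobounded1)
    then have "\<delta> * (X1 + 1) \<le> m * p / 4" using X by (subst (asm) pos_le_divide_eq) auto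
    then show ?thesis using \<delta>0 by (simp add: distrib_left)
  qed
  have \<delta>2: "\<delta> * X2 \<le> m / 32"
  proof -
    have "\<delta> \<le> m / 32 / (X2 + 1)" unfolding \<delta>_def by (rule min.coboundedI2, rule min.cobounded2)
    then have "\<delta> * (X2 + 1) \<le> m / 32" using X by (subst (asm) pos_le_divide_eq) auto
    then show ?thesis using \<delta>0 by (simp add: distrib_left)
  qed
  \<comment> \<open>distances up to \<open>R\<close> satisfy \<open>t powr (p / 2) \<le> \<delta>\<close>\<close>
  define R where "R = \<delta> powr (2 / p)"
  have R: "R > 0" "R powr (p / 2) = \<delta>" "R powr p = \<delta>\<^sup>2" "R \<le> 1"
  proof -
    show "R > 0" "R powr (p / 2) = \<delta>" using \<delta>0 p by (simp_all add: R_def powr_powr)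
    show "R powr p = \<delta>\<^sup>2" using \<delta>0 p by (simp add: R_def powr_powr)
    have "R \<le> 1 powr (2 / p)" unfolding R_def using \<delta>0 \<delta>h p by (intro powr_mono2) auto
    then show "R \<le> 1" by simp
  qed
  define G where "G = 78 * (2 * real N + 2 + S0)"
  have G: "G > 0" using S0 by (simp add: G_def add_nonneg_pos add_pos_nonneg)
  define \<kappa> where "\<kappa> = Min {\<tau> / 5, R / 4, \<delta>\<^sup>2 / 2, 1 / 6, 1 / G}"
  have \<kappa>: "\<kappa> > 0" "\<kappa> \<le> \<tau> / 5" "\<kappa> \<le> R / 4" "\<kappa> \<le> \<delta>\<^sup>2 / 2" "\<kappa> \<le> 1 / 6" "\<kappa> \<le> 1 / G"
  proof -
    show "\<kappa> > 0" using \<tau> R(1) \<delta>0 G by (simp add: \<kappa>_def)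
    show "\<kappa> \<le> \<tau> / 5" "\<kappa> \<le> R / 4" "\<kappa> \<le> \<delta>\<^sup>2 / 2" "\<kappa> \<le> 1 / 6" "\<kappa> \<le> 1 / G"
      unfolding \<kappa>_def by (rule Min_le; simp)+
  qed
  define \<eta> where "\<eta> = min 1 (min (m * p / 2) (m / (32 * c2\<^sup>2)))"
  have \<eta>: "\<eta> > 0" "\<eta> \<le> 1" "\<eta> \<le> m * p / 2" "\<eta> \<le> m / (32 * c2\<^sup>2)"
  proof -
    show "\<eta> > 0" using mp m c2 by (simp add: \<eta>_def)
    show "\<eta> \<le> 1" unfolding \<eta>_def by (rule min.cobounded1)
    show "\<eta> \<le> m * p / 2" unfolding \<eta>_def by (rule min.coboundedI2, rule min.cobounded1)
    show "\<eta> \<le> m / (32 * c2\<^sup>2)" unfolding \<eta>_def by (rule min.coboundedI2, rule min.cobounded2)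
  qed
  show ?thesis
  proof (rule exI[of _ L], rule exI[of _ N], rule exI[of _ \<kappa>], rule exI[of _ \<eta>], intro conjI L(1) \<kappa>(1) \<eta>(1) allI impI)
    fix \<epsilon> :: real and x z y0 :: 'a
    assume \<epsilon>: "\<epsilon> > 0" and xz: "x \<noteq> z" and y\<rho>: "norm (mid x z - y0) < \<rho>" and tp: "norm (x - z) powr p \<le> 1/4"
      and le: "pair_mod p L N \<epsilon> (norm (x - z)) \<le> \<kappa> * (\<rho>\<^sup>2 - (norm (mid x z - y0))\<^sup>2)\<^sup>2"
    define t where "t = norm (x - z)"
    define y where "y = mid x z - y0"
    define q where "q = \<rho>\<^sup>2 - (norm y)\<^sup>2"
    define \<Psi> where "\<Psi> = pair_mod p L N \<epsilon> t"
    have t0: "t > 0" using xz by (simp add: t_def)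
    have q0: "q > 0" using y\<rho> \<rho> power_strict_mono[of "norm y" \<rho> 2] by (simp add: q_def y_def)
    note q1 = weight_region(1)[OF q_def q0 \<rho>]
    have qq: "q\<^sup>2 \<le> q" "q\<^sup>2 \<le> 1" using q0 q1 by (simp_all add: power2_eq_square mult_left_le_one_le mult_le_one)
    have \<Psi>le: "\<Psi> \<le> \<kappa> * q\<^sup>2" using le by (simp add: \<Psi>_def t_def q_def y_def)
    have st: "stair L N (nat \<lceil>t / (2 * \<epsilon>)\<rceil>) \<ge> 1"
    proof -
      have "0 < t / (2 * \<epsilon>)" using t0 \<epsilon> by simp
      then have "1 \<le> nat \<lceil>t / (2 * \<epsilon>)\<rceil>" by linarith
      then have "stair L N 1 \<le> stair L N (nat \<lceil>t / (2 * \<epsilon>)\<rceil>)" using L by (intro stair_mono) auto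
      moreover have "stair L N 1 = L ^ N" using N stair_Suc[of L N 0] by simp
      moreover have "L ^ N \<ge> 1" using L by (simp add: one_le_power)
      ultimately show ?thesis by linarith
    qed
    have cm: "t / 2 \<le> concave_mod p t" using t0 tp by (intro concave_mod_lower) (auto simp: t_def)
    have "\<epsilon> * 1 \<le> \<epsilon> * stair L N (nat \<lceil>t / (2 * \<epsilon>)\<rceil>)" using \<epsilon> st by (intro mult_left_mono) auto
    then have "t / 2 + \<epsilon> \<le> \<Psi>" using cm unfolding \<Psi>_def pair_mod_def by linarith
    then have \<epsilon>\<kappa>: "\<epsilon> \<le> \<kappa> * q\<^sup>2" and t\<kappa>: "t \<le> 2 * (\<kappa> * q\<^sup>2)" using \<Psi>le t0 \<epsilon> by linarith+
    have kq: "\<kappa> * q\<^sup>2 \<le> \<kappa> * 1" "\<kappa> * q\<^sup>2 \<le> \<kappa> * q" using \<kappa>(1) qq by (auto intro!: mult_left_mono)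
    have t2: "t + 2 * \<epsilon> \<le> 4 * \<kappa>" using \<epsilon>\<kappa> t\<kappa> kq by linarith
    have t\<tau>: "t + 2 * \<epsilon> < \<tau>" using t2 \<kappa>(2) \<tau> by linarith
    have "\<epsilon> \<le> \<kappa> * q" using \<epsilon>\<kappa> kq by linarith
    also have "\<dots> \<le> 1 / 6 * q" using \<kappa>(5) q0 by (intro mult_right_mono) auto
    finally have \<epsilon>q: "6 * \<epsilon> \<le> q" by simp
    have "G * \<epsilon> \<le> G * (\<kappa> * q)" using \<epsilon>\<kappa> kq G by (intro mult_left_mono) auto
    also have "\<dots> \<le> G * (1 / G * q)" using \<kappa>(6) q0 G by (intro mult_left_mono mult_right_mono) auto
    finally have Gq: "G * \<epsilon> \<le> q" using G by simp
    have \<epsilon>1: "\<epsilon> \<le> 1" using \<epsilon>q q1 \<epsilon> by linarith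
    have tR: "t + 2 * \<epsilon> \<le> R" using t2 \<kappa>(3) by linarith
    have t1: "t \<le> 1" using tR R(4) \<epsilon> by linarith
    have tp2: "(t + 2 * \<epsilon>) powr p \<le> 1/4"
    proof -
      have "(t + 2 * \<epsilon>) powr p \<le> R powr p" using tR t0 \<epsilon> p by (intro powr_mono2) auto
      also have "\<dots> \<le> (1/2)\<^sup>2" unfolding R(3) using \<delta>h \<delta>0 by (intro power_mono) auto
      finally show ?thesis by (simp add: power2_eq_square)
    qed
    have W1: "weight \<rho> y \<ge> 1" using q0 qq by (simp add: weight_def q_def[symmetric])
    have bar: "barrier p L N \<epsilon> \<rho> y0 x z = weight \<rho> y * \<Psi>" by (simp add: barrier_def \<Psi>_def t_def y_def)
    show "norm (x - z) + 2 * \<epsilon> < \<tau>" using t\<tau> by (simp add: t_def)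
    show "6 * \<epsilon> \<le> \<rho>\<^sup>2 - (norm (mid x z - y0))\<^sup>2" using \<epsilon>q by (simp add: q_def y_def)
    fix a b \<theta> :: real and \<nu> \<nu>' :: 'a
    assume wt: "a \<ge> m" "b \<ge> 0" "\<theta> \<ge> 0" "a + b + \<theta> = 1" and \<theta>: "\<theta> \<le> c * norm (x - z) powr (2 * p)"
      and \<nu>: "norm \<nu> = \<epsilon>" "norm \<nu>' = \<epsilon>"
    show "answered (barrier p L N \<epsilon> \<rho> y0) \<epsilon> x z a b \<theta> \<nu> \<nu>' (2 * barrier p L N \<epsilon> \<rho> y0 x z - \<eta> * \<epsilon>\<^sup>2)"
    proof (cases "t \<le> 2 * real N * \<epsilon>")
      case True
      have "weight \<rho> y * (2 * \<Psi> - \<epsilon>) \<le> 2 * barrier p L N \<epsilon> \<rho> y0 x z - \<eta> * \<epsilon>\<^sup>2"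
      proof -
        have "\<eta> * \<epsilon>\<^sup>2 \<le> 1 * (\<epsilon> * 1)" unfolding power2_eq_square using \<eta> \<epsilon> \<epsilon>1 by (intro mult_mono) auto
        moreover have "1 * \<epsilon> \<le> weight \<rho> y * \<epsilon>" using W1 \<epsilon> by (intro mult_right_mono) auto
        ultimately show ?thesis unfolding bar by (simp add: right_diff_distrib)
      qed
      with near_answered[OF dim p L \<epsilon> xz t_def True tp2 y_def q_def \<epsilon>q \<rho> Gq[unfolded G_def S0_def] \<Psi>_def wt(1) m(1) wt(2-4) \<nu>]
      show ?thesis by (rule answered_mono)
    next
      case False
      define w where "w = t powr (p / 2)"
      have w0: "w > 0" using t0 by (simp add: w_def)
      have w\<delta>: "w \<le> \<delta>"
        unfolding w_def R(2)[symmetric] using tR t0 \<epsilon> p by (intro powr_mono2) auto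
      have w4: "w ^ 4 = t powr (2 * p)"
      proof -
        have "w ^ 4 = w powr real 4" using w0 by (rule powr_realpow[symmetric])
        then show ?thesis by (simp add: w_def powr_powr mult.commute)
      qed
      have N\<epsilon>: "4 * \<epsilon> \<le> t" "80 * \<epsilon> \<le> m * t"
      proof -
        have "2 * \<epsilon> \<le> real N * \<epsilon>" using N \<epsilon> by (intro mult_right_mono) auto
        then show "4 * \<epsilon> \<le> t" using False by simp
        have "80 * \<epsilon> \<le> m * (2 * real N) * \<epsilon>" using N \<epsilon> by (intro mult_right_mono) auto
        also have "\<dots> = m * (2 * real N * \<epsilon>)" by simp
        also have "\<dots> \<le> m * t" using False m by (intro mult_left_mono) auto
        finally show "80 * \<epsilon> \<le> m * t" .
      qed
      have tq: "t / q \<le> \<delta> * w"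
      proof -
        \<comment> \<open>\<open>t = sqrt t * sqrt t\<close>, one factor is at most \<open>\<delta> * q\<close> and the other at most \<open>w\<close>\<close>
        have "t \<le> 2 * (\<kappa> * q\<^sup>2)" by (rule t\<kappa>)
        also have "\<dots> \<le> 2 * (\<delta>\<^sup>2 / 2 * q\<^sup>2)" using \<kappa>(4) by (intro mult_left_mono mult_right_mono) auto
        finally have "t \<le> (\<delta> * q)\<^sup>2" by (simp add: power_mult_distrib)
        then have "sqrt t \<le> \<delta> * q" using \<delta>0 q0 by (intro real_le_lsqrt) auto
        moreover have "sqrt t \<le> w"
          unfolding w_def powr_half_sqrt[symmetric, OF less_imp_le[OF t0]] using p t0 t1 by (intro powr_mono') auto
        ultimately have "sqrt t * sqrt t \<le> (\<delta> * q) * w" using \<delta>0 q0 t0 by (intro mult_mono) auto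
        then show ?thesis using t0 q0 by (simp add: divide_le_eq mult_ac)
      qed
      have \<Psi>S: "\<Psi> \<le> S * t"
      proof -
        have "\<Psi> \<le> t + \<epsilon> * S0" unfolding \<Psi>_def S0_def by (rule pair_mod_upper) (use L \<epsilon> t0 in auto)
        also have "\<epsilon> * S0 \<le> t * S0" using N\<epsilon>(1) \<epsilon> S0 by (intro mult_right_mono) auto
        finally show ?thesis by (simp add: S_def algebra_simps)
      qed
      interpret distant_pair x z y0 p L \<epsilon> \<rho> \<delta> S K N t q w \<Psi> y "(x - z) /\<^sub>R t"
        by unfold_locales (use p L \<epsilon> t_def False N\<epsilon> tp2 y_def q_def \<epsilon>q \<rho> \<Psi>_def \<Psi>S w_def w\<delta> tq \<delta>h K_def in \<open>auto simp: not_le\<close>)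
      have "\<theta> \<le> c * w ^ 4" using \<theta> by (simp add: w4 t_def)
      note resp = distant_answered[OF wt(1) m(1) wt(2-4) c N\<epsilon>(2) this c1(1-3) c2 \<delta>1[unfolded X1_def] _ \<nu> t1 \<eta>(3,4)]
      have "weight \<rho> y * (2 * \<Psi> - \<eta> * \<epsilon>\<^sup>2) \<le> 2 * barrier p L N \<epsilon> \<rho> y0 x z - \<eta> * \<epsilon>\<^sup>2"
      proof -
        have "1 * (\<eta> * \<epsilon>\<^sup>2) \<le> weight \<rho> y * (\<eta> * \<epsilon>\<^sup>2)" using W1 \<eta> by (intro mult_right_mono) auto
        then show ?thesis unfolding bar by (simp add: right_diff_distrib)
      qed
      moreover have "\<delta> * c2\<^sup>2 * (2 * S + 7 * K + c * (4 * S + 8 + 6 * K)) \<le> m / 32"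
        using \<delta>2 by (simp add: X2_def mult.assoc)
      ultimately show ?thesis using answered_mono[OF resp] by blast
    qed
  qed
qed

definition turn_value :: "('a::euclidean_space \<Rightarrow> real) \<Rightarrow> real \<Rightarrow> real \<Rightarrow> 'a \<Rightarrow> 'a \<Rightarrow> real" where
  "turn_value u \<epsilon> \<alpha> x \<nu> = \<alpha> * u (x + \<nu>) + (1 - \<alpha>) * orth_disc_average u \<epsilon> \<nu> x"

text \<open>
  Stated at a single point and with the weight as a number, so that it can be used for \<open>- u\<close> and with
  the two points exchanged.
\<close>
definition dpp_at :: "('a::euclidean_space \<Rightarrow> real) \<Rightarrow> real \<Rightarrow> real \<Rightarrow> 'a \<Rightarrow> bool" where
  "dpp_at u \<epsilon> \<alpha> x \<longleftrightarrow>
     u x = 1/2 * (SUP \<nu>\<in>sphere 0 \<epsilon>. turn_value u \<epsilon> \<alpha> x \<nu>) + 1/2 * (INF \<nu>\<in>sphere 0 \<epsilon>. turn_value u \<epsilon> \<alpha> x \<nu>)"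

lemma turn_value_uminus: "turn_value (\<lambda>y. - u y) \<epsilon> \<alpha> x \<nu> = - turn_value u \<epsilon> \<alpha> x \<nu>"
  by (simp add: turn_value_def orth_disc_average_uminus algebra_simps)

lemma dpp_at_uminus: "dpp_at u \<epsilon> \<alpha> x \<Longrightarrow> dpp_at (\<lambda>y. - u y) \<epsilon> \<alpha> x"
  by (simp add: dpp_at_def turn_value_uminus Inf_real_def image_image)

lemma turn_value_bounded:
  fixes u :: "'a::euclidean_space \<Rightarrow> real"
  assumes u: "u \<in> borel_measurable borel" "\<And>y. \<bar>u y\<bar> \<le> c" and "\<epsilon> > 0" and \<alpha>: "0 \<le> \<alpha>" "\<alpha> \<le> 1"
  shows "\<bar>turn_value u \<epsilon> \<alpha> x \<nu>\<bar> \<le> c"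
proof -
  have le: "orth_disc_average v \<epsilon> \<nu> x \<le> c" if "v \<in> borel_measurable borel" "\<And>y. \<bar>v y\<bar> \<le> c" for v
  proof (rule orth_disc_average_bound[OF that \<open>\<epsilon> > 0\<close>])
    show "v (x + h) + v (x - h) \<le> 2 * c" for h using that(2)[of "x + h"] that(2)[of "x - h"] by linarith
  qed
  have "\<bar>orth_disc_average u \<epsilon> \<nu> x\<bar> \<le> c"
    using le[of u] le[of "\<lambda>y. - u y"] u by (auto simp: orth_disc_average_uminus abs_le_iff)
  then have "\<bar>(1 - \<alpha>) * orth_disc_average u \<epsilon> \<nu> x\<bar> \<le> (1 - \<alpha>) * c" using \<alpha> by (simp add: abs_mult mult_left_mono)
  moreover have "\<bar>\<alpha> * u (x + \<nu>)\<bar> \<le> \<alpha> * c" using \<alpha> u by (simp add: abs_mult mult_left_mono)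
  ultimately show ?thesis unfolding turn_value_def by (simp add: left_diff_distrib abs_le_iff)
qed

text \<open>
  The coupling: the difference of the turn values splits with weights \<open>\<alpha>z\<close>, \<open>1 - \<alpha>x\<close> and
  \<open>\<alpha>x - \<alpha>z\<close> into the three branches.
\<close>
lemma turn_value_diff_le:
  fixes u :: "'a::euclidean_space \<Rightarrow> real"
  assumes u[measurable]: "u \<in> borel_measurable borel" and bdd: "\<And>y. \<bar>u y\<bar> \<le> c" and \<epsilon>: "\<epsilon> > 0"
    and \<alpha>: "0 \<le> \<alpha>z" "\<alpha>z \<le> \<alpha>x" "\<alpha>x \<le> 1" and C: "C \<ge> 0"
    and \<nu>: "norm \<nu> = \<epsilon>" "norm \<nu>' = \<epsilon>"
    and f: "\<And>a b. norm a \<le> \<epsilon> \<Longrightarrow> norm b \<le> \<epsilon> \<Longrightarrow> u (x + a) - u (z + b) \<le> K + C * f (x + a) (z + b)"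
    and cpl: "coupled_le f \<epsilon> x z \<nu> \<nu>' e1 e2 e3"
  shows "turn_value u \<epsilon> \<alpha>x x \<nu> - turn_value u \<epsilon> \<alpha>z z \<nu>' \<le> K + C * (\<alpha>z * e1 + (1 - \<alpha>x) * e2 + (\<alpha>x - \<alpha>z) * e3)"
proof -
  let ?Ax = "orth_disc_average u \<epsilon> \<nu> x" and ?Az = "orth_disc_average u \<epsilon> \<nu>' z"
  let ?Q = "reflect (\<nu> - \<nu>')"
  have 1: "u (x + \<nu>) - u (z + \<nu>') \<le> K + C * e1"
  proof -
    have "C * f (x + \<nu>) (z + \<nu>') \<le> C * e1" using cpl C by (intro mult_left_mono) (auto simp: coupled_le_def)
    then show ?thesis using f[of \<nu> \<nu>'] \<nu> by simp
  qed
  have 2: "?Ax - ?Az \<le> K + C * e2"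
  proof (rule orth_disc_average_diff_bound[OF u bdd \<epsilon> linear_reflect norm_reflect reflect_hyperplane])
    show "norm \<nu> = norm \<nu>'" using \<nu> by simp
    fix h assume h: "\<nu> \<bullet> h = 0" "norm h < \<epsilon>"
    have "f (x + h) (z + ?Q h) + f (x - h) (z - ?Q h) \<le> 2 * e2" using cpl h by (auto simp: coupled_le_def)
    from mult_left_mono[OF this C]
    show "u (x + h) - u (z + ?Q h) + (u (x - h) - u (z - ?Q h)) \<le> 2 * (K + C * e2)"
      using f[of h "?Q h"] f[of "- h" "- ?Q h"] h by (simp add: norm_reflect distrib_left)
  qed
  have 3: "u (x + \<nu>) - ?Az \<le> K + C * e3"
  proof -
    have "orth_disc_average (\<lambda>y. - u y) \<epsilon> \<nu>' z \<le> K + C * e3 - u (x + \<nu>)"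
    proof (rule orth_disc_average_bound[OF _ _ \<epsilon>])
      fix h assume h: "\<nu>' \<bullet> h = 0" "norm h < \<epsilon>"
      have "f (x + \<nu>) (z + h) + f (x + \<nu>) (z - h) \<le> 2 * e3" using cpl h by (auto simp: coupled_le_def)
      from mult_left_mono[OF this C]
      show "- u (z + h) + - u (z - h) \<le> 2 * (K + C * e3 - u (x + \<nu>))"
        using f[of \<nu> h] f[of \<nu> "- h"] h \<nu> by (simp add: distrib_left)
    qed (use bdd in auto)
    then show ?thesis by (simp add: orth_disc_average_uminus)
  qed
  have "turn_value u \<epsilon> \<alpha>x x \<nu> - turn_value u \<epsilon> \<alpha>z z \<nu>'
      = \<alpha>z * (u (x + \<nu>) - u (z + \<nu>')) + (1 - \<alpha>x) * (?Ax - ?Az) + (\<alpha>x - \<alpha>z) * (u (x + \<nu>) - ?Az)"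
    by (simp add: turn_value_def algebra_simps)
  also have "\<dots> \<le> \<alpha>z * (K + C * e1) + (1 - \<alpha>x) * (K + C * e2) + (\<alpha>x - \<alpha>z) * (K + C * e3)"
    using \<alpha> 1 2 3 by (intro add_mono mult_left_mono) auto
  also have "\<dots> = K + C * (\<alpha>z * e1 + (1 - \<alpha>x) * e2 + (\<alpha>x - \<alpha>z) * e3)" by (simp add: algebra_simps)
  finally show ?thesis .
qed

text \<open>
  Take \<open>\<nu>\<close> nearly optimal for the supremum at \<open>x\<close> and \<open>\<nu>'\<close> nearly optimal for the infimum at \<open>z\<close>; the answer bounds the
  infimum at \<open>x\<close> and the supremum at \<open>z\<close>.
\<close>
lemma dpp_diff_le:
  fixes u :: "'a::euclidean_space \<Rightarrow> real"
  assumes \<epsilon>: "\<epsilon> > 0" and dx: "dpp_at u \<epsilon> \<alpha>x x" and dz: "dpp_at u \<epsilon> \<alpha>z z"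
    and bdd: "\<And>\<nu>. \<bar>turn_value u \<epsilon> \<alpha>x x \<nu>\<bar> \<le> c" "\<And>\<nu>. \<bar>turn_value u \<epsilon> \<alpha>z z \<nu>\<bar> \<le> c"
    and resp: "\<And>\<nu> \<nu>'. norm \<nu> = \<epsilon> \<Longrightarrow> norm \<nu>' = \<epsilon> \<Longrightarrow> \<exists>\<mu> \<mu>'. norm \<mu> = \<epsilon> \<and> norm \<mu>' = \<epsilon> \<and>
       (turn_value u \<epsilon> \<alpha>x x \<nu> - turn_value u \<epsilon> \<alpha>z z \<nu>') + (turn_value u \<epsilon> \<alpha>x x \<mu> - turn_value u \<epsilon> \<alpha>z z \<mu>') \<le> 2 * R"
  shows "u x - u z \<le> R"
proof (rule field_le_epsilon)
  fix e :: real assume e: "e > 0"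
  let ?S = "sphere (0::'a) \<epsilon>" and ?T = "turn_value u \<epsilon> \<alpha>x x" and ?T' = "turn_value u \<epsilon> \<alpha>z z"
  have ne: "?S \<noteq> {}" using \<epsilon> by simp
  have ba: "bdd_above (?T ` ?S)" "bdd_below (?T ` ?S)" "bdd_above (?T' ` ?S)" "bdd_below (?T' ` ?S)"
    using bdd by (auto intro!: bdd_aboveI2[of _ _ c] bdd_belowI2[of _ "- c"] simp: abs_le_iff minus_le_iff)
  obtain \<nu> where \<nu>: "\<nu> \<in> ?S" "(SUP \<nu>\<in>?S. ?T \<nu>) - e < ?T \<nu>"
    using less_cSUP_iff[OF ne ba(1), of "(SUP \<nu>\<in>?S. ?T \<nu>) - e"] e by auto
  obtain \<nu>' where \<nu>': "\<nu>' \<in> ?S" "?T' \<nu>' < (INF \<nu>\<in>?S. ?T' \<nu>) + e"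
    using cINF_less_iff[OF ne ba(4), of "(INF \<nu>\<in>?S. ?T' \<nu>) + e"] e by auto
  obtain \<mu> \<mu>' where \<mu>: "norm \<mu> = \<epsilon>" "norm \<mu>' = \<epsilon>" "(?T \<nu> - ?T' \<nu>') + (?T \<mu> - ?T' \<mu>') \<le> 2 * R"
    using resp[of \<nu> \<nu>'] \<nu> \<nu>' by auto
  have "(INF \<nu>\<in>?S. ?T \<nu>) \<le> ?T \<mu>" using \<mu> by (intro cINF_lower ba) auto
  moreover have "?T' \<mu>' \<le> (SUP \<nu>\<in>?S. ?T' \<nu>)" using \<mu> by (intro cSUP_upper ba) auto
  ultimately show "u x - u z \<le> R + e"
    using dx dz \<nu>(2) \<nu>'(2) \<mu>(3) unfolding dpp_at_def by linarith
qed

section \<open>Comparison with the barrier\<close>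

lemma comparison_step:
  fixes u :: "'a::euclidean_space \<Rightarrow> real"
  assumes u: "u \<in> borel_measurable borel" "\<And>y. \<bar>u y\<bar> \<le> c" and \<epsilon>: "\<epsilon> > 0" and C: "C \<ge> 0"
    and dpp: "dpp_at u \<epsilon> \<alpha>x x" "dpp_at u \<epsilon> \<alpha>z z" and \<alpha>: "0 \<le> \<alpha>z" "\<alpha>z \<le> \<alpha>x" "\<alpha>x \<le> 1"
    and f: "\<And>a b. norm a \<le> \<epsilon> \<Longrightarrow> norm b \<le> \<epsilon> \<Longrightarrow> u (x + a) - u (z + b) \<le> K + C * f (x + a) (z + b)"
    and ans: "\<And>\<nu> \<nu>'. norm \<nu> = \<epsilon> \<Longrightarrow> norm \<nu>' = \<epsilon> \<Longrightarrow>
       answered f \<epsilon> x z \<alpha>z (1 - \<alpha>x) (\<alpha>x - \<alpha>z) \<nu> \<nu>' (2 * f x z - e)"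
  shows "u x - u z \<le> K + C * f x z - C * e / 2"
proof (rule dpp_diff_le[OF \<epsilon> dpp])
  show "\<bar>turn_value u \<epsilon> \<alpha>x x \<nu>\<bar> \<le> c" "\<bar>turn_value u \<epsilon> \<alpha>z z \<nu>\<bar> \<le> c" for \<nu>
    using \<alpha> by (intro turn_value_bounded u \<epsilon>; simp)+
  fix \<nu> \<nu>' :: 'a assume \<nu>: "norm \<nu> = \<epsilon>" "norm \<nu>' = \<epsilon>"
  from ans[OF this] obtain \<mu> \<mu>' e1 e2 e3 e1' e2' e3' where \<mu>: "norm \<mu> = \<epsilon>" "norm \<mu>' = \<epsilon>"
    and cpl: "coupled_le f \<epsilon> x z \<nu> \<nu>' e1 e2 e3" "coupled_le f \<epsilon> x z \<mu> \<mu>' e1' e2' e3'"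
    and le: "\<alpha>z * (e1 + e1') + (1 - \<alpha>x) * (e2 + e2') + (\<alpha>x - \<alpha>z) * (e3 + e3') \<le> 2 * f x z - e"
    unfolding answered_def by blast
  have gen: "X + X' \<le> 2 * (K + F - E)" if "X \<le> K + A" "X' \<le> K + A'" "A + A' = D" "D \<le> H" "H = 2 * (F - E)"
    for X X' A A' D H F E :: real
    using that by argo
  have "turn_value u \<epsilon> \<alpha>x x \<nu> - turn_value u \<epsilon> \<alpha>z z \<nu>' \<le> K + C * (\<alpha>z * e1 + (1 - \<alpha>x) * e2 + (\<alpha>x - \<alpha>z) * e3)"
    by (rule turn_value_diff_le[OF u \<epsilon> \<alpha> C \<nu> f cpl(1)])
  moreover have "turn_value u \<epsilon> \<alpha>x x \<mu> - turn_value u \<epsilon> \<alpha>z z \<mu>' \<le> K + C * (\<alpha>z * e1' + (1 - \<alpha>x) * e2' + (\<alpha>x - \<alpha>z) * e3')"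
    by (rule turn_value_diff_le[OF u \<epsilon> \<alpha> C \<mu> f cpl(2)])
  moreover have "C * (\<alpha>z * e1 + (1 - \<alpha>x) * e2 + (\<alpha>x - \<alpha>z) * e3) + C * (\<alpha>z * e1' + (1 - \<alpha>x) * e2' + (\<alpha>x - \<alpha>z) * e3')
      = C * (\<alpha>z * (e1 + e1') + (1 - \<alpha>x) * (e2 + e2') + (\<alpha>x - \<alpha>z) * (e3 + e3'))"
    by (simp add: algebra_simps)
  moreover note mult_left_mono[OF le C]
  moreover have "C * (2 * f x z - e) = 2 * (C * f x z - C * e / 2)" by (simp add: algebra_simps)
  ultimately have "(turn_value u \<epsilon> \<alpha>x x \<nu> - turn_value u \<epsilon> \<alpha>z z \<nu>') + (turn_value u \<epsilon> \<alpha>x x \<mu> - turn_value u \<epsilon> \<alpha>z z \<mu>')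
      \<le> 2 * (K + C * f x z - C * e / 2)" by (rule gen)
  with \<mu> show "\<exists>\<mu> \<mu>'. norm \<mu> = \<epsilon> \<and> norm \<mu>' = \<epsilon> \<and>
       (turn_value u \<epsilon> \<alpha>x x \<nu> - turn_value u \<epsilon> \<alpha>z z \<nu>') + (turn_value u \<epsilon> \<alpha>x x \<mu> - turn_value u \<epsilon> \<alpha>z z \<mu>')
       \<le> 2 * (K + C * f x z - C * e / 2)" by blast
qed

text \<open>
  The maximum principle.  The case \<open>\<alpha> x < \<alpha> z\<close> reduces to the other one by passing to \<open>- u\<close> and exchanging
  the points, since the barrier is symmetric.
\<close>
lemma local_comparison:
  fixes m c p \<rho> \<tau> M :: real
  assumes dim: "DIM('a::euclidean_space) \<ge> 2" and m: "0 < m" "m \<le> 1" and c: "c \<ge> 0"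
    and p: "0 < p" "p \<le> 1/2" and \<rho>: "0 < \<rho>" "\<rho> \<le> 1/2" and \<tau>: "\<tau> > 0" "\<tau> powr p \<le> 1/4" and M: "M \<ge> 0"
  shows "\<exists>L N C. L \<ge> 1 \<and> C > 0 \<and>
    (\<forall>\<epsilon> (u :: 'a \<Rightarrow> real) \<alpha> y0. \<epsilon> > 0 \<longrightarrow> u \<in> borel_measurable borel \<longrightarrow> bounded (range u) \<longrightarrow>
      (\<forall>w\<in>ball y0 (\<rho> + \<tau> / 2). \<bar>u w\<bar> \<le> M \<and> dpp_at u \<epsilon> (\<alpha> w) w \<and> m \<le> \<alpha> w \<and> \<alpha> w \<le> 1) \<longrightarrow>
      (\<forall>w\<in>ball y0 (\<rho> + \<tau> / 2). \<forall>v\<in>ball y0 (\<rho> + \<tau> / 2). \<bar>\<alpha> w - \<alpha> v\<bar> \<le> c * norm (w - v) powr (2 * p)) \<longrightarrow>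
      (\<forall>x z. norm (mid x z - y0) < \<rho> \<longrightarrow> norm (x - z) < \<tau> \<longrightarrow> u x - u z \<le> C * barrier p L N \<epsilon> \<rho> y0 x z))"
proof -
  have \<rho>1: "\<rho> \<le> 1" using \<rho> by simp
  obtain L N \<kappa> \<eta> where L: "L \<ge> 1" and \<kappa>: "\<kappa> > 0" and \<eta>: "\<eta> > 0" and super:
    "\<And>\<epsilon> x z y0::'a. \<epsilon> > 0 \<Longrightarrow> x \<noteq> z \<Longrightarrow> norm (mid x z - y0) < \<rho> \<Longrightarrow> norm (x - z) powr p \<le> 1/4 \<Longrightarrow>
       pair_mod p L N \<epsilon> (norm (x - z)) \<le> \<kappa> * (\<rho>\<^sup>2 - (norm (mid x z - y0))\<^sup>2)\<^sup>2 \<Longrightarrow>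
       norm (x - z) + 2 * \<epsilon> < \<tau> \<and> 6 * \<epsilon> \<le> \<rho>\<^sup>2 - (norm (mid x z - y0))\<^sup>2 \<and>
       (\<forall>a b \<theta> \<nu> \<nu>'. a \<ge> m \<longrightarrow> b \<ge> 0 \<longrightarrow> \<theta> \<ge> 0 \<longrightarrow> a + b + \<theta> = 1 \<longrightarrow> \<theta> \<le> c * norm (x - z) powr (2 * p) \<longrightarrow>
          norm \<nu> = \<epsilon> \<longrightarrow> norm \<nu>' = \<epsilon> \<longrightarrow>
          answered (barrier p L N \<epsilon> \<rho> y0) \<epsilon> x z a b \<theta> \<nu> \<nu>' (2 * barrier p L N \<epsilon> \<rho> y0 x z - \<eta> * \<epsilon>\<^sup>2))"
    using barrier_strict_supersolution[OF dim m c p \<rho>(1) \<rho>1 \<tau>(1)] by blast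
  \<comment> \<open>\<open>u x - u z\<close> is at most \<open>2 * M\<close>, so a violation forces the barrier below \<open>\<kappa>\<close>; the summand \<open>1\<close> keeps \<open>C\<close> positive\<close>
  define C where "C = (2 * M + 1) / \<kappa>"
  have C: "C > 0" using M \<kappa> by (simp add: C_def add_nonneg_pos)
  show ?thesis
  proof (rule exI[of _ L], rule exI[of _ N], rule exI[of _ C], intro conjI L C allI impI)
    fix \<epsilon> :: real and u :: "'a \<Rightarrow> real" and \<alpha> :: "'a \<Rightarrow> real" and y0 x1 z1 :: 'a
    assume \<epsilon>: "\<epsilon> > 0" and u: "u \<in> borel_measurable borel" "bounded (range u)"
      and pts: "\<forall>w\<in>ball y0 (\<rho> + \<tau> / 2). \<bar>u w\<bar> \<le> M \<and> dpp_at u \<epsilon> (\<alpha> w) w \<and> m \<le> \<alpha> w \<and> \<alpha> w \<le> 1"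
      and hol: "\<forall>w\<in>ball y0 (\<rho> + \<tau> / 2). \<forall>v\<in>ball y0 (\<rho> + \<tau> / 2). \<bar>\<alpha> w - \<alpha> v\<bar> \<le> c * norm (w - v) powr (2 * p)"
      and xz1: "norm (mid x1 z1 - y0) < \<rho>" "norm (x1 - z1) < \<tau>"
    obtain B where B: "\<And>y. \<bar>u y\<bar> \<le> B" using u(2) by (auto simp: bounded_iff)
    let ?b = "barrier p L N \<epsilon> \<rho> y0"
    define P where "P = {(x, z). norm (mid x z - y0) < \<rho> \<and> norm (x - z) < \<tau>}"
    define gap where "gap = (\<lambda>(x, z). u x - u z - C * ?b x z)"
    have inb: "x \<in> ball y0 (\<rho> + \<tau> / 2)" "z \<in> ball y0 (\<rho> + \<tau> / 2)" if "(x, z) \<in> P" for x z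
    proof -
      have "x - y0 = (mid x z - y0) + (1/2) *\<^sub>R (x - z)" "z - y0 = (mid x z - y0) + (- (1/2)) *\<^sub>R (x - z)"
        by (simp_all add: mid_def algebra_simps flip: scaleR_add_left)
      note e = this
      have "norm (x - y0) \<le> norm (mid x z - y0) + norm (x - z) / 2" "norm (z - y0) \<le> norm (mid x z - y0) + norm (x - z) / 2"
        unfolding e using norm_triangle_ineq[of "mid x z - y0" "(1/2) *\<^sub>R (x - z)"] norm_triangle_ineq[of "mid x z - y0" "(- (1/2)) *\<^sub>R (x - z)"] by simp_all
      then show "x \<in> ball y0 (\<rho> + \<tau> / 2)" "z \<in> ball y0 (\<rho> + \<tau> / 2)"
        using that by (auto simp: P_def dist_norm norm_minus_commute)
    qed
    have tp: "norm (x - z) powr p \<le> 1/4" if "(x, z) \<in> P" for x z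
    proof -
      have "norm (x - z) powr p \<le> \<tau> powr p" using that p by (intro powr_mono2) (auto simp: P_def)
      then show ?thesis using \<tau>(2) by linarith
    qed
    have b0: "?b x z \<ge> 0" if "(x, z) \<in> P" for x z
      unfolding barrier_def using tp[OF that] L \<epsilon> by (intro mult_nonneg_nonneg pair_mod_nonneg weight_nonneg) auto
    have gap2M: "gap (x, z) \<le> 2 * M" if "(x, z) \<in> P" for x z
    proof -
      have "\<bar>u x\<bar> \<le> M" "\<bar>u z\<bar> \<le> M" using pts inb[OF that] by blast+
      then show ?thesis using b0[OF that] C unfolding gap_def by (simp add: abs_le_iff) (smt (verit) mult_nonneg_nonneg)
    qed
    define K where "K = (SUP xz\<in>P. gap xz)"
    have bdd: "bdd_above (gap ` P)" using gap2M by (intro bdd_aboveI2[of _ _ "2 * M"]) auto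
    have gapK: "gap (x, z) \<le> K" if "(x, z) \<in> P" for x z
      unfolding K_def by (rule cSUP_upper[OF that bdd])
    have improve: "gap (x, z) \<le> K - C * (\<eta> * \<epsilon>\<^sup>2) / 2" if xz: "(x, z) \<in> P" and pos: "gap (x, z) > 0" for x z
    proof -
      have ne: "x \<noteq> z" using pos by (auto simp: gap_def barrier_diag)
      define q where "q = \<rho>\<^sup>2 - (norm (mid x z - y0))\<^sup>2"
      have my: "norm (mid x z - y0) < \<rho>" using xz by (simp add: P_def)
      have q0: "q > 0" using my power_strict_mono[of "norm (mid x z - y0)" \<rho> 2] by (simp add: q_def)
      have small: "pair_mod p L N \<epsilon> (norm (x - z)) \<le> \<kappa> * q\<^sup>2"
      proof -
        have "\<bar>u x\<bar> \<le> M" "\<bar>u z\<bar> \<le> M" using pts inb[OF xz] by blast+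
        then have "C * ?b x z \<le> 2 * M + 1" using pos by (simp add: gap_def abs_le_iff)
        then have "(2 * M + 1) * ?b x z \<le> (2 * M + 1) * \<kappa>" using \<kappa> by (simp add: C_def divide_le_eq)
        then have "?b x z \<le> \<kappa>" using M by simp
        then show ?thesis using q0 by (simp add: barrier_def weight_def q_def[symmetric] divide_le_eq)
      qed
      note S = super[OF \<epsilon> ne my tp[OF xz] small[unfolded q_def]]
      have nb: "(x + a, z + b) \<in> P" if ab: "norm a \<le> \<epsilon>" "norm b \<le> \<epsilon>" for a b
      proof -
        have "q = (\<rho> - norm (mid x z - y0)) * (\<rho> + norm (mid x z - y0))" by (simp add: q_def power2_eq_square algebra_simps)
        also have "\<dots> \<le> (\<rho> - norm (mid x z - y0)) * 1" using my \<rho> by (intro mult_left_mono) auto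
        finally have "6 * \<epsilon> \<le> \<rho> - norm (mid x z - y0)" using S by (simp add: q_def)
        moreover have mm: "mid (x + a) (z + b) - y0 = (mid x z - y0) + mid a b" by (simp add: mid_def algebra_simps)
        moreover have "norm (mid a b) \<le> \<epsilon>" unfolding mid_def using norm_triangle_ineq[of a b] ab by simp
        ultimately have "norm (mid (x + a) (z + b) - y0) < \<rho>"
          unfolding mm using norm_triangle_ineq[of "mid x z - y0" "mid a b"] \<epsilon> by linarith
        moreover have "norm (x + a - (z + b)) \<le> norm (x - z) + 2 * \<epsilon>"
          using norm_triangle_ineq[of "x - z" "a - b"] norm_triangle_ineq4[of a b] ab by (simp add: algebra_simps)
        ultimately show ?thesis using S by (simp add: P_def)
      qed
      have fK: "u (x + a) - u (z + b) \<le> K + C * ?b (x + a) (z + b)" if "norm a \<le> \<epsilon>" "norm b \<le> \<epsilon>" for a b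
        using gapK[OF nb[OF that]] by (simp add: gap_def)
      note px = pts[rule_format, OF inb(1)[OF xz]] and pz = pts[rule_format, OF inb(2)[OF xz]]
      have h: "\<bar>\<alpha> x - \<alpha> z\<bar> \<le> c * norm (x - z) powr (2 * p)" using hol inb[OF xz] by blast
      have "u x - u z \<le> K + C * ?b x z - C * (\<eta> * \<epsilon>\<^sup>2) / 2"
      proof (cases "\<alpha> z \<le> \<alpha> x")
        case True
        show ?thesis
        proof (rule comparison_step[OF u(1) B \<epsilon> less_imp_le[OF C], where \<alpha>x="\<alpha> x" and \<alpha>z="\<alpha> z"])
          show "answered ?b \<epsilon> x z (\<alpha> z) (1 - \<alpha> x) (\<alpha> x - \<alpha> z) \<nu> \<nu>' (2 * ?b x z - \<eta> * \<epsilon>\<^sup>2)"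
            if "norm \<nu> = \<epsilon>" "norm \<nu>' = \<epsilon>" for \<nu> \<nu>'
            using S that px pz True h by auto
        qed (use px pz True m fK in auto)
      next
        case False
        have ne': "z \<noteq> x" using ne by simp
        have sw: "mid z x = mid x z" "norm (z - x) = norm (x - z)" by (simp_all add: mid_def add.commute norm_minus_commute)
        have S': "\<forall>a b \<theta> \<nu> \<nu>'. a \<ge> m \<longrightarrow> b \<ge> 0 \<longrightarrow> \<theta> \<ge> 0 \<longrightarrow> a + b + \<theta> = 1 \<longrightarrow> \<theta> \<le> c * norm (z - x) powr (2 * p) \<longrightarrow>
          norm \<nu> = \<epsilon> \<longrightarrow> norm \<nu>' = \<epsilon> \<longrightarrow> answered ?b \<epsilon> z x a b \<theta> \<nu> \<nu>' (2 * ?b z x - \<eta> * \<epsilon>\<^sup>2)"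
          using super[OF \<epsilon> ne', of y0] my tp[OF xz] small unfolding sw q_def by blast
        have "- u z - - u x \<le> K + C * ?b z x - C * (\<eta> * \<epsilon>\<^sup>2) / 2"
        proof (rule comparison_step[where u="\<lambda>y. - u y" and c=B and \<epsilon>=\<epsilon> and \<alpha>x="\<alpha> z" and \<alpha>z="\<alpha> x"])
          show "answered ?b \<epsilon> z x (\<alpha> x) (1 - \<alpha> z) (\<alpha> z - \<alpha> x) \<nu> \<nu>' (2 * ?b z x - \<eta> * \<epsilon>\<^sup>2)"
            if "norm \<nu> = \<epsilon>" "norm \<nu>' = \<epsilon>" for \<nu> \<nu>'
            using S' that px pz False h unfolding sw by auto
          show "- u (z + a) - - u (x + b) \<le> K + C * ?b (z + a) (x + b)" if "norm a \<le> \<epsilon>" "norm b \<le> \<epsilon>" for a b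
            using fK[OF that(2,1)] barrier_sym[of p L N \<epsilon> \<rho> y0 "x + b" "z + a"] by simp
        qed (use px pz False m B \<epsilon> C u dpp_at_uminus in auto)
        then show ?thesis using barrier_sym[of p L N \<epsilon> \<rho> y0 x z] by simp
      qed
      then show ?thesis by (simp add: gap_def)
    qed
    have "gap (x1, z1) \<le> 0"
    proof (rule ccontr)
      assume "\<not> gap (x1, z1) \<le> 0"
      then have g: "gap (x1, z1) > 0" by simp
      have P1: "(x1, z1) \<in> P" using xz1 by (simp add: P_def)
      have d: "C * (\<eta> * \<epsilon>\<^sup>2) / 2 > 0" using C \<eta> \<epsilon> by simp
      have K0: "K > 0" using gapK[OF P1] g by linarith
      have "gap w \<le> max 0 (K - C * (\<eta> * \<epsilon>\<^sup>2) / 2)" if "w \<in> P" for w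
        using improve[of "fst w" "snd w"] that by (cases "gap w > 0") auto
      then have "K \<le> max 0 (K - C * (\<eta> * \<epsilon>\<^sup>2) / 2)"
        unfolding K_def using P1 by (intro cSUP_least) auto
      then show False using K0 d by linarith
    qed
    then show "u x1 - u z1 \<le> C * ?b x1 z1" by (simp add: gap_def)
  qed
qed

text \<open>
  Extending the solution by \<open>0\<close> outside the closed \<open>\<epsilon>\<close>-neighbourhood makes it a bounded Borel function on the whole
  space; the principle only sees values in that neighbourhood.
\<close>
lemma dpp_solution_truncate:
  fixes u :: "'a::euclidean_space \<Rightarrow> real"
  assumes sol: "dpp_solution \<Omega> \<epsilon> \<alpha> \<beta> u" and \<epsilon>: "\<epsilon> > 0" and \<beta>: "\<forall>x\<in>\<Omega>. \<alpha> x + \<beta> x = 1"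
  defines "v \<equiv> \<lambda>y. if y \<in> eps_nbhd \<Omega> \<epsilon> then u y else 0"
  shows "v \<in> borel_measurable borel" "bounded (range v)" "\<And>x. x \<in> \<Omega> \<Longrightarrow> v x = u x"
    "\<And>x. x \<in> \<Omega> \<Longrightarrow> dpp_at v \<epsilon> (\<alpha> x) x"
proof -
  have "closed (eps_nbhd \<Omega> \<epsilon>)"
    unfolding eps_nbhd_def by (intro closed_Collect_le continuous_intros)
  then have "eps_nbhd \<Omega> \<epsilon> \<in> sets borel" by (rule borel_closed)
  then have "(\<lambda>y. indicator (eps_nbhd \<Omega> \<epsilon>) y *\<^sub>R u y) \<in> borel_measurable borel"
    using sol by (simp add: dpp_solution_def borel_measurable_restrict_space_iff)
  moreover have "(\<lambda>y. indicator (eps_nbhd \<Omega> \<epsilon>) y *\<^sub>R u y) = v" by (auto simp: v_def)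
  ultimately show "v \<in> borel_measurable borel" by simp
  have "bounded (u ` eps_nbhd \<Omega> \<epsilon>)" using sol by (simp add: dpp_solution_def)
  then have "bounded (insert 0 (u ` eps_nbhd \<Omega> \<epsilon>))" by simp
  then show "bounded (range v)" by (rule bounded_subset) (auto simp: v_def)
  have near: "y \<in> eps_nbhd \<Omega> \<epsilon>" if "x \<in> \<Omega>" "dist y x \<le> \<epsilon>" for x y
    using infdist_le[OF that(1), of y] that(2) by (simp add: eps_nbhd_def)
  show v: "v x = u x" if "x \<in> \<Omega>" for x using near[OF that, of x] \<epsilon> by (simp add: v_def)
  fix x assume x: "x \<in> \<Omega>"
  have "turn_value v \<epsilon> (\<alpha> x) x \<nu> = \<alpha> x * u (x + \<nu>) + \<beta> x * orth_disc_average u \<epsilon> \<nu> x" if "\<nu> \<in> sphere 0 \<epsilon>" for \<nu>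
  proof -
    have "v (x + \<nu>) = u (x + \<nu>)" using near[OF x, of "x + \<nu>"] that by (simp add: v_def dist_norm)
    moreover have "orth_disc_average v \<epsilon> \<nu> x = orth_disc_average u \<epsilon> \<nu> x"
      by (rule orth_disc_average_cong) (use near[OF x] in \<open>simp add: v_def orth_disc_def dist_norm\<close>)
    moreover have "1 - \<alpha> x = \<beta> x" using \<beta> x by fastforce
    ultimately show ?thesis by (simp add: turn_value_def)
  qed
  then have "turn_value v \<epsilon> (\<alpha> x) x ` sphere 0 \<epsilon>
      = (\<lambda>\<nu>. \<alpha> x * u (x + \<nu>) + \<beta> x * orth_disc_average u \<epsilon> \<nu> x) ` sphere 0 \<epsilon>"
    by (rule image_cong[OF refl])
  then show "dpp_at v \<epsilon> (\<alpha> x) x"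
    using sol x v[OF x] unfolding dpp_at_def dpp_solution_def by simp
qed

section \<open>The Lipschitz estimate\<close>

lemma mid_diff: "mid a b - c = mid (a - c) (b - c)"
  by (simp add: mid_def algebra_simps flip: scaleR_add_left)

theorem theorem1p1:
  fixes \<alpha>min C\<alpha> s r M :: real
  assumes "CARD('n::finite) \<ge> 2"
    and "\<alpha>min > 0" and "C\<alpha> > 0" and "0 < s" and "s < 1" and "r > 0"
  shows "\<exists>C>0. \<forall>(\<Omega> :: (real ^ 'n) set) \<alpha> \<beta> x0 \<epsilon> u.
    open \<Omega> \<and> connected \<Omega> \<and> bounded \<Omega> \<and>
    (\<forall>x\<in>\<Omega>. \<alpha> x \<in> {0<..1} \<and> \<beta> x \<in> {0..<1} \<and> \<alpha> x + \<beta> x = 1) \<and>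
    (\<forall>x\<in>\<Omega>. \<alpha>min \<le> \<alpha> x \<and> \<alpha> x \<le> 1) \<and>
    (\<forall>x\<in>\<Omega>. \<forall>z\<in>\<Omega>. \<bar>\<alpha> x - \<alpha> z\<bar> \<le> C\<alpha> * dist x z powr s) \<and>
    x0 \<in> \<Omega> \<and> ball x0 (2 * r) \<subseteq> \<Omega> \<and> \<epsilon> > 0 \<and>
    dpp_solution \<Omega> \<epsilon> \<alpha> \<beta> u \<and>
    (SUP y\<in>ball x0 (2 * r). \<bar>u y\<bar>) = M
    \<longrightarrow> (\<forall>x\<in>ball x0 r. \<forall>z\<in>ball x0 r. \<bar>u x - u z\<bar> \<le> C * (dist x z + \<epsilon>))"
proof -
  define p where "p = s / 2"
  have p: "0 < p" "p \<le> 1/2" "2 * p = s" using assms by (simp_all add: p_def)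
  define m where "m = min \<alpha>min 1"
  have m: "0 < m" "m \<le> 1" using assms by (simp_all add: m_def)
  define \<rho> where "\<rho> = min r 1 / 2"
  have \<rho>: "0 < \<rho>" "\<rho> \<le> 1/2" "2 * \<rho> \<le> r" using assms by (simp_all add: \<rho>_def)
  define \<tau> where "\<tau> = min \<rho> ((1/4) powr (1 / p))"
  have \<tau>: "\<tau> > 0" "\<tau> \<le> \<rho>" using \<rho> by (simp_all add: \<tau>_def)
  have \<tau>p: "\<tau> powr p \<le> 1/4"
  proof -
    have "\<tau> powr p \<le> ((1/4) powr (1 / p)) powr p" using \<tau> p by (intro powr_mono2) (auto simp: \<tau>_def)
    then show ?thesis using p by (simp add: powr_powr)
  qed
  have dim: "DIM(real ^ 'n) \<ge> 2" using assms(1) by simp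
  define M' where "M' = \<bar>M\<bar>"
  have M': "M' \<ge> 0" by (simp add: M'_def)
  obtain L N C where L: "L \<ge> 1" and C: "C > 0" and loc:
    "\<And>\<epsilon> (u :: real ^ 'n \<Rightarrow> real) \<alpha> y0 x z. \<epsilon> > 0 \<Longrightarrow> u \<in> borel_measurable borel \<Longrightarrow> bounded (range u) \<Longrightarrow>
      (\<forall>w\<in>ball y0 (\<rho> + \<tau> / 2). \<bar>u w\<bar> \<le> M' \<and> dpp_at u \<epsilon> (\<alpha> w) w \<and> m \<le> \<alpha> w \<and> \<alpha> w \<le> 1) \<Longrightarrow>
      (\<forall>w\<in>ball y0 (\<rho> + \<tau> / 2). \<forall>v\<in>ball y0 (\<rho> + \<tau> / 2). \<bar>\<alpha> w - \<alpha> v\<bar> \<le> C\<alpha> * norm (w - v) powr (2 * p)) \<Longrightarrow>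
      norm (mid x z - y0) < \<rho> \<Longrightarrow> norm (x - z) < \<tau> \<Longrightarrow> u x - u z \<le> C * barrier p L N \<epsilon> \<rho> y0 x z"
    using local_comparison[OF dim m less_imp_le[OF assms(3)] p(1,2) \<rho>(1,2) \<tau>(1) \<tau>p M'] by blast
  define S where "S = stair L N N"
  have S: "S \<ge> 0" unfolding S_def using L by (intro stair_nonneg) auto
  define C1 where "C1 = C * (1 + S) / (\<rho>\<^sup>2)\<^sup>2"
  define C2 where "C2 = 2 * M' / \<tau>"
  have C12: "C1 > 0" "C2 \<ge> 0" using C S \<rho> M' \<tau> by (simp_all add: C1_def C2_def)
  show ?thesis
  proof (rule exI[of _ "C1 + C2"], intro conjI allI impI ballI)
    show "C1 + C2 > 0" using C12 by simp
    fix \<Omega> :: "(real ^ 'n) set" and \<alpha> \<beta> u :: "real ^ 'n \<Rightarrow> real" and x0 x z :: "real ^ 'n" and \<epsilon> :: real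
    assume H: "open \<Omega> \<and> connected \<Omega> \<and> bounded \<Omega> \<and>
      (\<forall>x\<in>\<Omega>. \<alpha> x \<in> {0<..1} \<and> \<beta> x \<in> {0..<1} \<and> \<alpha> x + \<beta> x = 1) \<and>
      (\<forall>x\<in>\<Omega>. \<alpha>min \<le> \<alpha> x \<and> \<alpha> x \<le> 1) \<and>
      (\<forall>x\<in>\<Omega>. \<forall>z\<in>\<Omega>. \<bar>\<alpha> x - \<alpha> z\<bar> \<le> C\<alpha> * dist x z powr s) \<and>
      x0 \<in> \<Omega> \<and> ball x0 (2 * r) \<subseteq> \<Omega> \<and> \<epsilon> > 0 \<and>
      dpp_solution \<Omega> \<epsilon> \<alpha> \<beta> u \<and>
      (SUP y\<in>ball x0 (2 * r). \<bar>u y\<bar>) = M"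
      and xz: "x \<in> ball x0 r" "z \<in> ball x0 r"
    have \<epsilon>: "\<epsilon> > 0" and sol: "dpp_solution \<Omega> \<epsilon> \<alpha> \<beta> u" and sub: "ball x0 (2 * r) \<subseteq> \<Omega>"
      and \<alpha>\<beta>: "\<forall>x\<in>\<Omega>. \<alpha> x + \<beta> x = 1" and \<alpha>: "\<And>x. x \<in> \<Omega> \<Longrightarrow> \<alpha>min \<le> \<alpha> x \<and> \<alpha> x \<le> 1"
      and hol: "\<And>x z. x \<in> \<Omega> \<Longrightarrow> z \<in> \<Omega> \<Longrightarrow> \<bar>\<alpha> x - \<alpha> z\<bar> \<le> C\<alpha> * dist x z powr s"
      and sup: "(SUP y\<in>ball x0 (2 * r). \<bar>u y\<bar>) = M"
      using H by blast+
    define v where "v = (\<lambda>y. if y \<in> eps_nbhd \<Omega> \<epsilon> then u y else 0)"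
    note v = dpp_solution_truncate[OF sol \<epsilon> \<alpha>\<beta>, folded v_def]
    have vu: "v y = u y" if "y \<in> \<Omega>" for y using v(3)[OF that] by (simp add: v_def)
    have uM: "\<bar>u y\<bar> \<le> M'" if "y \<in> ball x0 (2 * r)" for y
    proof -
      obtain B where B: "\<And>y. \<bar>v y\<bar> \<le> B" using v(2) by (auto simp: bounded_iff)
      have "bdd_above ((\<lambda>y. \<bar>u y\<bar>) ` ball x0 (2 * r))"
      proof (rule bdd_aboveI2)
        fix y assume "y \<in> ball x0 (2 * r)"
        then show "\<bar>u y\<bar> \<le> B" using B[of y] vu[of y] sub by auto
      qed
      then have "\<bar>u y\<bar> \<le> (SUP y\<in>ball x0 (2 * r). \<bar>u y\<bar>)" using that by (intro cSUP_upper)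
      then show ?thesis using sup by (simp add: M'_def)
    qed
    have t0: "dist x z \<ge> 0" by simp
    have one: "u x' - u z' \<le> C1 * (dist x z + \<epsilon>)"
      if xz': "x' \<in> ball x0 r" "z' \<in> ball x0 r" and d: "dist x' z' = dist x z" and "dist x z < \<tau>" for x' z'
    proof -
      define y0 where "y0 = mid x' z'"
      have y0: "dist x0 y0 < r"
      proof -
        have "y0 - x0 = mid (x' - x0) (z' - x0)" by (simp add: y0_def mid_diff)
        then have "norm (y0 - x0) \<le> (norm (x' - x0) + norm (z' - x0)) / 2"
          using norm_triangle_ineq[of "x' - x0" "z' - x0"] by (simp add: mid_def)
        then show ?thesis using xz' by (simp add: dist_norm norm_minus_commute)
      qed
      have inb: "w \<in> ball x0 (2 * r)" "w \<in> \<Omega>" if "w \<in> ball y0 (\<rho> + \<tau> / 2)" for w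
      proof -
        have "dist x0 w < 2 * r" using dist_triangle[of x0 w y0] y0 that \<rho> \<tau> by simp
        then show "w \<in> ball x0 (2 * r)" by simp
        then show "w \<in> \<Omega>" using sub by blast
      qed
      have "v x' - v z' \<le> C * barrier p L N \<epsilon> \<rho> y0 x' z'"
      proof (rule loc[OF \<epsilon> v(1,2)])
        show "\<forall>w\<in>ball y0 (\<rho> + \<tau> / 2). \<bar>v w\<bar> \<le> M' \<and> dpp_at v \<epsilon> (\<alpha> w) w \<and> m \<le> \<alpha> w \<and> \<alpha> w \<le> 1"
          using inb vu v(4) uM \<alpha> by (force simp: m_def)
        show "\<forall>w\<in>ball y0 (\<rho> + \<tau> / 2). \<forall>v\<in>ball y0 (\<rho> + \<tau> / 2). \<bar>\<alpha> w - \<alpha> v\<bar> \<le> C\<alpha> * norm (w - v) powr (2 * p)"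
          using inb hol by (simp add: p(3) dist_norm)
        show "norm (mid x' z' - y0) < \<rho>" using \<rho> by (simp add: y0_def)
        show "norm (x' - z') < \<tau>" using that by (simp add: dist_norm)
      qed
      also have "\<dots> = C * pair_mod p L N \<epsilon> (dist x z) / (\<rho>\<^sup>2)\<^sup>2"
        using d by (simp add: barrier_def weight_def y0_def dist_norm)
      also have "\<dots> \<le> C * ((1 + S) * (dist x z + \<epsilon>)) / (\<rho>\<^sup>2)\<^sup>2"
      proof (intro divide_right_mono mult_left_mono)
        have "pair_mod p L N \<epsilon> (dist x z) \<le> dist x z + \<epsilon> * S"
          unfolding S_def by (rule pair_mod_upper) (use L \<epsilon> in auto)
        also have "\<dots> \<le> dist x z + \<epsilon> * S + \<epsilon> + S * dist x z" using \<epsilon> mult_nonneg_nonneg[OF S t0] by linarith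
        also have "\<dots> = (1 + S) * (dist x z + \<epsilon>)" by (simp add: algebra_simps)
        finally show "pair_mod p L N \<epsilon> (dist x z) \<le> (1 + S) * (dist x z + \<epsilon>)" .
      qed (use C in auto)
      also have "\<dots> = C1 * (dist x z + \<epsilon>)" by (simp add: C1_def)
      finally have "v x' - v z' \<le> C1 * (dist x z + \<epsilon>)" .
      moreover have "x' \<in> \<Omega>" "z' \<in> \<Omega>" using xz' sub assms(6) by auto
      ultimately show ?thesis using vu by simp
    qed
    \<comment> \<open>points at distance at least \<open>\<tau>\<close> are handled by the bound on \<open>u\<close> alone\<close>
    show "\<bar>u x - u z\<bar> \<le> (C1 + C2) * (dist x z + \<epsilon>)"
    proof (cases "dist x z < \<tau>")
      case True
      have "\<bar>u x - u z\<bar> \<le> C1 * (dist x z + \<epsilon>)"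
        using one[OF xz refl True] one[OF xz(2,1) dist_commute True] by (simp add: abs_le_iff)
      also have "\<dots> \<le> (C1 + C2) * (dist x z + \<epsilon>)" using C12 \<epsilon> t0 by (intro mult_right_mono) auto
      finally show ?thesis .
    next
      case False
      have "\<bar>u x\<bar> \<le> M'" "\<bar>u z\<bar> \<le> M'" using uM xz assms(6) by auto
      then have "\<bar>u x - u z\<bar> \<le> C2 * \<tau>" using \<tau> by (simp add: C2_def)
      also have "\<dots> \<le> (C1 + C2) * (dist x z + \<epsilon>)" using C12 False \<epsilon> \<tau> by (intro mult_mono) auto
      finally show ?thesis .
    qed
  qed
qed

end
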